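(* Let $\omega=dy_1\wedge dy_2$ on $\mathbb{R}^4$ (coordinates $(y_1,y_2,y_3,y_4)$). For every $\lambda<2$ there exists a finite distortion $\omega$-curve $f:\mathbb{R}^2\to\mathbb{R}^4$, with distortion function $K_f$, such that $f\in W^{1,2}_{loc}(\mathbb{R}^2,\mathbb{R}^4)$ and $\exp(\lambda K_f)\in L^1_{loc}(\mathbb{R}^2)$, but $f$ does not have Lusin's (N) property.
   Context: Let $n\le m$ and let $\Omega\subset\mathbb{R}^n$ be a domain. An $n$-volume form on $\mathbb{R}^m$ is a smooth, non-vanishing, closed differential $n$-form $\omega$. Its pointwise comass norm is $\|\omega\|(p)=\sup\{|\omega_p(v_1,\dots,v_n)|: v_1,\dots,v_n\in\mathbb{R}^m,\ |v_i|\le 1\}$. For a Sobolev map $f$, $\star f^*\omega$ denotes the real-valued function with $(\star f^*\omega)\,dx_1\wedge\dots\wedge dx_n=f^*\omega$ (pullback computed with weak derivatives). $|Df(x)|$ is the operator norm of the weak differential. Finite distortion $\omega$-curve: a map $f\in W^{1,1}_{loc}(\Omega,\mathbb{R}^m)$ such that $\star f^*\omega\in L^1_{loc}(\Omega)$ and there is a measurable function $K_f\ge 1$, finite almost everywhere (the distortion function), with $(\|\omega\|\circ f)(x)\,|Df(x)|^n\le K_f(x)\,(\star f^*\omega)(x)$ for almost every $x\in\Omega$. Lusin's (N) property for a map $f:\Omega\subset\mathbb{R}^n\to\mathbb{R}^m$: $f$ maps sets of zero $n$-dimensional Lebesgue measure to sets of zero $n$-dimensional measure, where in $\mathbb{R}^m$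 the $n$-dimensional measure is the Hausdorff measure $\mathcal{H}^n$. *)

theory Defs
  imports "HOL-Analysis.Analysis"
begin

definition domain :: "('a::euclidean_space) set \<Rightarrow> bool" where
  "domain \<Omega> \<longleftrightarrow> open \<Omega> \<and> connected \<Omega> \<and> \<Omega> \<noteq> {}"

text \<open>The set \<open>S\<close> is meant to be open in the next two definitions.\<close>

primrec Ck_on :: "nat \<Rightarrow> 'a::euclidean_space set \<Rightarrow> ('a \<Rightarrow> 'b::real_normed_vector) \<Rightarrow> bool" where
  "Ck_on 0 S f \<longleftrightarrow> continuous_on S f"
| "Ck_on (Suc k) S f \<longleftrightarrow> (\<forall>x\<in>S. f differentiable (at x)) \<and>
     (\<forall>b\<in>Basis. Ck_on k S (\<lambda>x. frechet_derivative f (at x) b))"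

definition smooth_on :: "'a::euclidean_space set \<Rightarrow> ('a \<Rightarrow> 'b::real_normed_vector) \<Rightarrow> bool" where
  "smooth_on S f \<longleftrightarrow> (\<forall>k. Ck_on k S f)"

definition test_function :: "'a::euclidean_space set \<Rightarrow> ('a \<Rightarrow> real) \<Rightarrow> bool" where
  "test_function \<Omega> \<phi> \<longleftrightarrow> smooth_on UNIV \<phi> \<and>
     (\<exists>C. compact C \<and> C \<subseteq> \<Omega> \<and> (\<forall>x. x \<notin> C \<longrightarrow> \<phi> x = 0))"


text \<open>
  A differential \<open>n\<close>-form on \<open>\<real>\<^sup>m\<close>, where \<open>n = CARD('n)\<close> and \<open>m = CARD('m)\<close>, is a function
  \<open>\<omega> p v\<close> of a point \<open>p\<close> and of an \<open>'n\<close>-indexed tuple \<open>v\<close> of vectors.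
\<close>

type_synonym ('m, 'n) form = "real^'m \<Rightarrow> real^'m^'n \<Rightarrow> real"

definition alternating_multilinear :: "(real^'m^'n \<Rightarrow> real) \<Rightarrow> bool" where
  "alternating_multilinear \<alpha> \<longleftrightarrow>
     (\<forall>i v. linear (\<lambda>x. \<alpha> (\<chi> j. if j = i then x else v $ j))) \<and>
     (\<forall>i j v. i \<noteq> j \<and> v $ i = v $ j \<longrightarrow> \<alpha> v = 0)"

text \<open>
  The exterior derivative at the \<open>n+1\<close> vectors \<open>v\<^sub>0, v\<^sub>1, \<dots>, v\<^sub>n\<close>.  In the usual formula
  the summand for \<open>i \<ge> 1\<close> is \<open>(-1)\<^sup>i\<close> times the derivative in direction \<open>v\<^sub>i\<close> of
  \<open>\<omega>(v\<^sub>0, \<dots>, v\<^sub>n)\<close> with \<open>v\<^sub>i\<close> omitted.  Moving \<open>v\<^sub>0\<close> to the place of \<open>v\<^sub>i\<close> costs the sign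
  \<open>(-1)\<^sup>i\<^sup>-\<^sup>1\<close>, so that each of these summands carries the total sign \<open>-1\<close> and no
  ordering of the index type is needed.
\<close>

definition ext_deriv :: "('m::finite, 'n::finite) form \<Rightarrow> real^'m \<Rightarrow> real^'m \<Rightarrow> real^'m^'n \<Rightarrow> real" where
  "ext_deriv \<omega> p v0 v =
     frechet_derivative (\<lambda>q. \<omega> q v) (at p) v0 -
     (\<Sum>i\<in>UNIV. frechet_derivative (\<lambda>q. \<omega> q (\<chi> j. if j = i then v0 else v $ j)) (at p) (v $ i))"

definition volume_form :: "('m::finite, 'n::finite) form \<Rightarrow> bool" where
  "volume_form \<omega> \<longleftrightarrow>
     (\<forall>p. alternating_multilinear (\<omega> p)) \<and>
     (\<forall>v. smooth_on UNIV (\<lambda>p. \<omega> p v)) \<and>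
     (\<forall>p. \<exists>v. \<omega> p v \<noteq> 0) \<and>
     (\<forall>p v0 v. ext_deriv \<omega> p v0 v = 0)"

definition comass :: "('m::finite, 'n::finite) form \<Rightarrow> real^'m \<Rightarrow> real" where
  "comass \<omega> p = (SUP v\<in>{v. \<forall>i. norm (v $ i) \<le> 1}. \<bar>\<omega> p v\<bar>)"

text \<open>
  The form \<open>dy\<^sub>1 \<and> dy\<^sub>2\<close> on \<open>\<real>\<^sup>4\<close>, with the convention that it takes the value \<open>1\<close> on
  the first two standard basis vectors.
\<close>

definition dy1_dy2 :: "(4, 2) form" where
  "dy1_dy2 p v = v $ 1 $ 1 * v $ 2 $ 2 - v $ 1 $ 2 * v $ 2 $ 1"


definition Lp_loc :: "real \<Rightarrow> 'a::euclidean_space set \<Rightarrow> ('a \<Rightarrow> 'b::euclidean_space) \<Rightarrow> bool" where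
  "Lp_loc p \<Omega> f \<longleftrightarrow> (\<forall>C. compact C \<and> C \<subseteq> \<Omega> \<longrightarrow>
     set_borel_measurable lebesgue C f \<and> set_integrable lebesgue C (\<lambda>x. norm (f x) powr p))"

text \<open>\<open>D x\<close> is the Jacobian matrix: the entry \<open>D x $ j $ i\<close> is \<open>\<partial>f\<^sub>j/\<partial>x\<^sub>i\<close>.\<close>

definition weak_derivative :: "(real^'n) set \<Rightarrow> (real^'n \<Rightarrow> real^'m) \<Rightarrow> (real^'n \<Rightarrow> real^'n^'m) \<Rightarrow> bool" where
  "weak_derivative \<Omega> f D \<longleftrightarrow> Lp_loc 1 \<Omega> f \<and> Lp_loc 1 \<Omega> D \<and>
     (\<forall>\<phi> i j. test_function \<Omega> \<phi> \<longrightarrow>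
        set_lebesgue_integral lebesgue \<Omega> (\<lambda>x. f x $ j * frechet_derivative \<phi> (at x) (axis i 1)) =
        - set_lebesgue_integral lebesgue \<Omega> (\<lambda>x. D x $ j $ i * \<phi> x))"

definition W1p_loc :: "real \<Rightarrow> (real^'n) set \<Rightarrow> (real^'n \<Rightarrow> real^'m) \<Rightarrow> bool" where
  "W1p_loc p \<Omega> f \<longleftrightarrow> (\<exists>D. weak_derivative \<Omega> f D \<and> Lp_loc p \<Omega> f \<and> Lp_loc p \<Omega> D)"

text \<open>The coefficient of \<open>f\<^sup>*\<omega>\<close>, that is, its value on the standard basis of \<open>\<real>\<^sup>n\<close>.\<close>

definition star_pullback ::
  "('m::finite, 'n::finite) form \<Rightarrow> (real^'n \<Rightarrow> real^'m) \<Rightarrow> (real^'n \<Rightarrow> real^'n^'m) \<Rightarrow> real^'n \<Rightarrow> real" where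
  "star_pullback \<omega> f D x = \<omega> (f x) (\<chi> i. D x *v axis i 1)"

text \<open>
  The weak derivative \<open>D\<close> is unique up to null sets, on which none of the conditions
  below depends.  The distortion function takes values in \<open>[1,\<infinity>]\<close>.
\<close>

definition finite_distortion_curve ::
  "(real^'n) set \<Rightarrow> ('m::finite, 'n::finite) form \<Rightarrow> (real^'n \<Rightarrow> real^'m) \<Rightarrow> (real^'n \<Rightarrow> ereal) \<Rightarrow> bool" where
  "finite_distortion_curve \<Omega> \<omega> f K \<longleftrightarrow>
     domain \<Omega> \<and> volume_form \<omega> \<and> W1p_loc 1 \<Omega> f \<and>
     K \<in> borel_measurable (lebesgue_on \<Omega>) \<and> (\<forall>x\<in>\<Omega>. 1 \<le> K x) \<and>
     (AE x in lebesgue_on \<Omega>. K x < \<infinity>) \<and>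
     (\<exists>D. weak_derivative \<Omega> f D \<and> Lp_loc 1 \<Omega> (star_pullback \<omega> f D) \<and>
        (AE x in lebesgue_on \<Omega>.
           ereal (comass \<omega> (f x) * onorm ((*v) (D x)) ^ CARD('n)) \<le> K x * ereal (star_pullback \<omega> f D x)))"


definition hausdorff_premeasure :: "nat \<Rightarrow> real \<Rightarrow> 'a::metric_space set \<Rightarrow> ennreal" where
  "hausdorff_premeasure n \<delta> A =
     (INF U\<in>{U :: nat \<Rightarrow> 'a set. A \<subseteq> (\<Union>k. U k) \<and> (\<forall>k. bounded (U k) \<and> diameter (U k) \<le> \<delta>)}.
        \<Sum>k. if U k = {} then 0 else ennreal (unit_ball_vol (real n) * (diameter (U k) / 2) ^ n))"

definition hausdorff_measure :: "nat \<Rightarrow> 'a::metric_space set \<Rightarrow> ennreal" where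
  "hausdorff_measure n A = (SUP \<delta>\<in>{0<..}. hausdorff_premeasure n \<delta> A)"

text \<open>
  This is a property of the function itself and not of its class modulo null sets.  For a
  Sobolev map it is meaningful only for a fixed representative, such as the continuous one.
\<close>

definition lusin_N :: "(real^'n) set \<Rightarrow> (real^'n \<Rightarrow> real^'m) \<Rightarrow> bool" where
  "lusin_N \<Omega> f \<longleftrightarrow>
     (\<forall>E. E \<subseteq> \<Omega> \<and> E \<in> null_sets lebesgue \<longrightarrow> hausdorff_measure CARD('n) (f ` E) = 0)"


lemma smooth_on_const: "smooth_on S (\<lambda>_. c)"
proof -
  have "Ck_on k S (\<lambda>_. c)" for k
    by (induction k arbitrary: c) auto
  then show ?thesis
    by (simp add: smooth_on_def)
qed

lemma volume_form_dy1_dy2: "volume_form dy1_dy2"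
  unfolding volume_form_def
proof (intro conjI allI)
  fix p :: "real^4"
  have "linear (\<lambda>x. dy1_dy2 p (\<chi> j. if j = i then x else v $ j))" for i v
  proof (cases "i = 1")
    case True
    then show ?thesis
      by (intro linearI) (simp_all add: dy1_dy2_def algebra_simps)
  next
    case False
    then have "i = 2"
      using exhaust_2 by blast
    then show ?thesis
      by (intro linearI) (simp_all add: dy1_dy2_def algebra_simps)
  qed
  moreover have "dy1_dy2 p v = 0" if "i \<noteq> j" "v $ i = v $ j" for i j v
  proof -
    have "v $ 1 = v $ 2"
      using that exhaust_2[of i] exhaust_2[of j] by metis
    then show ?thesis
      by (simp add: dy1_dy2_def)
  qed
  ultimately show "alternating_multilinear (dy1_dy2 p)"
    unfolding alternating_multilinear_def by blast
next
  fix v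
  show "smooth_on UNIV (\<lambda>p. dy1_dy2 p v)"
    unfolding dy1_dy2_def by (rule smooth_on_const)
next
  fix p
  have "dy1_dy2 p (\<chi> i. if i = 1 then axis 1 1 else axis 2 1) = 1"
    by (simp add: dy1_dy2_def axis_def)
  then show "\<exists>v. dy1_dy2 p v \<noteq> 0"
    by (metis zero_neq_one)
next
  fix p v0 v
  show "ext_deriv dy1_dy2 p v0 v = 0"
    by (simp add: ext_deriv_def dy1_dy2_def)
qed

end

theory Submission
  imports Defs
begin

text \<open>
  The first two coordinates of the map are a sum of radial stretchings \<open>c P(\<bar>x - a\<bar>\<^sup>2) (x - a)\<close> with
  singularities near finitely many centres \<open>a\<close> at each of infinitely many scales. Their
  differentials are symmetric and positive, and the condition that the largest eigenvalue is
  at most \<open>\<kappa>\<close> times the smallest one defines a convex cone, so the distortion of the sum is at most the supremum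
  of the distortions of the summands. The latter are \<open>1 + 2 b log\<^sup>+(R/\<bar>x - a\<bar>)\<close> with \<open>b\<close> slightly
  less than \<open>1/\<lambda>\<close>, hence exponentially integrable. Because \<open>\<lambda> < 2\<close> allows \<open>b > 1/2\<close>, the operator norm
  of the differential of a stretching, although square integrable, is not integrable along rays.
  There is therefore a bump function which has height \<open>1\<close>, an arbitrarily small support, and a
  gradient bounded by a small multiple of this operator norm. The last two coordinates are sums of
  such bumps, which add the binary digits of a point of the square; they cost only a factor
  \<open>1 + 8 \<epsilon>\<^sup>2\<close> in the distortion, and on a Cantor set of measure zero they take all values in the unit
  square \<open>[0,1)\<^sup>2\<close>.
\<close>

text \<open>What shapes the construction is the order in which its parameters can be chosen. The (N
  k)^2 stretchings of scale \<open>k\<close> are felt on the whole plane, so their amplitudes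
  \<open>c k\<close> are taken as small as 2^(-k) / (N k)^2. A bump controlled by such a weak
  stretching can only have a tiny gradient, and the radius \<open>R k * sqrt (\<tau> k)\<close> of
  its plateau gets no lower bound in advance. Hence no global estimate may depend on
  \<open>\<tau> k\<close>: energies and exponential integrals are bounded uniformly in it, and the
  next grid is refined afterwards, until the points addressed by further digits stay on the plateau.
  The same \<open>\<tau> k\<close> is added to the squared radius. This removes the singularity of
  each summand, which is then classically differentiable, and only the infinite sum needs a weak
  derivative. The supremum of the distortions of infinitely many summands is replaced by the
  logarithm of a sum of exponentials, whose integrability follows disc by disc from the small total
  area.\<close>

section \<open>Weak derivatives of series\<close>

text \<open>Difference quotients of \<open>\<psi>\<close> in direction \<open>e\<close> have
  integral 0 by translation invariance. By the mean value theorem they are bounded by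
  \<open>M\<close>, and with steps at most 1 they live in one ball, so dominated convergence passes
  to the derivative. Its measurability comes from the pointwise convergence.\<close>

lemma integral_directional_derivative_eq_0:
  fixes \<psi> :: "'a::euclidean_space \<Rightarrow> real"
  assumes der: "\<And>x. (\<psi> has_derivative \<psi>' x) (at x)"
    and bnd: "\<And>x. \<bar>\<psi>' x e\<bar> \<le> M"
    and zero: "\<And>x. norm x > r \<Longrightarrow> \<psi> x = 0"
  shows "integrable lborel (\<lambda>x. \<psi>' x e)" and "(\<integral>x. \<psi>' x e \<partial>lborel) = 0"
proof -
  define h where "h n = 1 / real (Suc n)" for n
  have h: "0 < h n" "h n \<le> 1" for n
    by (auto simp: h_def)
  have h0: "h \<longlonglongrightarrow> 0"
    unfolding h_def by (rule LIMSEQ_Suc[OF lim_1_over_n])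
  define q where "q n x = (\<psi> (h n *\<^sub>R e + x) - \<psi> x) / h n" for n x
  have cont: "continuous_on UNIV \<psi>"
    by (rule has_derivative_continuous_on[where f' = \<psi>']) (use der in simp)
  then have meas[measurable]: "\<psi> \<in> borel_measurable borel"
    by (rule borel_measurable_continuous_onI)
  have line: "((\<lambda>s. \<psi> (s *\<^sub>R e + x)) has_real_derivative \<psi>' (s *\<^sub>R e + x) e) (at s)" for s x
  proof -
    have "((\<lambda>s. \<psi> (s *\<^sub>R e + x)) has_derivative (\<lambda>t. \<psi>' (s *\<^sub>R e + x) (t *\<^sub>R e))) (at s)"
      by (rule has_derivative_compose[OF _ der]) (auto intro!: derivative_eq_intros)
    moreover have "\<psi>' (s *\<^sub>R e + x) (t *\<^sub>R e) = \<psi>' (s *\<^sub>R e + x) e * t" for t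
      using der[of "s *\<^sub>R e + x"] by (simp add: has_derivative_def bounded_linear.linear linear_cmul)
    ultimately show ?thesis
      by (simp add: has_field_derivative_def)
  qed
  have qlim: "(\<lambda>n. q n x) \<longlonglongrightarrow> \<psi>' x e" for x
  proof -
    have "((\<lambda>t. (\<psi> (t *\<^sub>R e + x) - \<psi> x) / t) \<longlongrightarrow> \<psi>' x e) (at 0)"
      using line[of x 0] by (simp add: DERIV_def)
    then show ?thesis
      unfolding q_def
      by (rule filterlim_compose[where g = "\<lambda>t. (\<psi> (t *\<^sub>R e + x) - \<psi> x) / t"])
         (use h(1) h0 in \<open>auto simp: filterlim_at intro!: always_eventually less_imp_neq[symmetric]\<close>)
  qed
  have qbnd: "\<bar>q n x\<bar> \<le> M" for n x
  proof -
    obtain z where "\<psi> (h n *\<^sub>R e + x) - \<psi> (0 *\<^sub>R e + x) = (h n - 0) * \<psi>' (z *\<^sub>R e + x) e"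
      using MVT2[of 0 "h n", OF h(1) line] by blast
    then have "q n x = \<psi>' (z *\<^sub>R e + x) e"
      using h(1)[of n] by (simp add: q_def field_simps)
    then show ?thesis
      using bnd by simp
  qed
  define w where "w x = M * indicator (cball (0::'a) (r + norm e)) x" for x
  have M: "M \<ge> 0"
    using bnd[of 0] by linarith
  have "integrable lborel (\<lambda>x. indicator (cball (0::'a) (r + norm e)) x :: real)"
    by (intro integrable_real_indicator emeasure_lborel_cball_finite) auto
  then have w: "integrable lborel w"
    unfolding w_def by (rule integrable_mult_right)
  have qw: "norm (q n x) \<le> w x" for n x
  proof (cases "x \<in> cball 0 (r + norm e)")
    case True
    then show ?thesis using qbnd by (simp add: w_def)
  next
    case False
    then have 1: "norm x > r + norm e"
      by simp
    then have 2: "norm x > r"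
      using norm_ge_zero[of e] by linarith
    have "norm x - norm (h n *\<^sub>R e) \<le> norm (x + h n *\<^sub>R e)"
      by (rule norm_diff_ineq)
    moreover have "norm (h n *\<^sub>R e) \<le> norm e"
      using h[of n] by (simp add: mult_left_le_one_le)
    ultimately have "norm (h n *\<^sub>R e + x) > r"
      using 1 by (simp add: add.commute)
    then show ?thesis
      using zero 2 M by (simp add: q_def w_def)
  qed
  have mq[measurable]: "q n \<in> borel_measurable borel" for n
    unfolding q_def by measurable
  have m': "(\<lambda>x. \<psi>' x e) \<in> borel_measurable lborel"
    by (rule borel_measurable_LIMSEQ_real[of _ q]) (use qlim in auto)
  note dc = m' _ w AE_I2[OF qlim] AE_I2[OF qw]
  show "integrable lborel (\<lambda>x. \<psi>' x e)"
    by (rule integrable_dominated_convergence[OF dc]) simp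
  have lim: "(\<lambda>n. \<integral>x. q n x \<partial>lborel) \<longlonglongrightarrow> (\<integral>x. \<psi>' x e \<partial>lborel)"
    by (rule integral_dominated_convergence[OF dc]) simp
  obtain B where B: "\<And>x. x \<in> cball 0 r \<Longrightarrow> norm (\<psi> x) \<le> B"
    using compact_continuous_image[OF continuous_on_subset[OF cont subset_UNIV] compact_cball, THEN compact_imp_bounded]
    unfolding bounded_iff by (metis image_eqI)
  have int\<psi>: "integrable lborel \<psi>"
  proof (rule Bochner_Integration.integrable_bound)
    show "integrable lborel (\<lambda>x. \<bar>B\<bar> * indicator (cball (0::'a) r) x)"
      by (intro integrable_mult_right integrable_real_indicator emeasure_lborel_cball_finite) auto
    show "AE x in lborel. norm (\<psi> x) \<le> norm (\<bar>B\<bar> * indicator (cball (0::'a) r) x)"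
      using B zero by (intro AE_I2) (force simp: indicator_def not_le)
  qed simp
  have "(\<integral>x. q n x \<partial>lborel) = 0" for n
  proof -
    have i1: "integrable (distr lborel borel ((+) (h n *\<^sub>R e))) \<psi>"
      by (simp add: lborel_distr_plus int\<psi>)
    then have i2: "integrable lborel (\<lambda>x. \<psi> (h n *\<^sub>R e + x))"
      by (subst (asm) integrable_distr_eq) auto
    have "(\<integral>x. \<psi> (h n *\<^sub>R e + x) \<partial>lborel) = (\<integral>x. \<psi> x \<partial>distr lborel borel ((+) (h n *\<^sub>R e)))"
      by (subst integral_distr) auto
    then have "(\<integral>x. \<psi> (h n *\<^sub>R e + x) \<partial>lborel) = (\<integral>x. \<psi> x \<partial>lborel)"
      by (simp add: lborel_distr_plus)
    then show ?thesis
      using i2 int\<psi> by (simp add: q_def)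
  qed
  then show "(\<integral>x. \<psi>' x e \<partial>lborel) = 0"
    using LIMSEQ_unique[OF lim] by simp
qed

lemma test_functionD:
  fixes \<phi> :: "'a::euclidean_space \<Rightarrow> real"
  assumes "test_function \<Omega> \<phi>"
  obtains r where "r > 0" "\<And>x. norm x > r \<Longrightarrow> \<phi> x = 0"
    "\<And>x. norm x > r \<Longrightarrow> frechet_derivative \<phi> (at x) = (\<lambda>_. 0)"
    "\<And>x. (\<phi> has_derivative frechet_derivative \<phi> (at x)) (at x)"
    "\<And>e. e \<in> Basis \<Longrightarrow> continuous_on UNIV (\<lambda>x. frechet_derivative \<phi> (at x) e)"
proof -
  from assms obtain C where C: "compact C" "\<And>x. x \<notin> C \<Longrightarrow> \<phi> x = 0" and "Ck_on (Suc 0) UNIV \<phi>"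
    unfolding test_function_def smooth_on_def by blast
  then have d: "\<And>x. \<phi> differentiable (at x)"
    and c: "\<And>e. e \<in> Basis \<Longrightarrow> continuous_on UNIV (\<lambda>x. frechet_derivative \<phi> (at x) e)"
    by auto
  obtain r where r: "r > 0" "\<And>x. x \<in> C \<Longrightarrow> norm x \<le> r"
    using compact_imp_bounded[OF C(1)] unfolding bounded_pos by blast
  then have z: "\<phi> x = 0" if "norm x > r" for x
    using C(2) that by force
  have "frechet_derivative \<phi> (at x) = (\<lambda>_. 0)" if "norm x > r" for x
  proof -
    have "open {x::'a. norm x > r}"
      by (intro open_Collect_less continuous_intros)
    then have "(\<phi> has_derivative (\<lambda>_. 0)) (at x)"
      by (rule has_derivative_transform_within_open[OF has_derivative_const[of 0]]) (use that z in auto)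
    then show ?thesis
      by (metis frechet_derivative_at)
  qed
  then show thesis
    using that[of r] r(1) z c d frechet_derivative_works by blast
qed

lemma continuous_bounded_on_cball:
  fixes f :: "'a::euclidean_space \<Rightarrow> 'b::real_normed_vector"
  assumes "continuous_on UNIV f"
  obtains B where "B \<ge> 0" "\<And>x. norm x \<le> r \<Longrightarrow> norm (f x) \<le> B"
proof -
  have "bounded (f ` cball 0 r)"
    by (intro compact_imp_bounded compact_continuous_image continuous_on_subset[OF assms]) auto
  then obtain B where "B > 0" "\<forall>x\<in>cball 0 r. norm (f x) \<le> B"
    unfolding bounded_pos by auto
  then show thesis
    by (intro that[of B]) auto
qed

text \<open>The product rule for \<open>u * \<phi>\<close>, whose directional derivative is bounded
  with bounded support and therefore integrates to 0.\<close>

lemma integration_by_parts_test_function: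
  fixes u :: "'a::euclidean_space \<Rightarrow> real"
  assumes \<phi>: "test_function \<Omega> \<phi>" and e: "e \<in> Basis"
    and der: "\<And>x. (u has_derivative u' x) (at x)"
    and bnd: "\<And>r. \<exists>B. \<forall>x. norm x \<le> r \<longrightarrow> \<bar>u' x e\<bar> \<le> B"
    and meas[measurable]: "(\<lambda>x. u' x e) \<in> borel_measurable borel"
  shows "integrable lborel (\<lambda>x. u x * frechet_derivative \<phi> (at x) e)"
    and "integrable lborel (\<lambda>x. u' x e * \<phi> x)"
    and "(\<integral>x. u x * frechet_derivative \<phi> (at x) e \<partial>lborel) = - (\<integral>x. u' x e * \<phi> x \<partial>lborel)"
proof -
  define \<phi>' where "\<phi>' x = frechet_derivative \<phi> (at x)" for x
  from \<phi> obtain r where r: "r > 0" "\<And>x. norm x > r \<Longrightarrow> \<phi> x = 0" "\<And>x. norm x > r \<Longrightarrow> \<phi>' x = (\<lambda>_. 0)"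
    "\<And>x. (\<phi> has_derivative \<phi>' x) (at x)" and c'0: "\<And>e. e \<in> Basis \<Longrightarrow> continuous_on UNIV (\<lambda>x. \<phi>' x e)"
    unfolding \<phi>'_def by (rule test_functionD) metis
  note c' = c'0[OF e]
  have cu: "continuous_on UNIV u"
    by (rule has_derivative_continuous_on[where f' = u']) (use der in simp)
  have c\<phi>: "continuous_on UNIV \<phi>"
    by (rule has_derivative_continuous_on[where f' = \<phi>']) (use r(4) in simp)
  note [measurable] = borel_measurable_continuous_onI[OF cu] borel_measurable_continuous_onI[OF c\<phi>]
    borel_measurable_continuous_onI[OF c']
  obtain Bu where Bu: "Bu \<ge> 0" "\<And>x. norm x \<le> r \<Longrightarrow> norm (u x) \<le> Bu"
    by (rule continuous_bounded_on_cball[OF cu]) blast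
  obtain B\<phi> where B\<phi>: "B\<phi> \<ge> 0" "\<And>x. norm x \<le> r \<Longrightarrow> norm (\<phi> x) \<le> B\<phi>"
    by (rule continuous_bounded_on_cball[OF c\<phi>]) blast
  obtain B' where B': "B' \<ge> 0" "\<And>x. norm x \<le> r \<Longrightarrow> norm (\<phi>' x e) \<le> B'"
    by (rule continuous_bounded_on_cball[OF c']) blast
  obtain B where B: "\<And>x. norm x \<le> r \<Longrightarrow> \<bar>u' x e\<bar> \<le> B"
    using bnd by blast
  have B0: "B \<ge> 0"
    using B[of 0] r(1) by simp
  have I: "integrable lborel g" if "g \<in> borel_measurable borel" "\<And>x. norm x \<le> r \<Longrightarrow> \<bar>g x\<bar> \<le> N"
    "\<And>x. norm x > r \<Longrightarrow> g x = 0" for g :: "'a \<Rightarrow> real" and N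
  proof (rule Bochner_Integration.integrable_bound)
    show "integrable lborel (\<lambda>x. \<bar>N\<bar> * indicator (cball (0::'a) r) x)"
      by (intro integrable_mult_right integrable_real_indicator emeasure_lborel_cball_finite) auto
    show "AE x in lborel. norm (g x) \<le> norm (\<bar>N\<bar> * indicator (cball (0::'a) r) x)"
      using that(2,3) by (intro AE_I2) (force simp: indicator_def not_le)
  qed (use that in simp)
  have b1: "\<bar>u x * \<phi>' x e\<bar> \<le> Bu * B'" if "norm x \<le> r" for x
    using Bu B' that by (auto simp: abs_mult intro!: mult_mono)
  have b2: "\<bar>u' x e * \<phi> x\<bar> \<le> B * B\<phi>" if "norm x \<le> r" for x
    using B B0 B\<phi> that by (auto simp: abs_mult intro!: mult_mono)
  show i1: "integrable lborel (\<lambda>x. u x * frechet_derivative \<phi> (at x) e)"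
    unfolding \<phi>'_def[symmetric] by (rule I[OF _ b1]) (use r in auto)
  show i2: "integrable lborel (\<lambda>x. u' x e * \<phi> x)"
    by (rule I[OF _ b2]) (use r in auto)
  have "(\<integral>x. u x * \<phi>' x e + u' x e * \<phi> x \<partial>lborel) = 0"
  proof (rule integral_directional_derivative_eq_0(2)[where \<psi> = "\<lambda>x. u x * \<phi> x" and \<psi>' = "\<lambda>x v. u x * \<phi>' x v + u' x v * \<phi> x" and e = e])
    show "((\<lambda>x. u x * \<phi> x) has_derivative (\<lambda>v. u x * \<phi>' x v + u' x v * \<phi> x)) (at x)" for x
      by (rule has_derivative_mult[OF der r(4)])
    show "\<bar>u x * \<phi>' x e + u' x e * \<phi> x\<bar> \<le> Bu * B' + B * B\<phi>" for x
    proof (cases "norm x \<le> r")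
      case True
      then show ?thesis
        using b1[of x] b2[of x] by linarith
    next
      case False
      then show ?thesis
        using r Bu B' B0 B\<phi> by (simp add: not_le)
    qed
  qed (use r in auto)
  then show "(\<integral>x. u x * frechet_derivative \<phi> (at x) e \<partial>lborel) = - (\<integral>x. u' x e * \<phi> x \<partial>lborel)"
    using i1 i2 by (simp add: \<phi>'_def)
qed

text \<open>The estimates below concern Borel functions over \<open>lborel\<close>; this is the
  passage to the completion \<open>lebesgue\<close>. A compact set lies in some ball about
  0.\<close>

lemma Lp_locI:
  fixes f :: "'a::euclidean_space \<Rightarrow> 'b::euclidean_space"
  assumes [measurable]: "f \<in> borel_measurable borel"
    and fin: "\<And>r. (\<integral>\<^sup>+x\<in>cball 0 r. ennreal (norm (f x) powr p) \<partial>lborel) < \<infinity>"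
  shows "Lp_loc p \<Omega> f"
  unfolding Lp_loc_def
proof (intro allI impI conjI)
  fix C :: "'a set"
  assume C: "compact C \<and> C \<subseteq> \<Omega>"
  then have [measurable]: "C \<in> sets borel"
    by (simp add: borel_compact)
  show "set_borel_measurable lebesgue C f"
    unfolding set_borel_measurable_def by (rule measurable_completion) measurable
  obtain r where r: "C \<subseteq> cball 0 r"
    using C compact_imp_bounded[of C] unfolding bounded_iff by (auto simp: subset_iff)
  have "integrable lborel (\<lambda>x. indicator C x *\<^sub>R (norm (f x) powr p))"
  proof (rule integrableI_bounded)
    have "(\<integral>\<^sup>+x. ennreal (norm (indicator C x *\<^sub>R (norm (f x) powr p))) \<partial>lborel)
        \<le> (\<integral>\<^sup>+x\<in>cball 0 r. ennreal (norm (f x) powr p) \<partial>lborel)"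
      using r by (intro nn_integral_mono) (auto simp: indicator_def)
    then show "(\<integral>\<^sup>+x. ennreal (norm (indicator C x *\<^sub>R (norm (f x) powr p))) \<partial>lborel) < \<infinity>"
      using fin[of r] by (rule le_less_trans)
  qed measurable
  then show "set_integrable lebesgue C (\<lambda>x. norm (f x) powr p)"
    unfolding set_integrable_def by (intro integrable_completion[THEN iffD2]) auto
qed

lemma nn_integral_cball_bounded:
  fixes g :: "'a::euclidean_space \<Rightarrow> real"
  assumes "\<And>x. norm x \<le> r \<Longrightarrow> g x \<le> B"
  shows "(\<integral>\<^sup>+x\<in>cball 0 r. ennreal (g x) \<partial>lborel) \<le> ennreal B * emeasure lborel (cball (0::'a) r)"
    and "ennreal B * emeasure lborel (cball (0::'a) r) < \<infinity>"
proof -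
  have "(\<integral>\<^sup>+x\<in>cball 0 r. ennreal (g x) \<partial>lborel) \<le> (\<integral>\<^sup>+x. ennreal B * indicator (cball (0::'a) r) x \<partial>lborel)"
    using assms by (intro nn_integral_mono) (auto simp: indicator_def ennreal_leI)
  also have "\<dots> = ennreal B * emeasure lborel (cball (0::'a) r)"
    by (rule nn_integral_cmult_indicator) simp
  finally show "(\<integral>\<^sup>+x\<in>cball 0 r. ennreal (g x) \<partial>lborel) \<le> ennreal B * emeasure lborel (cball (0::'a) r)" .
  show "ennreal B * emeasure lborel (cball (0::'a) r) < \<infinity>"
    using emeasure_lborel_cball_finite[of "0::'a" r] by (simp add: ennreal_mult_less_top)
qed

lemma Lp_loc_continuous:
  fixes f :: "'a::euclidean_space \<Rightarrow> 'b::euclidean_space"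
  assumes f: "continuous_on UNIV f" and p: "p > 0"
  shows "Lp_loc p \<Omega> f"
proof (rule Lp_locI)
  show "f \<in> borel_measurable borel"
    by (rule borel_measurable_continuous_onI[OF f])
  fix r
  obtain B where B: "B \<ge> 0" "\<And>x. norm x \<le> r \<Longrightarrow> norm (f x) \<le> B"
    by (rule continuous_bounded_on_cball[OF f]) blast
  have "norm (f x) powr p \<le> B powr p" if "norm x \<le> r" for x
    using B(2)[OF that] p by (intro powr_mono2) auto
  from nn_integral_cball_bounded[OF this]
  show "(\<integral>\<^sup>+x\<in>cball 0 r. ennreal (norm (f x) powr p) \<partial>lborel) < \<infinity>"
    by (rule le_less_trans)
qed

lemma AE_finite_if_locally_integrable:
  fixes G :: "'a::euclidean_space \<Rightarrow> ennreal"
  assumes meas: "G \<in> borel_measurable borel"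
    and fin: "\<And>r. (\<integral>\<^sup>+x\<in>cball 0 r. G x \<partial>lborel) < \<infinity>"
  shows "AE x in lborel. G x \<noteq> \<infinity>"
proof -
  have "AE x in lborel. G x * indicator (cball 0 (real n)) x \<noteq> \<infinity>" for n
  proof (rule nn_integral_noteq_infinite)
    show "(\<lambda>x. G x * indicator (cball 0 (real n)) x) \<in> borel_measurable lborel"
      using meas by (intro borel_measurable_times_ennreal borel_measurable_indicator) auto
  qed (rule less_imp_neq[OF fin])
  then have "AE x in lborel. \<forall>n. G x * indicator (cball 0 (real n)) x \<noteq> \<infinity>"
    unfolding AE_all_countable by blast
  then show ?thesis
  proof eventually_elim
    case (elim x)
    obtain n where "norm x \<le> real n"
      using real_arch_simple by blast
    with elim[rule_format, of n] show ?case
      by simp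
  qed
qed

text \<open>Each term is integrated by parts, and sum and integral commute on both sides: the
  functions converge uniformly on balls, their derivatives absolutely in L^1 on balls. The bound on
  a single \<open>DF k\<close> may depend on \<open>k\<close>, since it serves only the integration
  by parts. On the null set without absolute convergence the value of \<open>suminf\<close> is
  irrelevant.\<close>

theorem weak_derivative_suminf:
  fixes F :: "nat \<Rightarrow> real^'n \<Rightarrow> real^'m" and DF :: "nat \<Rightarrow> real^'n \<Rightarrow> real^'n^'m"
  assumes der: "\<And>k x. (F k has_derivative (\<lambda>v. DF k x *v v)) (at x)"
    and meas[measurable]: "\<And>k. DF k \<in> borel_measurable borel"
    and bnd: "\<And>k r. \<exists>B. \<forall>x. norm x \<le> r \<longrightarrow> norm (DF k x) \<le> B"
    and unif: "\<And>r. \<exists>M. summable M \<and> (\<forall>k x. norm x \<le> r \<longrightarrow> norm (F k x) \<le> M k)"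
    and int: "\<And>r. (\<Sum>k. \<integral>\<^sup>+x\<in>cball 0 r. ennreal (norm (DF k x)) \<partial>lborel) < \<infinity>"
  shows "continuous_on UNIV (\<lambda>x. \<Sum>k. F k x)"
    and "AE x in lborel. summable (\<lambda>k. norm (DF k x))"
    and "weak_derivative UNIV (\<lambda>x. \<Sum>k. F k x) (\<lambda>x. \<Sum>k. DF k x)"
proof -
  have contF: "continuous_on A (F k)" for k A
    by (rule has_derivative_continuous_on[where f' = "\<lambda>x v. DF k x *v v"])
       (use der has_derivative_at_withinI in blast)
  note [measurable] = borel_measurable_continuous_onI[OF contF]
  have sumF: "summable (\<lambda>k. norm (F k x))" for x
    using unif[of "norm x"] by (auto intro: summable_comparison_test')
  have "continuous_on (ball 0 r) (\<lambda>x. \<Sum>k. F k x)" for r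
  proof -
    obtain M where M: "summable M" "\<And>k x. norm x \<le> r \<Longrightarrow> norm (F k x) \<le> M k"
      using unif by metis
    have "uniform_limit (ball 0 r) (\<lambda>n x. \<Sum>k<n. F k x) (\<lambda>x. \<Sum>k. F k x) sequentially"
      by (rule Weierstrass_m_test[OF _ M(1)]) (use M(2) in auto)
    then show ?thesis
      by (rule uniform_limit_theorem[rotated]) (auto intro!: always_eventually continuous_intros contF)
  qed
  then have "isCont (\<lambda>x. \<Sum>k. F k x) x" for x
    by (rule continuous_on_interior[where S = "ball 0 (norm x + 1)"]) (simp add: interior_open)
  then show cont: "continuous_on UNIV (\<lambda>x. \<Sum>k. F k x)"
    by (simp add: continuous_at_imp_continuous_on)
  have int': "(\<integral>\<^sup>+x\<in>cball 0 r. (\<Sum>k. ennreal (norm (DF k x))) \<partial>lborel) < \<infinity>" for r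
  proof -
    have "(\<integral>\<^sup>+x\<in>cball 0 r. (\<Sum>k. ennreal (norm (DF k x))) \<partial>lborel)
        = (\<integral>\<^sup>+x. (\<Sum>k. ennreal (norm (DF k x)) * indicator (cball 0 r) x) \<partial>lborel)"
      by (intro nn_integral_cong) (rule ennreal_suminf_multc[symmetric])
    also have "\<dots> = (\<Sum>k. \<integral>\<^sup>+x\<in>cball 0 r. ennreal (norm (DF k x)) \<partial>lborel)"
      by (intro nn_integral_suminf borel_measurable_times_ennreal borel_measurable_indicator) auto
    finally show ?thesis
      using int by simp
  qed
  have "AE x in lborel. (\<Sum>k. ennreal (norm (DF k x))) \<noteq> \<infinity>"
    by (rule AE_finite_if_locally_integrable[OF _ int']) (intro borel_measurable_suminf_order, measurable)
  then show ae: "AE x in lborel. summable (\<lambda>k. norm (DF k x))"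
    by eventually_elim (intro summable_suminf_not_top, auto)
  have "Lp_loc 1 UNIV (\<lambda>x. \<Sum>k. DF k x)"
  proof (rule Lp_locI)
    fix r
    have "AE x in lborel. ennreal (norm (\<Sum>k. DF k x) powr 1) * indicator (cball 0 r) x
        \<le> (\<Sum>k. ennreal (norm (DF k x))) * indicator (cball 0 r) x"
      using ae
    proof eventually_elim
      case (elim x)
      then have "ennreal (norm (\<Sum>k. DF k x)) \<le> ennreal (\<Sum>k. norm (DF k x))"
        by (intro ennreal_leI summable_norm)
      also have "\<dots> = (\<Sum>k. ennreal (norm (DF k x)))"
        using elim by (subst suminf_ennreal2) auto
      finally show ?case
        by (auto simp: indicator_def)
    qed
    from nn_integral_mono_AE[OF this] int'[of r]
    show "(\<integral>\<^sup>+x\<in>cball 0 r. ennreal (norm (\<Sum>k. DF k x) powr 1) \<partial>lborel) < \<infinity>"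
      by (rule le_less_trans)
  qed measurable
  moreover have "set_lebesgue_integral lebesgue UNIV (\<lambda>x. (\<Sum>k. F k x) $ j * frechet_derivative \<phi> (at x) (axis i 1)) =
        - set_lebesgue_integral lebesgue UNIV (\<lambda>x. (\<Sum>k. DF k x) $ j $ i * \<phi> x)"
    if \<phi>: "test_function UNIV \<phi>" for \<phi> :: "real^'n \<Rightarrow> real" and i j
  proof -
    have e: "axis i (1::real) \<in> Basis"
      by simp
    define \<phi>' where "\<phi>' x = frechet_derivative \<phi> (at x) (axis i 1)" for x
    obtain r where r: "r > 0" "\<And>x. norm x > r \<Longrightarrow> \<phi> x = 0" "\<And>x. norm x > r \<Longrightarrow> \<phi>' x = 0"
      "\<And>x. (\<phi> has_derivative frechet_derivative \<phi> (at x)) (at x)" and c': "continuous_on UNIV \<phi>'"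
      unfolding \<phi>'_def[abs_def] by (rule test_functionD[OF \<phi>]) (use e in force)
    have c\<phi>: "continuous_on UNIV \<phi>"
      by (rule has_derivative_continuous_on[where f' = "\<lambda>x. frechet_derivative \<phi> (at x)"]) (use r(4) in simp)
    note [measurable] = borel_measurable_continuous_onI[OF c\<phi>] borel_measurable_continuous_onI[OF c']
    obtain B\<phi> where B\<phi>: "B\<phi> \<ge> 0" "\<And>x. norm x \<le> r \<Longrightarrow> norm (\<phi> x) \<le> B\<phi>"
      by (rule continuous_bounded_on_cball[OF c\<phi>]) blast
    obtain B' where B': "B' \<ge> 0" "\<And>x. norm x \<le> r \<Longrightarrow> norm (\<phi>' x) \<le> B'"
      by (rule continuous_bounded_on_cball[OF c']) blast
    have comp_le: "\<bar>A $ j $ i\<bar> \<le> norm A" for A :: "real^'n^'m"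
      using Finite_Cartesian_Product.norm_nth_le[of A j] component_le_norm_cart[of "A $ j" i] by linarith
    have derj: "((\<lambda>x. F k x $ j) has_derivative (\<lambda>v. (DF k x *v v) $ j)) (at x)" for k x
      by (rule bounded_linear.has_derivative[OF bounded_linear_vec_nth der])
    have DFij: "(DF k x *v axis i 1) $ j = DF k x $ j $ i" for k x
      by (simp add: matrix_vector_mul_component inner_axis)
    have [measurable]: "(\<lambda>x. DF k x $ j $ i) \<in> borel_measurable borel" for k
      by (rule borel_measurable_continuous_on[OF _ meas, where f = "\<lambda>A. A $ j $ i"]) (intro continuous_intros)
    have "\<exists>B. \<forall>x. norm x \<le> r \<longrightarrow> \<bar>(DF k x *v axis i 1) $ j\<bar> \<le> B" for k r
    proof -
      obtain B where "\<forall>x. norm x \<le> r \<longrightarrow> norm (DF k x) \<le> B"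
        using bnd by blast
      then have "\<forall>x. norm x \<le> r \<longrightarrow> \<bar>DF k x $ j $ i\<bar> \<le> B"
        using comp_le by (blast intro: order_trans)
      then show ?thesis
        unfolding DFij by blast
    qed
    note ibp = integration_by_parts_test_function[OF \<phi> e derj this, unfolded DFij, folded \<phi>'_def]
    obtain M where M: "summable M" "\<And>k x. norm x \<le> r \<Longrightarrow> norm (F k x) \<le> M k"
      using unif by metis
    have M0: "M k \<ge> 0" for k
      using order_trans[OF norm_ge_zero M(2)[of 0 k]] r(1) by simp
    define V where "V = measure lborel (cball (0::real^'n) r)"
    have V: "emeasure lborel (cball (0::real^'n) r) = ennreal V"
      unfolding V_def using emeasure_lborel_cball_finite[of "0::real^'n" r] by (intro emeasure_eq_ennreal_measure) auto
    have s1: "(\<integral>x. (\<Sum>k. F k x $ j * \<phi>' x) \<partial>lborel) = (\<Sum>k. \<integral>x. F k x $ j * \<phi>' x \<partial>lborel)"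
    proof (rule integral_suminf)
      show "integrable lborel (\<lambda>x. F k x $ j * \<phi>' x)" for k
        by (rule ibp(1)) measurable
      have sm: "summable (\<lambda>k. norm (F k x $ j * \<phi>' x))" for x
        by (rule summable_comparison_test'[OF summable_mult2[OF sumF[of x], of "\<bar>\<phi>' x\<bar>"], of 0])
           (auto simp: abs_mult intro!: mult_right_mono component_le_norm_cart)
      then show "AE x in lborel. summable (\<lambda>k. norm (F k x $ j * \<phi>' x))"
        by simp
      show "summable (\<lambda>k. \<integral>x. norm (F k x $ j * \<phi>' x) \<partial>lborel)"
      proof (rule summable_comparison_test'[OF summable_mult2[OF M(1), of "B' * V"], of 0])
        fix k
        have "(\<integral>x. norm (F k x $ j * \<phi>' x) \<partial>lborel) \<le> (\<integral>x. M k * B' * indicator (cball (0::real^'n) r) x \<partial>lborel)"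
        proof (rule integral_mono)
          show "integrable lborel (\<lambda>x. norm (F k x $ j * \<phi>' x))"
            by (intro integrable_norm ibp(1)) measurable
          show "integrable lborel (\<lambda>x. M k * B' * indicator (cball (0::real^'n) r) x)"
            by (intro integrable_mult_right integrable_real_indicator emeasure_lborel_cball_finite) auto
          show "norm (F k x $ j * \<phi>' x) \<le> M k * B' * indicator (cball 0 r) x" for x
          proof (cases "norm x \<le> r")
            case True
            have "\<bar>F k x $ j\<bar> \<le> M k"
              using component_le_norm_cart[of "F k x" j] M(2)[OF True, of k] by linarith
            then show ?thesis
              using True B'(2)[OF True] M0[of k] by (auto simp: abs_mult intro!: mult_mono)
          next
            case False
            then show ?thesis using r by simp
          qed
        qed
        also have "\<dots> = M k * (B' * V)"
          by (simp add: V_def)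
        finally show "norm (\<integral>x. norm (F k x $ j * \<phi>' x) \<partial>lborel) \<le> M k * (B' * V)"
          by simp
      qed
    qed
    have I: "integrable lborel (\<lambda>x. DF k x $ j $ i * \<phi> x)" for k
      by (rule ibp(2)) measurable
    have A: "AE x in lborel. summable (\<lambda>k. norm (DF k x $ j $ i * \<phi> x))"
      using ae
    proof eventually_elim
      case (elim x)
      show ?case
        by (rule summable_comparison_test'[OF summable_mult2[OF elim, of "\<bar>\<phi> x\<bar>"], of 0])
           (auto simp: abs_mult intro!: mult_right_mono comp_le)
    qed
    have S: "summable (\<lambda>k. \<integral>x. norm (DF k x $ j $ i * \<phi> x) \<partial>lborel)"
    proof (rule summable_suminf_not_top)
      have "(\<Sum>k. ennreal (\<integral>x. norm (DF k x $ j $ i * \<phi> x) \<partial>lborel))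
          \<le> (\<Sum>k. ennreal B\<phi> * (\<integral>\<^sup>+x\<in>cball 0 r. ennreal (norm (DF k x)) \<partial>lborel))"
      proof (intro suminf_le allI)
        fix k
        have "ennreal (\<integral>x. norm (DF k x $ j $ i * \<phi> x) \<partial>lborel) = (\<integral>\<^sup>+x. norm (DF k x $ j $ i * \<phi> x) \<partial>lborel)"
          by (intro nn_integral_eq_integral[symmetric] integrable_norm I) simp
        also have "\<dots> \<le> (\<integral>\<^sup>+x. ennreal B\<phi> * (ennreal (norm (DF k x)) * indicator (cball 0 r) x) \<partial>lborel)"
        proof (rule nn_integral_mono)
          fix x :: "real^'n"
          show "ennreal (norm (DF k x $ j $ i * \<phi> x)) \<le> ennreal B\<phi> * (ennreal (norm (DF k x)) * indicator (cball 0 r) x)"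
          proof (cases "norm x \<le> r")
            case True
            have "norm (DF k x $ j $ i * \<phi> x) \<le> B\<phi> * norm (DF k x)"
              using B\<phi>(2)[OF True] B\<phi>(1) comp_le[of "DF k x"]
              by (subst mult.commute) (auto simp: abs_mult intro!: mult_mono)
            then show ?thesis
              using True B\<phi>(1) by (simp add: ennreal_mult[symmetric] ennreal_leI)
          next
            case False
            then show ?thesis using r by simp
          qed
        qed
        also have "\<dots> = ennreal B\<phi> * (\<integral>\<^sup>+x\<in>cball 0 r. ennreal (norm (DF k x)) \<partial>lborel)"
          by (intro nn_integral_cmult borel_measurable_times_ennreal borel_measurable_indicator) auto
        finally show "ennreal (\<integral>x. norm (DF k x $ j $ i * \<phi> x) \<partial>lborel)
          \<le> ennreal B\<phi> * (\<integral>\<^sup>+x\<in>cball 0 r. ennreal (norm (DF k x)) \<partial>lborel)" .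
      qed auto
      also have "\<dots> = ennreal B\<phi> * (\<Sum>k. \<integral>\<^sup>+x\<in>cball 0 r. ennreal (norm (DF k x)) \<partial>lborel)"
        by (rule ennreal_suminf_cmult)
      also have "\<dots> < \<infinity>"
        using int[of r] by (simp add: ennreal_mult_less_top)
      finally show "(\<Sum>k. ennreal (\<integral>x. norm (DF k x $ j $ i * \<phi> x) \<partial>lborel)) \<noteq> top"
        by simp
    qed simp
    note s2 = integral_suminf[OF I A S] and sint = summable_integral[OF I A S]
    have mF: "(\<lambda>x. (\<Sum>k. F k x) $ j * \<phi>' x) \<in> borel_measurable lborel"
      using borel_measurable_continuous_onI[OF continuous_on_mult[OF continuous_on_component[OF cont] c']] by simp
    have "(\<lambda>x. \<Sum>k. DF k x) \<in> borel_measurable borel"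
      by measurable
    then have [measurable]: "(\<lambda>x. (\<Sum>k. DF k x) $ j $ i) \<in> borel_measurable borel"
      by (rule borel_measurable_continuous_on[rotated, where f = "\<lambda>A. A $ j $ i"]) (intro continuous_intros)
    have mD: "(\<lambda>x. (\<Sum>k. DF k x) $ j $ i * \<phi> x) \<in> borel_measurable lborel"
      by measurable
    have "set_lebesgue_integral lebesgue UNIV (\<lambda>x. (\<Sum>k. F k x) $ j * \<phi>' x) = (\<integral>x. (\<Sum>k. F k x) $ j * \<phi>' x \<partial>lborel)"
      unfolding set_lebesgue_integral_def by (simp add: integral_completion[OF mF])
    also have "\<dots> = (\<integral>x. (\<Sum>k. F k x $ j * \<phi>' x) \<partial>lborel)"
    proof (rule Bochner_Integration.integral_cong)
      fix x :: "real^'n"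
      have s: "summable (\<lambda>k. F k x)"
        by (rule summable_norm_cancel[OF sumF])
      show "(\<Sum>k. F k x) $ j * \<phi>' x = (\<Sum>k. F k x $ j * \<phi>' x)"
        by (simp add: bounded_linear.suminf[OF bounded_linear_vec_nth s]
          suminf_mult2[OF bounded_linear.summable[OF bounded_linear_vec_nth s]])
    qed simp
    also have "\<dots> = (\<Sum>k. - (\<integral>x. DF k x $ j $ i * \<phi> x \<partial>lborel))"
      unfolding s1 by (intro suminf_cong ibp(3)) measurable
    also have "\<dots> = - (\<Sum>k. \<integral>x. DF k x $ j $ i * \<phi> x \<partial>lborel)"
      by (rule suminf_minus[OF sint])
    also have "\<dots> = - (\<integral>x. (\<Sum>k. DF k x $ j $ i * \<phi> x) \<partial>lborel)"
      by (simp add: s2)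
    also have "(\<integral>x. (\<Sum>k. DF k x $ j $ i * \<phi> x) \<partial>lborel) = (\<integral>x. (\<Sum>k. DF k x) $ j $ i * \<phi> x \<partial>lborel)"
    proof (rule integral_cong_AE)
      show "AE x in lborel. (\<Sum>k. DF k x $ j $ i * \<phi> x) = (\<Sum>k. DF k x) $ j $ i * \<phi> x"
        using ae
      proof eventually_elim
        case (elim x)
        then have s: "summable (\<lambda>k. DF k x)"
          by (rule summable_norm_cancel)
        note s' = bounded_linear.summable[OF bounded_linear_vec_nth s]
        show ?case
          by (simp add: bounded_linear.suminf[OF bounded_linear_vec_nth s]
            bounded_linear.suminf[OF bounded_linear_vec_nth s']
            suminf_mult2[OF bounded_linear.summable[OF bounded_linear_vec_nth s']])
      qed
    qed measurable
    also have "(\<integral>x. (\<Sum>k. DF k x) $ j $ i * \<phi> x \<partial>lborel) = set_lebesgue_integral lebesgue UNIV (\<lambda>x. (\<Sum>k. DF k x) $ j $ i * \<phi> x)"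
      unfolding set_lebesgue_integral_def by (simp add: integral_completion[OF mD])
    finally show ?thesis
      unfolding \<phi>'_def .
  qed
  ultimately show "weak_derivative UNIV (\<lambda>x. \<Sum>k. F k x) (\<lambda>x. \<Sum>k. DF k x)"
    unfolding weak_derivative_def using Lp_loc_continuous[OF cont] by simp
qed

section \<open>Matrices of bounded distortion\<close>

text \<open>The eigenvalues of the symmetric upper block of \<open>D\<close> are half of
  \<open>trace2 D \<plusminus> aniso D\<close>, so their ratio is at most \<open>\<kappa>\<close> on the cone below. Unlike the
  bound on the ratio, the conditions defining the cone are visibly additive.\<close>

definition trace2 :: "real^2^4 \<Rightarrow> real" where
  "trace2 D = D $ 1 $ 1 + D $ 2 $ 2"

definition aniso :: "real^2^4 \<Rightarrow> real" where
  "aniso D = sqrt ((D $ 1 $ 1 - D $ 2 $ 2)\<^sup>2 + (2 * D $ 1 $ 2)\<^sup>2)"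

definition distortion_cone :: "real \<Rightarrow> real \<Rightarrow> (real^2^4) set" where
  "distortion_cone \<kappa> \<epsilon> = {D. D $ 2 $ 1 = D $ 1 $ 2 \<and> 0 \<le> trace2 D \<and>
     (\<kappa> + 1) * aniso D \<le> (\<kappa> - 1) * trace2 D \<and>
     norm (D $ 3) \<le> \<epsilon> * trace2 D \<and> norm (D $ 4) \<le> \<epsilon> * trace2 D}"

text \<open>\<open>aniso\<close> is the Euclidean norm of the vector (D11 - D22, 2 D12), which is
  linear in \<open>D\<close>.\<close>

lemma aniso_add: "aniso (D + E) \<le> aniso D + aniso E"
  using real_sqrt_sum_squares_triangle_ineq[of "D $ 1 $ 1 - D $ 2 $ 2" "E $ 1 $ 1 - E $ 2 $ 2" "2 * D $ 1 $ 2" "2 * E $ 1 $ 2"]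
  by (simp add: aniso_def algebra_simps)

lemma aniso_nonneg: "0 \<le> aniso D"
  by (simp add: aniso_def)

lemma zero_in_distortion_cone: "0 \<in> distortion_cone \<kappa> \<epsilon>"
  by (simp add: distortion_cone_def trace2_def aniso_def)

lemma add_in_distortion_cone:
  assumes D: "D \<in> distortion_cone \<kappa> \<epsilon>" and E: "E \<in> distortion_cone \<kappa> \<epsilon>" and \<kappa>: "1 \<le> \<kappa>"
  shows "D + E \<in> distortion_cone \<kappa> \<epsilon>"
proof -
  have tr: "trace2 (D + E) = trace2 D + trace2 E"
    by (simp add: trace2_def)
  have "(\<kappa> + 1) * aniso (D + E) \<le> (\<kappa> + 1) * (aniso D + aniso E)"
    using \<kappa> by (intro mult_left_mono aniso_add) simp
  also have "\<dots> \<le> (\<kappa> - 1) * trace2 (D + E)"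
    using D E unfolding tr by (simp add: distortion_cone_def distrib_left)
  finally show ?thesis
    using D E norm_triangle_ineq[of "D $ 3" "E $ 3"] norm_triangle_ineq[of "D $ 4" "E $ 4"]
    by (auto simp: distortion_cone_def tr algebra_simps)
qed

lemma sum_in_distortion_cone:
  assumes "\<And>i. i \<in> I \<Longrightarrow> D i \<in> distortion_cone \<kappa> \<epsilon>" and "1 \<le> \<kappa>"
  shows "(\<Sum>i\<in>I. D i) \<in> distortion_cone \<kappa> \<epsilon>"
  using assms
  by (induction I rule: infinite_finite_induct) (auto intro: zero_in_distortion_cone add_in_distortion_cone)

lemma closed_distortion_cone: "closed (distortion_cone \<kappa> \<epsilon>)"
  unfolding distortion_cone_def trace2_def aniso_def
  by (intro closed_Collect_conj closed_Collect_eq closed_Collect_le continuous_intros)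

lemma suminf_in_distortion_cone:
  assumes "\<And>k. D k \<in> distortion_cone \<kappa> \<epsilon>" and "1 \<le> \<kappa>" and "summable D"
  shows "(\<Sum>k. D k) \<in> distortion_cone \<kappa> \<epsilon>"
  by (rule closed_sequentially[OF closed_distortion_cone _ summable_LIMSEQ[OF assms(3)]])
     (rule sum_in_distortion_cone[OF assms(1,2)])

lemma aniso_le_trace2:
  assumes D: "D \<in> distortion_cone \<kappa> \<epsilon>" and \<kappa>: "1 \<le> \<kappa>"
  shows "aniso D \<le> trace2 D"
proof -
  have "(\<kappa> - 1) * trace2 D \<le> (\<kappa> + 1) * trace2 D"
    using D by (intro mult_right_mono) (auto simp: distortion_cone_def)
  then have "(\<kappa> + 1) * aniso D \<le> (\<kappa> + 1) * trace2 D"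
    using D by (auto simp: distortion_cone_def)
  then show ?thesis
    using \<kappa> by simp
qed

text \<open>Raising \<kappa> to \<kappa>' adds (\<kappa>' - \<kappa>) (trace2 D - aniso D) to the
  slack of the cone inequality, and this is nonnegative.\<close>

lemma distortion_cone_mono:
  assumes D: "D \<in> distortion_cone \<kappa> \<epsilon>" and \<kappa>: "1 \<le> \<kappa>" "\<kappa> \<le> \<kappa>'"
  shows "D \<in> distortion_cone \<kappa>' \<epsilon>"
proof -
  have "(\<kappa>' - \<kappa>) * aniso D \<le> (\<kappa>' - \<kappa>) * trace2 D"
    using aniso_le_trace2[OF D] \<kappa> by (intro mult_left_mono) auto
  then show ?thesis
    using D by (auto simp: distortion_cone_def algebra_simps)
qed

text \<open>|D11| + |D22| is the larger of |D11 + D22| and |D11 - D22|, hence at most the trace; so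
  are 2 |D12| and the norms of rows 3 and 4. The constant 6 is not sharp.\<close>

lemma norm_le_trace2:
  assumes D: "D \<in> distortion_cone \<kappa> \<epsilon>" and \<kappa>: "1 \<le> \<kappa>" and \<epsilon>: "\<epsilon> \<le> 1"
  shows "norm D \<le> 6 * trace2 D"
proof -
  have an: "aniso D \<le> trace2 D" and tr: "0 \<le> trace2 D"
    using aniso_le_trace2[OF D \<kappa>] D by (auto simp: distortion_cone_def)
  have 1: "\<bar>D $ 1 $ 1 - D $ 2 $ 2\<bar> \<le> aniso D" "\<bar>2 * D $ 1 $ 2\<bar> \<le> aniso D"
    unfolding aniso_def by (rule real_sqrt_ge_abs1 real_sqrt_ge_abs2)+
  have r1: "norm (D $ 1) \<le> \<bar>D $ 1 $ 1\<bar> + \<bar>D $ 1 $ 2\<bar>" and r2: "norm (D $ 2) \<le> \<bar>D $ 2 $ 1\<bar> + \<bar>D $ 2 $ 2\<bar>"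
    using norm_le_l1_cart[of "D $ 1"] norm_le_l1_cart[of "D $ 2"] by (auto simp: sum_2)
  have "\<epsilon> * trace2 D \<le> 1 * trace2 D"
    using tr \<epsilon> by (rule mult_right_mono[rotated])
  then have r3: "norm (D $ 3) \<le> trace2 D" "norm (D $ 4) \<le> trace2 D" and sym: "D $ 2 $ 1 = D $ 1 $ 2"
    using D by (auto simp: distortion_cone_def)
  have "norm D \<le> norm (D $ 1) + norm (D $ 2) + norm (D $ 3) + norm (D $ 4)"
    using L2_set_le_sum[of UNIV "\<lambda>i. norm (D $ i)"] by (simp add: norm_vec_def[of D] sum_4)
  then show ?thesis
    using r1 r2 r3 1 an sym unfolding trace2_def by argo
qed

text \<open>With trace T and anisotropy A the upper block has the eigenvalues (T + A)/2 and (T -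
  A)/2. The cone says T + A \<le> \<kappa> (T - A), so the square of the larger one is at most
  \<kappa> times the determinant. Rows 3 and 4 add at most 2 \<epsilon>^2 T^2, and T is at most
  twice the larger eigenvalue; this is the 8.\<close>

lemma onorm_le_distortion:
  assumes D: "D \<in> distortion_cone \<kappa> \<epsilon>" and \<kappa>: "1 \<le> \<kappa>"
  shows "(onorm ((*v) D))\<^sup>2 \<le> (1 + 8 * \<epsilon>\<^sup>2) * \<kappa> * (D $ 1 $ 1 * D $ 2 $ 2 - D $ 2 $ 1 * D $ 1 $ 2)"
proof -
  define a b d where "a = D $ 1 $ 1" and "b = D $ 1 $ 2" and "d = D $ 2 $ 2"
  define T A where "T = trace2 D" and "A = aniso D"
  have T: "T = a + d" "0 \<le> T" and sym: "D $ 2 $ 1 = b" and A0: "0 \<le> A"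
    and cone: "(\<kappa> + 1) * A \<le> (\<kappa> - 1) * T" and r3: "norm (D $ 3) \<le> \<epsilon> * T" and r4: "norm (D $ 4) \<le> \<epsilon> * T"
    using D
    by (auto simp: distortion_cone_def T_def A_def a_def b_def d_def trace2_def aniso_nonneg)
  have A2: "A\<^sup>2 = (a - d)\<^sup>2 + (2 * b)\<^sup>2"
    by (simp add: A_def aniso_def a_def b_def d_def)
  have det: "4 * (a * d - b * b) = (T + A) * (T - A)"
    using A2 by (simp add: T(1) power2_eq_square algebra_simps)
  have "T + A \<le> \<kappa> * (T - A)"
    using cone by (simp add: algebra_simps)
  then have "(T + A) * (T + A) \<le> (T + A) * (\<kappa> * (T - A))"
    using T A0 by (intro mult_left_mono) auto
  also have "\<dots> = \<kappa> * ((T + A) * (T - A))"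
    by (simp only: mult.left_commute)
  also have "\<dots> = 4 * (\<kappa> * (a * d - b * b))"
    unfolding det[symmetric] by simp
  finally have key: "((T + A) / 2)\<^sup>2 \<le> \<kappa> * (a * d - b * b)"
    by (simp add: power2_eq_square)
  define C where "C = (1 + 8 * \<epsilon>\<^sup>2) * \<kappa> * (a * d - b * b)"
  have C: "(1 + 8 * \<epsilon>\<^sup>2) * ((T + A) / 2)\<^sup>2 \<le> C"
    unfolding C_def mult.assoc by (intro mult_left_mono key) simp
  have C0: "0 \<le> C"
    by (rule order_trans[OF _ C]) simp
  have "norm (D *v v) \<le> sqrt C * norm v" for v
  proof -
    have ab: "(D *v v) $ 1 = a * v $ 1 + b * v $ 2" "(D *v v) $ 2 = b * v $ 1 + d * v $ 2"
      by (simp_all add: matrix_vector_mult_def sum_2 a_def b_def d_def sym)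
    have nv: "(norm v)\<^sup>2 = (v $ 1)\<^sup>2 + (v $ 2)\<^sup>2"
      by (simp add: norm_vec_def L2_set_def sum_2)
    have nD: "(norm (D *v v))\<^sup>2 = (a * v $ 1 + b * v $ 2)\<^sup>2 + (b * v $ 1 + d * v $ 2)\<^sup>2 + (D $ 3 \<bullet> v)\<^sup>2 + (D $ 4 \<bullet> v)\<^sup>2"
      by (simp add: norm_vec_def[of "D *v v"] L2_set_def sum_4 ab) (simp add: matrix_vector_mul_component)
    \<comment> \<open>The squared length of \<open>v\<close> times the cosine and the sine of twice
      its angle: in these the trace-free part of the quadratic form is linear, and Cauchy-Schwarz
      bounds it by \<open>A\<close>.\<close>
    define p q where "p = (v $ 1)\<^sup>2 - (v $ 2)\<^sup>2" and "q = 2 * v $ 1 * v $ 2"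
    have pq: "p\<^sup>2 + q\<^sup>2 = ((norm v)\<^sup>2)\<^sup>2"
      unfolding p_def q_def nv by (simp add: power2_eq_square algebra_simps)
    have "((a - d) * p + (2 * b) * q)\<^sup>2 + ((a - d) * q - (2 * b) * p)\<^sup>2 = (A * (norm v)\<^sup>2)\<^sup>2"
      unfolding power_mult_distrib[of A] A2 pq[symmetric] by (simp add: power2_eq_square algebra_simps)
    then have "((a - d) * p + (2 * b) * q)\<^sup>2 \<le> (A * (norm v)\<^sup>2)\<^sup>2"
      by (metis le_add_same_cancel1 zero_le_power2)
    then have cs: "(a - d) * p + (2 * b) * q \<le> A * (norm v)\<^sup>2"
      by (rule power2_le_imp_le) (use A0 in simp)
    \<comment> \<open>For the symmetric block B, |B v|^2 is the inner product of v with B^2 v, and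
      B^2 = T B - det B by Cayley-Hamilton.\<close>
    have "(a * v $ 1 + b * v $ 2)\<^sup>2 + (b * v $ 1 + d * v $ 2)\<^sup>2
        = T / 2 * ((a - d) * p + (2 * b) * q) + (T\<^sup>2 / 2 - (a * d - b * b)) * (norm v)\<^sup>2"
      unfolding nv p_def q_def T(1) by (simp add: power2_eq_square field_simps)
    also have "\<dots> \<le> T / 2 * (A * (norm v)\<^sup>2) + (T\<^sup>2 / 2 - (a * d - b * b)) * (norm v)\<^sup>2"
      by (intro add_right_mono mult_left_mono cs) (use T in simp)
    also have "a * d - b * b = (T + A) * (T - A) / 4"
      using det by simp
    also have "T / 2 * (A * (norm v)\<^sup>2) + (T\<^sup>2 / 2 - (T + A) * (T - A) / 4) * (norm v)\<^sup>2 = ((T + A) / 2)\<^sup>2 * (norm v)\<^sup>2"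
      by (simp add: power2_eq_square field_simps)
    finally have 12: "(a * v $ 1 + b * v $ 2)\<^sup>2 + (b * v $ 1 + d * v $ 2)\<^sup>2 \<le> ((T + A) / 2)\<^sup>2 * (norm v)\<^sup>2" .
    have row: "(r \<bullet> v)\<^sup>2 \<le> 4 * \<epsilon>\<^sup>2 * ((T + A) / 2)\<^sup>2 * (norm v)\<^sup>2" if "norm r \<le> \<epsilon> * T" for r
    proof -
      have "\<bar>r \<bullet> v\<bar> \<le> norm r * norm v"
        by (rule Cauchy_Schwarz_ineq2)
      also have "\<dots> \<le> (\<epsilon> * T) * norm v"
        using that by (rule mult_right_mono) simp
      finally have "(r \<bullet> v)\<^sup>2 \<le> ((\<epsilon> * T) * norm v)\<^sup>2"
        by (metis abs_ge_zero power2_abs power_mono)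
      also have "\<dots> = \<epsilon>\<^sup>2 * (T\<^sup>2 * (norm v)\<^sup>2)"
        by (simp add: power_mult_distrib)
      also have "\<dots> \<le> \<epsilon>\<^sup>2 * ((T + A)\<^sup>2 * (norm v)\<^sup>2)"
        using T A0 by (intro mult_left_mono mult_right_mono power_mono) auto
      finally show ?thesis
        by (simp add: power_divide)
    qed
    have "(norm (D *v v))\<^sup>2 \<le> (1 + 8 * \<epsilon>\<^sup>2) * ((T + A) / 2)\<^sup>2 * (norm v)\<^sup>2"
      unfolding nD using 12 row[OF r3] row[OF r4] by (simp add: algebra_simps)
    also have "\<dots> \<le> C * (norm v)\<^sup>2"
      using C by (rule mult_right_mono) simp
    also have "\<dots> = (sqrt C * norm v)\<^sup>2"
      using C0 by (simp add: power_mult_distrib)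
    finally show ?thesis
      by (rule power2_le_imp_le) (use C0 in simp)
  qed
  then have "onorm ((*v) D) \<le> sqrt C"
    by (intro onorm_le)
  then have "(onorm ((*v) D))\<^sup>2 \<le> (sqrt C)\<^sup>2"
    by (intro power_mono onorm_pos_le matrix_vector_mul_bounded_linear)
  then show ?thesis
    using C0 unfolding C_def a_def b_def d_def sym by simp
qed

section \<open>Comass and Jacobian for dy1 dy2\<close>

lemma comass_dy1_dy2_le: "comass dy1_dy2 p \<le> 1"
  unfolding comass_def
proof (rule cSUP_least)
  show "{v :: real^4^2. \<forall>i. norm (v $ i) \<le> 1} \<noteq> {}"
    by (auto intro!: exI[of _ 0])
next
  fix v :: "real^4^2"
  assume "v \<in> {v. \<forall>i. norm (v $ i) \<le> 1}"
  then have n: "(norm (v $ i))\<^sup>2 \<le> 1" for i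
    by (simp add: abs_square_le_1)
  have sq: "(v $ i $ 1)\<^sup>2 + (v $ i $ 2)\<^sup>2 \<le> 1" for i
  proof -
    have "(norm (v $ i))\<^sup>2 = (v $ i $ 1)\<^sup>2 + (v $ i $ 2)\<^sup>2 + (v $ i $ 3)\<^sup>2 + (v $ i $ 4)\<^sup>2"
      by (simp add: norm_vec_def[of "v $ i"] L2_set_def sum_4)
    then show ?thesis
      using n[of i] zero_le_power2[of "v $ i $ 3"] zero_le_power2[of "v $ i $ 4"] by linarith
  qed
  \<comment> \<open>Lagrange's identity: the two sides differ by the square of the inner product of
    the projected vectors.\<close>
  have "(dy1_dy2 p v)\<^sup>2 \<le> ((v $ 1 $ 1)\<^sup>2 + (v $ 1 $ 2)\<^sup>2) * ((v $ 2 $ 1)\<^sup>2 + (v $ 2 $ 2)\<^sup>2)"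
    using zero_le_power2[of "v $ 1 $ 1 * v $ 2 $ 1 + v $ 1 $ 2 * v $ 2 $ 2"]
    by (simp add: dy1_dy2_def power2_eq_square algebra_simps)
  also have "\<dots> \<le> 1"
    using sq[of 1] sq[of 2] by (intro mult_le_one) auto
  finally show "\<bar>dy1_dy2 p v\<bar> \<le> 1"
    by (simp add: abs_square_le_1)
qed

lemma star_pullback_dy1_dy2:
  "star_pullback dy1_dy2 f D x = D x $ 1 $ 1 * D x $ 2 $ 2 - D x $ 2 $ 1 * D x $ 1 $ 2"
  by (simp add: star_pullback_def dy1_dy2_def matrix_vector_mul_component inner_axis)

text \<open>The contraction sends a covering set \<open>U k\<close> into a closed ball of radius
  \<open>diameter (U k)\<close>, whose volume is 2^n times the summand of \<open>U k\<close>. The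
  volume of the ball in the image is thus at most 2^n times the premeasure. Accepting the crude
  factor 2^n avoids the isodiametric inequality and any measurability of \<open>S\<close>.\<close>

lemma hausdorff_measure_contraction_nonzero:
  fixes Q :: "'a::metric_space \<Rightarrow> 'b::euclidean_space"
  assumes lip: "\<And>x y. dist (Q x) (Q y) \<le> dist x y" and sub: "ball c r \<subseteq> Q ` S" and r: "r > 0"
  shows "hausdorff_measure DIM('b) S \<noteq> 0"
proof
  let ?n = "DIM('b)"
  assume "hausdorff_measure ?n S = 0"
  then have "hausdorff_premeasure ?n 1 S \<le> 0"
    unfolding hausdorff_measure_def by (metis SUP_upper greaterThan_iff zero_less_one)
  moreover have two: "(2 :: ennreal) ^ ?n = ennreal (2 ^ ?n)"
    by (simp add: ennreal_power[symmetric])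
  define e where "e = measure lborel (ball c r) / 2 ^ ?n"
  have e: "e > 0"
    using r by (simp add: e_def content_ball_pos)
  ultimately have "hausdorff_premeasure ?n 1 S < ennreal e"
    by (simp add: ennreal_less_zero_iff)
  then obtain U where U: "S \<subseteq> (\<Union>k. U k)" "\<And>k. bounded (U k)"
    and lt: "(\<Sum>k. if U k = {} then 0 else ennreal (unit_ball_vol (real ?n) * (diameter (U k) / 2) ^ ?n)) < ennreal e"
    unfolding hausdorff_premeasure_def INF_less_iff by auto
  define V where "V k = (if U k = {} then {} else cball (Q (SOME z. z \<in> U k)) (diameter (U k)))" for k
  have "ball c r \<subseteq> (\<Union>k. V k)"
  proof
    fix y assume "y \<in> ball c r"
    then obtain s k where s: "s \<in> U k" "y = Q s"
      using sub U(1) by blast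
    then have "(SOME z. z \<in> U k) \<in> U k"
      by (metis someI)
    then have "dist (SOME z. z \<in> U k) s \<le> diameter (U k)"
      using s U(2) by (intro diameter_bounded_bound)
    then have "y \<in> V k"
      using s lip[of "SOME z. z \<in> U k" s] by (auto simp: V_def)
    then show "y \<in> (\<Union>k. V k)"
      by blast
  qed
  then have "emeasure lborel (ball c r) \<le> emeasure lborel (\<Union>k. V k)"
    by (intro emeasure_mono) (auto simp: V_def)
  also have "\<dots> \<le> (\<Sum>k. emeasure lborel (V k))"
    by (intro emeasure_subadditive_countably) (auto simp: V_def)
  also have "\<dots> = (\<Sum>k. 2 ^ ?n * (if U k = {} then 0 else ennreal (unit_ball_vol (real ?n) * (diameter (U k) / 2) ^ ?n)))"
  proof (intro suminf_cong)
    fix k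
    have "emeasure lborel (V k) = 2 ^ ?n * ennreal (unit_ball_vol (real ?n) * (diameter (U k) / 2) ^ ?n)" if "U k \<noteq> {}"
    proof -
      have d: "diameter (U k) \<ge> 0"
        by (rule diameter_ge_0[OF U(2)])
      have "emeasure lborel (V k) = ennreal (unit_ball_vol (real ?n) * diameter (U k) ^ ?n)"
        using that d by (simp add: V_def emeasure_cball)
      also have "unit_ball_vol (real ?n) * diameter (U k) ^ ?n = 2 ^ ?n * (unit_ball_vol (real ?n) * (diameter (U k) / 2) ^ ?n)"
        by (simp add: power_divide)
      also have "ennreal \<dots> = 2 ^ ?n * ennreal (unit_ball_vol (real ?n) * (diameter (U k) / 2) ^ ?n)"
        using d by (subst ennreal_mult) (auto simp: ennreal_power[symmetric])
      finally show ?thesis .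
    qed
    then show "emeasure lborel (V k) = 2 ^ ?n * (if U k = {} then 0 else ennreal (unit_ball_vol (real ?n) * (diameter (U k) / 2) ^ ?n))"
      by (simp add: V_def)
  qed
  also have "\<dots> = 2 ^ ?n * (\<Sum>k. if U k = {} then 0 else ennreal (unit_ball_vol (real ?n) * (diameter (U k) / 2) ^ ?n))"
    by (rule ennreal_suminf_cmult)
  also have "\<dots> < 2 ^ ?n * ennreal e"
    using lt by (intro ennreal_mult_strict_left_mono) (auto simp: two)
  also have "\<dots> = ennreal (2 ^ ?n * e)"
    using e by (subst ennreal_mult) (auto simp: ennreal_power[symmetric])
  also have "2 ^ ?n * e = measure lborel (ball c r)"
    by (simp add: e_def)
  finally show False
    using emeasure_lborel_ball_finite[of c r] by (simp add: emeasure_eq_ennreal_measure less_top)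
qed

section \<open>The radial profile\<close>

text \<open>Dyadic discs instead of polar coordinates: the disc of radius R / 2^i has area pi R^2 /
  4^i, and the decreasing \<open>F\<close> is at most \<open>F (1 / 4 ^ Suc i)\<close> on the part
  of it assigned to \<open>i\<close>. The bound is independent of \<tau>, which matters because the
  shifts are chosen with no lower bound.\<close>

lemma nn_integral_ball_radial_le:
  fixes F :: "real \<Rightarrow> real" and c :: "real^2"
  assumes anti: "\<And>s t. 0 < s \<Longrightarrow> s \<le> t \<Longrightarrow> F t \<le> F s" and R: "0 < R" and \<tau>: "0 < \<tau>"
  shows "(\<integral>\<^sup>+x\<in>ball c R. ennreal (F ((norm (x - c) / R)\<^sup>2 + \<tau>)) \<partial>lborel)
    \<le> ennreal (pi * R\<^sup>2) * (\<Sum>i. ennreal (F (1 / 4 ^ Suc i) / 4 ^ i))"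
proof -
  let ?I = "\<lambda>i. indicator (cball c (R / 2 ^ i)) :: real^2 \<Rightarrow> ennreal"
  have "ennreal (F ((norm (x - c) / R)\<^sup>2 + \<tau>)) * indicator (ball c R) x
      \<le> (\<Sum>i. ennreal (F (1 / 4 ^ Suc i)) * ?I i x)" for x
  proof (cases "x \<in> ball c R")
    case True
    define y where "y = norm (x - c) / R"
    have y: "0 \<le> y" "y < 1"
      using True R by (auto simp: y_def dist_norm norm_minus_commute)
    \<comment> \<open>Such an index exists because of the shift \<tau>; minimality puts the point
      into the disc of radius R / 2^i.\<close>
    define i where "i = (LEAST i. 1 / 4 ^ Suc i \<le> y\<^sup>2 + \<tau>)"
    obtain n where "(1 / 4) ^ n < \<tau>"
      using real_arch_pow_inv[OF \<tau>, of "1 / 4"] by auto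
    then have "1 / 4 ^ Suc n \<le> y\<^sup>2 + \<tau>"
      using power_decreasing[of n "Suc n" "1 / 4 :: real"] zero_le_power2[of y]
      unfolding power_one_over by linarith
    then have i: "1 / 4 ^ Suc i \<le> y\<^sup>2 + \<tau>"
      unfolding i_def by (rule LeastI)
    have "y \<le> 1 / 2 ^ i"
    proof (cases i)
      case (Suc j)
      then have "\<not> 1 / 4 ^ Suc j \<le> y\<^sup>2 + \<tau>"
        using not_less_Least[of j "\<lambda>i. 1 / 4 ^ Suc i \<le> y\<^sup>2 + \<tau>"] by (simp add: i_def)
      then have "y\<^sup>2 < 1 / 4 ^ i"
        using \<tau> unfolding Suc by linarith
      also have "1 / 4 ^ i = (1 / 2 ^ i :: real)\<^sup>2"
        by (simp add: power_divide power_mult[symmetric] mult.commute[of i 2] power_mult)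
      finally show ?thesis
        by (rule power2_less_imp_less[THEN less_imp_le]) simp
    qed (use y in simp)
    then have xi: "x \<in> cball c (R / 2 ^ i)"
      using R by (simp add: y_def dist_norm norm_minus_commute field_simps)
    have "ennreal (F (y\<^sup>2 + \<tau>)) \<le> ennreal (F (1 / 4 ^ Suc i)) * ?I i x"
      using xi by (simp add: ennreal_leI anti i del: power_Suc)
    also have "\<dots> \<le> (\<Sum>i. ennreal (F (1 / 4 ^ Suc i)) * ?I i x)"
    proof -
      have "f i \<le> suminf f" for f :: "nat \<Rightarrow> ennreal"
        using sum_le_suminf[OF summableI, of "{i}" f] by simp
      then show ?thesis .
    qed
    finally show ?thesis
      using True by (simp add: y_def)
  qed simp
  then have "(\<integral>\<^sup>+x\<in>ball c R. ennreal (F ((norm (x - c) / R)\<^sup>2 + \<tau>)) \<partial>lborel)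
      \<le> (\<integral>\<^sup>+x. (\<Sum>i. ennreal (F (1 / 4 ^ Suc i)) * ?I i x) \<partial>lborel)"
    by (rule nn_integral_mono)
  also have "\<dots> = (\<Sum>i. \<integral>\<^sup>+x. ennreal (F (1 / 4 ^ Suc i)) * ?I i x \<partial>lborel)"
    by (intro nn_integral_suminf borel_measurable_times_ennreal borel_measurable_indicator) auto
  also have "\<dots> = (\<Sum>i. ennreal (pi * R\<^sup>2) * ennreal (F (1 / 4 ^ Suc i) / 4 ^ i))"
  proof (intro suminf_cong)
    fix i
    have "(\<integral>\<^sup>+x. ennreal (F (1 / 4 ^ Suc i)) * ?I i x \<partial>lborel)
        = ennreal (F (1 / 4 ^ Suc i)) * emeasure lborel (cball c (R / 2 ^ i))"
      by (rule nn_integral_cmult_indicator) simp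
    also have "emeasure lborel (cball c (R / 2 ^ i)) = ennreal (pi * R\<^sup>2 / 4 ^ i)"
      using R by (simp add: emeasure_cball unit_ball_vol_2 power_divide power_mult[symmetric] mult.commute[of i 2])
        (simp add: power_mult)
    also have "ennreal (F (1 / 4 ^ Suc i)) * ennreal (pi * R\<^sup>2 / 4 ^ i)
        = ennreal (F (1 / 4 ^ Suc i) * (pi * R\<^sup>2 / 4 ^ i))"
      by (rule ennreal_mult''[symmetric]) simp
    also have "\<dots> = ennreal ((pi * R\<^sup>2) * (F (1 / 4 ^ Suc i) / 4 ^ i))"
      by (simp add: field_simps)
    also have "\<dots> = ennreal (pi * R\<^sup>2) * ennreal (F (1 / 4 ^ Suc i) / 4 ^ i)"
      by (rule ennreal_mult') simp
    finally show "(\<integral>\<^sup>+x. ennreal (F (1 / 4 ^ Suc i)) * ?I i x \<partial>lborel)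
      = ennreal (pi * R\<^sup>2) * ennreal (F (1 / 4 ^ Suc i) / 4 ^ i)" .
  qed
  also have "\<dots> = ennreal (pi * R\<^sup>2) * (\<Sum>i. ennreal (F (1 / 4 ^ Suc i) / 4 ^ i))"
    by (rule ennreal_suminf_cmult)
  finally show ?thesis .
qed

text \<open>Freezing \<open>E\<close> at its value at 0 creates no corner because E' vanishes there.
  In the variable s = ln t this makes all profiles constant for t \<ge> 1 without any
  mollification.\<close>

lemma has_real_derivative_min_0:
  fixes E :: "real \<Rightarrow> real"
  assumes der: "\<And>s. s \<le> 0 \<Longrightarrow> (E has_real_derivative E' s) (at s)" and zero: "E' 0 = 0"
  shows "((\<lambda>u. E (min 0 u)) has_real_derivative E' (min 0 u)) (at u)"
proof (cases u "0::real" rule: linorder_cases)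
  case less
  have "((\<lambda>u. E (min 0 u)) has_real_derivative E' u) (at u)"
    by (rule has_field_derivative_transform_within[OF der[of u], of "- u"]) (use less in \<open>auto simp: dist_real_def min_def\<close>)
  then show ?thesis
    using less by (simp add: min_def)
next
  case greater
  have "((\<lambda>u. E (min 0 u)) has_real_derivative 0) (at u)"
    by (rule has_field_derivative_transform_within[OF DERIV_const[of "E 0"], of u]) (use greater in \<open>auto simp: dist_real_def min_def\<close>)
  then show ?thesis
    using greater zero by (simp add: min_def)
next
  case equal
  have "((\<lambda>h. (E (0 + h) - E 0) / h) \<longlongrightarrow> 0) (at 0)"
    using der[of 0] zero by (simp add: DERIV_def)
  then have "((\<lambda>h. (E (min 0 (0 + h)) - E (min 0 0)) / h) \<longlongrightarrow> 0) (at 0)"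
    by (rule Lim_null_comparison[rotated, OF tendsto_rabs_zero]) (auto intro!: always_eventually simp: min_def)
  then show ?thesis
    using equal zero by (simp add: DERIV_def)
qed

locale stretching_profile =
  fixes b :: real
  assumes b: "1 / 2 < b" "b < 1"
begin

definition \<kappa> :: "real \<Rightarrow> real" where
  "\<kappa> t = 1 - b * min 0 (ln t)"

text \<open>The solution of Q' / Q = - (1 - 1 / (1 - b s)) / 2 with Q 0 = 1. For s = ln t this
  equation prescribes that the radial stretching is the tangential one divided by
  \<open>\<kappa> t\<close>.\<close>

definition Q :: "real \<Rightarrow> real" where
  "Q s = exp (- s / 2) * (1 - b * s) powr (- 1 / (2 * b))"

text \<open>Up to constants the stretching \<open>x \<mapsto> P (\<bar>x\<bar>\<^sup>2) x\<close> is \<open>x / (\<bar>x\<bar> log\<^sup>a (1/\<bar>x\<bar>))\<close> near the origin,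
  with \<open>a = 1 / (2 b) \<in> (1/2, 1)\<close>: its differential is square integrable because
  \<open>2 a > 1\<close>, and \<open>P (r\<^sup>2)\<close> is not integrable over \<open>0 < r < 1\<close> because \<open>a < 1\<close>.\<close>

definition P :: "real \<Rightarrow> real" where
  "P t = Q (min 0 (ln t))"

text \<open>The eigenvalues of the differential of P(|x|^2) x are P t tangentially and P t + 2 t P'
  t = P t / \<kappa> t radially, where t = |x|^2.\<close>

definition P' :: "real \<Rightarrow> real" where
  "P' t = - P t * (1 - 1 / \<kappa> t) / (2 * t)"

text \<open>For s = ln (r^2) this is 2 b - 1 times the integral of P(\<rho>^2) over r < \<rho> < 1.
  It is unbounded as s tends to minus infinity since the exponent is positive for b > 1/2.\<close>

definition \<xi> :: "real \<Rightarrow> real" where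
  "\<xi> s = (1 - b * s) powr (1 - 1 / (2 * b)) - 1"

text \<open>A C^1 transition from 0 at z = 0 to 1 for |z| \<ge> 1. Its derivative vanishes at both
  ends, so it can be glued to constants there.\<close>

definition T :: "real \<Rightarrow> real" where
  "T z = 1 - (min 0 (z\<^sup>2 - 1))\<^sup>2"

definition T' :: "real \<Rightarrow> real" where
  "T' z = - 4 * z * min 0 (z\<^sup>2 - 1)"

text \<open>The bump as a function of the squared radius. For c > 0 it rises from 0 at t = 1 to 1
  near t = 0; a small \<open>c\<close> slows the rise, at the price of a small plateau.\<close>

definition \<eta> :: "real \<Rightarrow> real \<Rightarrow> real" where
  "\<eta> c t = T (c * \<xi> (min 0 (ln t)))"

definition \<eta>' :: "real \<Rightarrow> real \<Rightarrow> real" where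
  "\<eta>' c t = T' (c * \<xi> (min 0 (ln t))) * (c * ((1 / 2 - b) * (1 - b * min 0 (ln t)) powr (- 1 / (2 * b)))) / t"

lemma base_ge_1: "s \<le> 0 \<Longrightarrow> 1 \<le> 1 - b * s"
  using b by (simp add: mult_nonneg_nonpos)

lemma \<kappa>_ge_1: "1 \<le> \<kappa> t"
  unfolding \<kappa>_def by (rule base_ge_1) simp

lemma \<kappa>_eq_1: "1 \<le> t \<Longrightarrow> \<kappa> t = 1"
  by (simp add: \<kappa>_def min_def ln_ge_zero order_antisym)

lemma \<kappa>_antimono: "0 < s \<Longrightarrow> s \<le> t \<Longrightarrow> \<kappa> t \<le> \<kappa> s"
  using b by (simp add: \<kappa>_def min_def)

lemma Q_derivative:
  assumes "s \<le> 0"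
  shows "(Q has_real_derivative (- Q s * (1 - 1 / (1 - b * s)) / 2)) (at s)"
proof -
  have pos: "1 - b * s > 0"
    using base_ge_1[OF assms] by linarith
  have "(Q has_real_derivative (exp (- s / 2) * (- 1 / 2) * (1 - b * s) powr (- 1 / (2 * b))
      + exp (- s / 2) * ((- 1 / (2 * b)) * (1 - b * s) powr (- 1 / (2 * b) - 1) * (- b)))) (at s)"
    unfolding Q_def[abs_def] using pos
    by (auto intro!: derivative_eq_intros)
  moreover have "exp (- s / 2) * (- 1 / 2) * (1 - b * s) powr (- 1 / (2 * b))
      + exp (- s / 2) * ((- 1 / (2 * b)) * (1 - b * s) powr (- 1 / (2 * b) - 1) * (- b)) = - Q s * (1 - 1 / (1 - b * s)) / 2"
  proof -
    have "(1 - b * s) powr (- 1 / (2 * b) - 1) = (1 - b * s) powr (- 1 / (2 * b)) / (1 - b * s)"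
      using pos by (simp only: powr_diff powr_one)
    moreover have "e * (- 1 / 2) * p + e * ((- 1 / (2 * b)) * (p / q) * (- b)) = - (e * p) * (1 - 1 / q) / 2"
      if "q > 0" for e p q :: real
      using that b by (simp add: field_simps)
    ultimately show ?thesis
      using pos unfolding Q_def by simp
  qed
  ultimately show ?thesis by simp
qed

lemma P_derivative:
  assumes "0 < t"
  shows "(P has_real_derivative P' t) (at t)"
proof -
  have "((\<lambda>u. Q (min 0 u)) has_real_derivative (- Q (min 0 (ln t)) * (1 - 1 / (1 - b * min 0 (ln t))) / 2)) (at (ln t))"
    by (rule has_real_derivative_min_0[OF Q_derivative]) simp_all
  from DERIV_chain2[OF this DERIV_ln_divide[OF assms]] show ?thesis
    unfolding P_def[abs_def] P'_def \<kappa>_def by (simp add: field_simps)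
qed

lemma P_pos: "0 < P t"
proof -
  have "1 - b * min 0 (ln t) > 0"
    using base_ge_1[of "min 0 (ln t)"] by simp
  then show ?thesis
    by (simp add: P_def Q_def)
qed

lemma P_eq_1: "1 \<le> t \<Longrightarrow> P t = 1"
  by (simp add: P_def Q_def min_def ln_ge_zero order_antisym)

lemma P_less_1:
  assumes "0 < t" "t \<le> 1"
  shows "P t = (1 - b * ln t) powr (- 1 / (2 * b)) / sqrt t"
proof -
  have "exp (- ln t / 2) = 1 / sqrt t"
    using assms by (simp add: exp_minus ln_sqrt[symmetric] inverse_eq_divide)
  then show ?thesis
    using assms by (simp add: P_def Q_def min_def)
qed

lemma P'_nonpos: "0 < t \<Longrightarrow> P' t \<le> 0"
  using P_pos[of t] \<kappa>_ge_1[of t] by (auto simp: P'_def intro!: divide_nonpos_pos mult_nonpos_nonneg)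

lemma P_antimono: "0 < s \<Longrightarrow> s \<le> t \<Longrightarrow> P t \<le> P s"
  by (rule DERIV_nonpos_imp_nonincreasing[of s t P]) (meson P_derivative P'_nonpos less_le_trans)+

lemma sqrt_mult_P_le:
  assumes "0 < t"
  shows "sqrt t * P t \<le> 1 + sqrt t"
proof (cases "t \<le> 1")
  case True
  have "(1 - b * ln t) powr (- 1 / (2 * b)) \<le> 1"
    using powr_mono[of "- 1 / (2 * b)" 0 "1 - b * ln t"] base_ge_1[of "ln t"] True assms b by simp
  then show ?thesis
    using assms True by (simp add: P_less_1) (smt (verit) real_sqrt_ge_zero)
next
  case False
  then show ?thesis
    using assms by (simp add: P_eq_1)
qed

text \<open>Square integrability of P(|x|^2) over the unit disc in dyadic form. The factor 1 / t in
  (P t)^2 cancels the areas and leaves a p-series with exponent 1 / b > 1.\<close>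

lemma summable_P_dyadic: "summable (\<lambda>i. (P (1 / 4 ^ Suc i))\<^sup>2 / 4 ^ i)"
proof -
  have "summable (\<lambda>i. 4 * (b * ln 4) powr (- 1 / b) * real (Suc i) powr (- 1 / b))"
    using b by (intro summable_mult summable_Suc_iff[THEN iffD2, of "\<lambda>i. real i powr _"])
      (simp add: summable_real_powr_iff field_simps)
  then show ?thesis
  proof (rule summable_comparison_test'[of _ 0])
    fix i :: nat
    have l: "ln (1 / 4 ^ Suc i) = - (real (Suc i) * ln (4::real))"
      by (simp add: ln_div ln_realpow del: power_Suc)
    have "(P (1 / 4 ^ Suc i))\<^sup>2 / 4 ^ i = ((1 + b * (real (Suc i) * ln 4)) powr (- 1 / (2 * b)))\<^sup>2 * (4 ^ Suc i / 4 ^ i)"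
      by (subst P_less_1) (simp_all add: l power_divide del: power_Suc)
    also have "((1 + b * (real (Suc i) * ln 4)) powr (- 1 / (2 * b)))\<^sup>2 = (1 + b * (real (Suc i) * ln 4)) powr (- 1 / b)"
      by (simp add: power2_eq_square powr_add[symmetric])
    also have "\<dots> \<le> (b * ln 4 * real (Suc i)) powr (- 1 / b)"
      using b by (intro powr_mono2') (auto simp: mult_ac)
    also have "\<dots> = (b * ln 4) powr (- 1 / b) * real (Suc i) powr (- 1 / b)"
      by (rule powr_mult)
    finally show "norm ((P (1 / 4 ^ Suc i))\<^sup>2 / 4 ^ i) \<le> 4 * (b * ln 4) powr (- 1 / b) * real (Suc i) powr (- 1 / b)"
      by (simp add: field_simps)
  qed
qed

text \<open>exp (\<mu> \<kappa>) grows like 4^(\<mu> b i) against areas of order 4^(-i): a geometric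
  series of ratio 4^(\<mu> b - 1).\<close>

lemma summable_exp_\<kappa>_dyadic:
  assumes "\<mu> * b < 1"
  shows "summable (\<lambda>i. exp (\<mu> * \<kappa> (1 / 4 ^ Suc i)) / 4 ^ i)"
proof -
  have e: "exp (\<mu> * \<kappa> (1 / 4 ^ Suc i)) / 4 ^ i = 4 * exp \<mu> * exp ((\<mu> * b - 1) * ln 4) ^ Suc i" for i
  proof -
    have "ln (1 / 4 ^ Suc i) = - (real (Suc i) * ln (4::real))"
      by (simp add: ln_div ln_realpow del: power_Suc)
    then have "\<kappa> (1 / 4 ^ Suc i) = 1 + b * (real (Suc i) * ln 4)"
      by (simp add: \<kappa>_def min_absorb2 del: power_Suc of_nat_Suc)
    then have "exp (\<mu> * \<kappa> (1 / 4 ^ Suc i)) = exp \<mu> * exp (real (Suc i) * (\<mu> * b * ln 4))"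
      by (simp add: exp_add[symmetric] algebra_simps)
    moreover have "exp ((\<mu> * b - 1) * ln 4) ^ Suc i = exp (real (Suc i) * (\<mu> * b * ln 4)) * exp (real (Suc i) * ln (1 / 4))"
      by (simp add: exp_add[symmetric] exp_of_nat_mult[symmetric] ln_div algebra_simps)
    moreover have "exp (real (Suc i) * ln (1 / 4)) = (1 / 4 :: real) ^ Suc i"
      by (simp only: exp_of_nat_mult exp_ln zero_less_divide_1_iff zero_less_numeral)
    ultimately show ?thesis
      by (simp add: power_one_over field_simps)
  qed
  have "summable (\<lambda>i. 4 * exp \<mu> * exp ((\<mu> * b - 1) * ln 4) ^ Suc i)"
    using assms by (intro summable_mult summable_ignore_initial_segment[where k = 1, simplified] summable_geometric)
      (simp add: mult_neg_pos)
  then show ?thesis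
    unfolding e .
qed

section \<open>The bump profile\<close>

lemma T_derivative: "(T has_real_derivative T' z) (at z)"
proof -
  have "((\<lambda>u. (min 0 u)\<^sup>2) has_real_derivative 2 * min 0 (z\<^sup>2 - 1)) (at (z\<^sup>2 - 1))"
    by (rule has_real_derivative_min_0[where E = "\<lambda>u. u\<^sup>2" and E' = "\<lambda>u. 2 * u"])
       (auto intro!: derivative_eq_intros)
  moreover have "((\<lambda>z. z\<^sup>2 - 1) has_real_derivative 2 * z) (at z)"
    by (auto intro!: derivative_eq_intros)
  ultimately have "((\<lambda>z. (min 0 (z\<^sup>2 - 1))\<^sup>2) has_real_derivative 2 * min 0 (z\<^sup>2 - 1) * (2 * z)) (at z)"
    by (rule DERIV_chain2[where f = "\<lambda>u. (min 0 u)\<^sup>2" and g = "\<lambda>z. z\<^sup>2 - 1"])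
  from DERIV_diff[OF DERIV_const[of 1] this] show ?thesis
    by (simp add: T_def[abs_def] T'_def mult_ac)
qed

lemma abs_T'_le: "\<bar>T' z\<bar> \<le> 4"
proof (cases "\<bar>z\<bar> \<le> 1")
  case True
  then have "z\<^sup>2 \<le> 1"
    by (simp add: abs_square_le_1)
  then have "\<bar>min 0 (z\<^sup>2 - 1)\<bar> \<le> 1"
    by (simp add: min_def)
  then have "\<bar>z\<bar> * \<bar>min 0 (z\<^sup>2 - 1)\<bar> \<le> 1"
    using True by (intro mult_le_one) auto
  then show ?thesis
    by (simp add: T'_def abs_mult)
next
  case False
  then have "1 < z\<^sup>2"
    by (metis abs_square_le_1 not_le)
  then show ?thesis
    by (simp add: T'_def)
qed

lemma \<xi>_derivative:
  assumes "s \<le> 0"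
  shows "(\<xi> has_real_derivative (1 / 2 - b) * (1 - b * s) powr (- 1 / (2 * b))) (at s)"
proof -
  have pos: "1 - b * s > 0"
    using base_ge_1[OF assms] by linarith
  have "(\<xi> has_real_derivative ((1 - 1 / (2 * b)) * (1 - b * s) powr (1 - 1 / (2 * b) - 1) * (- b))) (at s)"
    unfolding \<xi>_def[abs_def] using pos by (auto intro!: derivative_eq_intros)
  moreover have "(1 - 1 / (2 * b)) * (1 - b * s) powr (1 - 1 / (2 * b) - 1) * (- b) = (1 / 2 - b) * (1 - b * s) powr (- 1 / (2 * b))"
    using b by (simp add: field_simps)
  ultimately show ?thesis by simp
qed

lemma \<eta>_derivative:
  assumes "0 < t"
  shows "(\<eta> c has_real_derivative \<eta>' c t) (at t)"
proof -
  have "((\<lambda>s. T (c * \<xi> s)) has_real_derivative T' (c * \<xi> s) * (c * ((1 / 2 - b) * (1 - b * s) powr (- 1 / (2 * b))))) (at s)"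
    if "s \<le> 0" for s
    by (rule DERIV_chain2[OF T_derivative DERIV_cmult[OF \<xi>_derivative[OF that]]])
  then have "((\<lambda>u. T (c * \<xi> (min 0 u))) has_real_derivative T' (c * \<xi> (min 0 (ln t))) *
      (c * ((1 / 2 - b) * (1 - b * min 0 (ln t)) powr (- 1 / (2 * b))))) (at (ln t))"
    by (rule has_real_derivative_min_0) (simp_all add: \<xi>_def T'_def)
  from DERIV_chain2[OF this DERIV_ln_divide[OF assms]] show ?thesis
    unfolding \<eta>_def[abs_def] \<eta>'_def by simp
qed

text \<open>The gradient of \<eta>(|x|^2) has length 2 sqrt t |\<eta>'|, so this bounds it by 4 c
  times the operator norm P t of the stretching. The 2 is the product of |T'| \<le> 4 and b - 1/2
  \<le> 1/2.\<close>

lemma abs_\<eta>'_le: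
  assumes t: "0 < t" and c: "0 \<le> c"
  shows "\<bar>\<eta>' c t\<bar> \<le> 2 * c * P t / sqrt t"
proof (cases "t \<le> 1")
  case True
  let ?q = "(1 - b * ln t) powr (- 1 / (2 * b))"
  have "\<bar>\<eta>' c t\<bar> = \<bar>T' (c * \<xi> (ln t))\<bar> * (b - 1 / 2) * (c * ?q / t)"
    using t c b True by (simp add: \<eta>'_def min_def abs_mult)
  also have "\<dots> \<le> 4 * (1 / 2) * (c * ?q / t)"
    using t c b by (intro mult_right_mono mult_mono abs_T'_le) auto
  also have "\<dots> = 2 * c * P t / sqrt t"
    using t True by (simp add: P_less_1)
  finally show ?thesis .
next
  case False
  then have "min 0 (ln t) = 0"
    by (simp add: min_def ln_ge_zero order_antisym)
  then have "\<eta>' c t = 0"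
    by (simp add: \<eta>'_def \<xi>_def T'_def)
  then show ?thesis
    using c t P_pos[of t] by simp
qed

lemma \<eta>_eq_0: "1 \<le> t \<Longrightarrow> \<eta> c t = 0"
  by (simp add: \<eta>_def \<xi>_def T_def min_def ln_ge_zero order_antisym)

lemma \<eta>_bounds: "0 \<le> \<eta> c t" "\<eta> c t \<le> 1"
proof -
  have "\<bar>min 0 (z\<^sup>2 - 1)\<bar> \<le> 1" for z :: real
    by (auto simp: min_def)
  then have "(min 0 (z\<^sup>2 - 1))\<^sup>2 \<le> 1" for z :: real
    by (simp add: abs_square_le_1)
  then show "0 \<le> \<eta> c t" "\<eta> c t \<le> 1"
    by (auto simp: \<eta>_def T_def)
qed

text \<open>Here b > 1/2 is decisive: \<xi> is unbounded, so c \<xi> reaches 1 however small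
  \<open>c\<close> is. The 2 \<tau> anticipates the shift: with \<tau> added, squared radii up to
  \<tau> give arguments up to 2 \<tau>.\<close>

lemma \<eta>_eq_1_near_0:
  assumes c: "0 < c"
  shows "\<exists>\<tau>>0. \<tau> \<le> 1 / 2 \<and> (\<forall>t. 0 < t \<and> t \<le> 2 * \<tau> \<longrightarrow> \<eta> c t = 1)"
proof -
  define p where "p = 1 - 1 / (2 * b)"
  have p: "p > 0"
    using b by (simp add: p_def field_simps)
  \<comment> \<open>The solution of c \<xi>(- s0) = 1.\<close>
  define s0 where "s0 = ((1 + 1 / c) powr (1 / p) - 1) / b"
  have s0: "1 + b * s0 = (1 + 1 / c) powr (1 / p)"
    using b by (simp add: s0_def)
  have "1 \<le> (1 + 1 / c) powr (1 / p)"
    using c p by (intro ge_one_powr_ge_zero) auto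
  then have s0_0: "s0 \<ge> 0"
    using b by (simp add: s0_def)
  define \<tau> where "\<tau> = exp (- s0) / 2"
  have "\<eta> c t = 1" if t: "0 < t" "t \<le> 2 * \<tau>" for t
  proof -
    have "ln t \<le> ln (exp (- s0))"
      using t by (subst ln_le_cancel_iff) (auto simp: \<tau>_def)
    then have ls: "ln t \<le> - s0"
      by simp
    have "1 + 1 / c = (1 + b * s0) powr p"
      using c p by (simp add: s0 powr_powr)
    also have "\<dots> \<le> (1 - b * ln t) powr p"
    proof (rule powr_mono2)
      show "1 + b * s0 \<le> 1 - b * ln t"
        using mult_left_mono[of s0 "- ln t" b] ls b by simp
      show "0 \<le> 1 + b * s0"
        using s0_0 b by simp
    qed (use p in simp)
    finally have "1 / c \<le> \<xi> (min 0 (ln t))"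
      using ls s0_0 by (simp add: \<xi>_def p_def min_absorb2)
    then have "1 \<le> c * \<xi> (min 0 (ln t))"
      using c by (simp add: field_simps)
    then have "1 \<le> (c * \<xi> (min 0 (ln t)))\<^sup>2"
      by (metis one_le_power)
    then show ?thesis
      by (simp add: \<eta>_def T_def)
  qed
  moreover have "\<tau> > 0" "\<tau> \<le> 1 / 2"
    using s0_0 by (auto simp: \<tau>_def)
  ultimately show ?thesis
    by blast
qed

end

section \<open>A single stretching with its bump\<close>

lemma vector_4:
  "(vector [x, y, z, w] :: 'a::zero^4) $ 1 = x"
  "(vector [x, y, z, w] :: 'a::zero^4) $ 2 = y"
  "(vector [x, y, z, w] :: 'a::zero^4) $ 3 = z"
  "(vector [x, y, z, w] :: 'a::zero^4) $ 4 = w"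
  unfolding vector_def by simp_all

lemma norm_real2_square: "(norm (x :: real^2))\<^sup>2 = (x $ 1)\<^sup>2 + (x $ 2)\<^sup>2"
  by (simp add: norm_vec_def L2_set_def sum_2)

lemma has_derivative_vec:
  fixes f :: "'a::real_normed_vector \<Rightarrow> real^'m"
  assumes "\<And>j. ((\<lambda>x. f x $ j) has_derivative (\<lambda>v. f' v $ j)) (at x)"
  shows "(f has_derivative f') (at x)"
  unfolding has_derivative_componentwise_within[of f f' x UNIV]
  using assms by (auto simp: Basis_vec_def inner_axis)

lemma borel_measurable_matrix:
  fixes D :: "'a \<Rightarrow> real^'n^'m"
  assumes "\<And>i j. (\<lambda>x. D x $ i $ j) \<in> borel_measurable M"
  shows "D \<in> borel_measurable M"
  unfolding borel_measurable_euclidean_space[of D]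
  using assms by (auto simp: Basis_vec_def inner_axis)

lemma sum_matrix_vector_mult:
  fixes D :: "'i \<Rightarrow> real^'n^'m"
  shows "(\<Sum>i\<in>I. D i) *v v = (\<Sum>i\<in>I. D i *v v)"
  by (induction I rule: infinite_finite_induct) (auto simp: matrix_vector_mult_add_rdistrib)

context stretching_profile
begin

text \<open>The shift keeps the argument positive at the centre too, where the profiles would be
  singular, while the argument still dominates the squared scaled radius.\<close>

definition arg :: "real \<Rightarrow> real \<Rightarrow> real^2 \<Rightarrow> real^2 \<Rightarrow> real" where
  "arg R \<tau> a x = (norm (x - a) / R)\<^sup>2 + \<tau>"

definition block :: "real \<Rightarrow> real \<Rightarrow> real \<Rightarrow> real \<Rightarrow> real \<Rightarrow> real \<Rightarrow> real^2 \<Rightarrow> real^2 \<Rightarrow> real^4" where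
  "block c R \<tau> e w1 w2 a x =
     vector [c * P (arg R \<tau> a x) * (x - a) $ 1, c * P (arg R \<tau> a x) * (x - a) $ 2,
             w1 * \<eta> e (arg R \<tau> a x), w2 * \<eta> e (arg R \<tau> a x)]"

definition Dblock :: "real \<Rightarrow> real \<Rightarrow> real \<Rightarrow> real \<Rightarrow> real \<Rightarrow> real \<Rightarrow> real^2 \<Rightarrow> real^2 \<Rightarrow> real^2^4" where
  "Dblock c R \<tau> e w1 w2 a x =
     vector [
       vector [c * (P (arg R \<tau> a x) + 2 * P' (arg R \<tau> a x) * (x - a) $ 1 * (x - a) $ 1 / R\<^sup>2),
               c * (2 * P' (arg R \<tau> a x) * (x - a) $ 1 * (x - a) $ 2 / R\<^sup>2)],
       vector [c * (2 * P' (arg R \<tau> a x) * (x - a) $ 1 * (x - a) $ 2 / R\<^sup>2),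
               c * (P (arg R \<tau> a x) + 2 * P' (arg R \<tau> a x) * (x - a) $ 2 * (x - a) $ 2 / R\<^sup>2)],
       (w1 * \<eta>' e (arg R \<tau> a x) * 2 / R\<^sup>2) *\<^sub>R (x - a),
       (w2 * \<eta>' e (arg R \<tau> a x) * 2 / R\<^sup>2) *\<^sub>R (x - a)]"

lemma arg_pos: "0 < \<tau> \<Longrightarrow> 0 < arg R \<tau> a x"
  unfolding arg_def using zero_le_power2[of "norm (x - a) / R"] by linarith

lemma block_derivative:
  assumes \<tau>: "0 < \<tau>"
  shows "(block c R \<tau> e w1 w2 a has_derivative (\<lambda>v. Dblock c R \<tau> e w1 w2 a x *v v)) (at x)"
proof -
  let ?t = "arg R \<tau> a x" and ?y = "x - a"
  define k where "k = inverse (R\<^sup>2)"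
  have arg_eq: "arg R \<tau> a = (\<lambda>x. ((x - a) \<bullet> (x - a)) * k + \<tau>)"
    by (simp add: fun_eq_iff arg_def power_divide dot_square_norm k_def power_one_over divide_inverse power_mult_distrib power_inverse)
  have "(arg R \<tau> a has_derivative (\<lambda>v. 2 * (?y \<bullet> v) * k)) (at x)"
    unfolding arg_eq by (auto intro!: derivative_eq_intros simp: inner_commute)
  then have dt: "(arg R \<tau> a has_derivative (\<lambda>v. 2 * (?y \<bullet> v) / R\<^sup>2)) (at x)"
    by (simp add: k_def divide_inverse)
  have dP: "((\<lambda>x. P (arg R \<tau> a x)) has_derivative (\<lambda>v. P' ?t * (2 * (?y \<bullet> v) / R\<^sup>2))) (at x)"
    using has_derivative_compose[OF dt P_derivative[OF arg_pos[OF \<tau>], unfolded has_field_derivative_def]] .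
  have d\<eta>: "((\<lambda>x. \<eta> e (arg R \<tau> a x)) has_derivative (\<lambda>v. \<eta>' e ?t * (2 * (?y \<bullet> v) / R\<^sup>2))) (at x)"
    using has_derivative_compose[OF dt \<eta>_derivative[OF arg_pos[OF \<tau>], unfolded has_field_derivative_def]] .
  have dy: "((\<lambda>x. (x - a) $ i) has_derivative (\<lambda>v. v $ i)) (at x)" for i
    by (rule bounded_linear.has_derivative[OF bounded_linear_vec_nth]) (auto intro!: derivative_eq_intros)
  have in2: "?y \<bullet> v = ?y $ 1 * v $ 1 + ?y $ 2 * v $ 2" for v
    by (simp add: inner_vec_def sum_2)
  have mv: "(D *v v) $ j = D $ j $ 1 * v $ 1 + D $ j $ 2 * v $ 2" for D :: "real^2^4" and v j
    by (simp add: matrix_vector_mult_def sum_2)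
  have "((\<lambda>x. block c R \<tau> e w1 w2 a x $ j) has_derivative (\<lambda>v. (Dblock c R \<tau> e w1 w2 a x *v v) $ j)) (at x)" for j
  proof -
    consider "j = 1" | "j = 2" | "j = 3" | "j = 4"
      using exhaust_4 by blast
    then show ?thesis
    proof cases
      case 1
      show ?thesis
        unfolding 1 block_def vector_4
        by (rule has_derivative_eq_rhs[OF has_derivative_mult[OF has_derivative_mult_right[OF dP] dy]])
           (simp only: fun_eq_iff in2 mv, simp add: Dblock_def vector_4 divide_inverse algebra_simps)
    next
      case 2
      show ?thesis
        unfolding 2 block_def vector_4
        by (rule has_derivative_eq_rhs[OF has_derivative_mult[OF has_derivative_mult_right[OF dP] dy]])
           (simp only: fun_eq_iff in2 mv, simp add: Dblock_def vector_4 divide_inverse algebra_simps)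
    next
      case 3
      show ?thesis
        unfolding 3 block_def vector_4
        by (rule has_derivative_eq_rhs[OF has_derivative_mult_right[OF d\<eta>]])
           (simp only: fun_eq_iff in2 mv, simp add: Dblock_def vector_4 divide_inverse algebra_simps)
    next
      case 4
      show ?thesis
        unfolding 4 block_def vector_4
        by (rule has_derivative_eq_rhs[OF has_derivative_mult_right[OF d\<eta>]])
           (simp only: fun_eq_iff in2 mv, simp add: Dblock_def vector_4 divide_inverse algebra_simps)
    qed
  qed
  then show ?thesis
    by (rule has_derivative_vec)
qed

lemma measurable_profile[measurable]:
  "P \<in> borel_measurable borel" "P' \<in> borel_measurable borel" "\<eta>' e \<in> borel_measurable borel"
  "\<kappa> \<in> borel_measurable borel" "arg R \<tau> a \<in> borel_measurable borel"
proof -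
  show [measurable]: "P \<in> borel_measurable borel"
    unfolding P_def[abs_def] Q_def[abs_def] by measurable
  show [measurable]: "\<kappa> \<in> borel_measurable borel"
    unfolding \<kappa>_def[abs_def] by measurable
  show "P' \<in> borel_measurable borel"
    unfolding P'_def[abs_def] by measurable
  show "\<eta>' e \<in> borel_measurable borel"
    unfolding \<eta>'_def[abs_def] T'_def[abs_def] \<xi>_def[abs_def] by measurable
  show "arg R \<tau> a \<in> borel_measurable borel"
    unfolding arg_def[abs_def] by measurable
qed

lemma Dblock_measurable: "Dblock c R \<tau> e w1 w2 a \<in> borel_measurable borel"
proof (rule borel_measurable_matrix)
  fix i :: 4 and j :: 2
  have [measurable]: "(\<lambda>x::real^2. (x - a) $ k) \<in> borel_measurable borel" for k
    by (intro borel_measurable_continuous_onI continuous_intros)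
  consider "i = 1" | "i = 2" | "i = 3" | "i = 4"
    using exhaust_4 by blast
  then show "(\<lambda>x. Dblock c R \<tau> e w1 w2 a x $ i $ j) \<in> borel_measurable borel"
    using exhaust_2[of j]
    by cases (auto simp: Dblock_def vector_4 simp del: vector_minus_component)
qed

text \<open>With y = x - a the upper block is c (P I + (2 P' / R^2) y y^T), with eigenvalues c P and
  c (P - q), hence trace c (2 P - q) and anisotropy c q. The value of \<open>e\<close> turns the
  bump estimate into a bound \<epsilon> c P for rows 3 and 4, and c P is at most the trace.\<close>

lemma
  assumes c: "0 < c" and R: "0 < R" and \<tau>: "0 < \<tau>" and \<epsilon>: "0 < \<epsilon>" and e: "e = \<epsilon> * c * R / 4"
    and w: "\<bar>w1\<bar> \<le> 1" "\<bar>w2\<bar> \<le> 1"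
  shows Dblock_in_distortion_cone: "Dblock c R \<tau> e w1 w2 a x \<in> distortion_cone (\<kappa> (arg R \<tau> a x)) \<epsilon>"
    and norm_Dblock_le: "\<epsilon> \<le> 1 \<Longrightarrow> norm (Dblock c R \<tau> e w1 w2 a x) \<le> 12 * c * P (arg R \<tau> a x)"
proof -
  define t y where "t = arg R \<tau> a x" and "y = x - a"
  let ?D = "Dblock c R \<tau> e w1 w2 a x"
  have t: "0 < t"
    unfolding t_def by (rule arg_pos[OF \<tau>])
  have yt: "(norm y / R)\<^sup>2 \<le> t"
    using \<tau> by (simp add: t_def y_def arg_def)
  then have yt': "norm y / R \<le> sqrt t"
    by (rule real_le_rsqrt)
  have e0: "0 < e"
    using c R \<epsilon> by (simp add: e)
  have P0: "0 < P t" and P'0: "P' t \<le> 0" and \<kappa>1: "1 \<le> \<kappa> t"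
    using P_pos P'_nonpos[OF t] \<kappa>_ge_1 by auto
  define q where "q = - 2 * P' t * (norm y / R)\<^sup>2"
  have q0: "0 \<le> q"
    using P'0 by (simp add: q_def mult_nonpos_nonneg)
  \<comment> \<open>Since the squared scaled radius is at most \<open>t\<close>, the shift only
    reduces the anisotropy; without it equality would hold.\<close>
  have "q \<le> - 2 * P' t * t"
    unfolding q_def using yt P'0 by (intro mult_left_mono) auto
  also have "\<dots> = P t * (1 - 1 / \<kappa> t)"
    using t by (simp add: P'_def field_simps)
  finally have q1: "q \<le> P t * (1 - 1 / \<kappa> t)" .
  also have "\<dots> \<le> P t * 1"
    using P0 \<kappa>1 by (intro mult_left_mono) auto
  finally have qP: "q \<le> P t" by simp
  have q2: "\<kappa> t * q \<le> (\<kappa> t - 1) * P t"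
  proof -
    have "\<kappa> t * q \<le> \<kappa> t * (P t * (1 - 1 / \<kappa> t))"
      using q1 \<kappa>1 by (intro mult_left_mono) auto
    also have "\<dots> = (\<kappa> t - 1) * P t"
      using \<kappa>1 by (simp add: right_diff_distrib left_diff_distrib)
    finally show ?thesis .
  qed
  have D: "?D $ 1 $ 1 = c * (P t + 2 * P' t * y $ 1 * y $ 1 / R\<^sup>2)" "?D $ 2 $ 2 = c * (P t + 2 * P' t * y $ 2 * y $ 2 / R\<^sup>2)"
    "?D $ 1 $ 2 = c * (2 * P' t * y $ 1 * y $ 2 / R\<^sup>2)" "?D $ 2 $ 1 = ?D $ 1 $ 2"
    by (simp_all add: Dblock_def vector_4 t_def y_def)
  have D34: "?D $ 3 = (w1 * \<eta>' e t * 2 / R\<^sup>2) *\<^sub>R y" "?D $ 4 = (w2 * \<eta>' e t * 2 / R\<^sup>2) *\<^sub>R y"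
    by (simp_all add: Dblock_def vector_4 t_def y_def)
  define g where "g = 2 * P' t / R\<^sup>2"
  have Dg: "?D $ 1 $ 1 = c * (P t + g * y $ 1 * y $ 1)" "?D $ 2 $ 2 = c * (P t + g * y $ 2 * y $ 2)"
    "?D $ 1 $ 2 = c * (g * y $ 1 * y $ 2)" and qg: "q = - g * ((y $ 1)\<^sup>2 + (y $ 2)\<^sup>2)"
    unfolding D q_def power_divide norm_real2_square by (simp_all add: g_def)
  have tr: "trace2 ?D = c * (2 * P t - q)"
    unfolding trace2_def Dg qg by (simp add: power2_eq_square algebra_simps)
  have an: "aniso ?D = c * q"
  proof -
    have "(?D $ 1 $ 1 - ?D $ 2 $ 2)\<^sup>2 + (2 * ?D $ 1 $ 2)\<^sup>2 = (c * q)\<^sup>2"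
      unfolding Dg qg by (simp add: power2_eq_square algebra_simps)
    then show ?thesis
      using c q0 by (simp add: aniso_def)
  qed
  have trP: "c * P t \<le> trace2 ?D"
    unfolding tr using c qP by (intro mult_left_mono) auto
  have row: "norm ((w * \<eta>' e t * 2 / R\<^sup>2) *\<^sub>R y) \<le> \<epsilon> * trace2 ?D" if "\<bar>w\<bar> \<le> 1" for w
  proof -
    have "norm ((w * \<eta>' e t * 2 / R\<^sup>2) *\<^sub>R y) = \<bar>w\<bar> * \<bar>\<eta>' e t\<bar> * (2 / R * (norm y / R))"
      using R by (simp add: abs_mult power2_eq_square)
    also have "\<dots> \<le> 1 * (2 * e * P t / sqrt t) * (2 / R * sqrt t)"
      using that abs_\<eta>'_le[OF t, of e] e0 yt' R by (intro mult_mono) auto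
    also have "\<dots> = \<epsilon> * (c * P t)"
      using t R by (simp add: e field_simps)
    also have "\<dots> \<le> \<epsilon> * trace2 ?D"
      using trP \<epsilon> by (intro mult_left_mono) auto
    finally show ?thesis .
  qed
  have "(\<kappa> t + 1) * aniso ?D \<le> (\<kappa> t - 1) * trace2 ?D"
    using mult_left_mono[OF q2, of "2 * c"] c unfolding an tr by (simp add: algebra_simps)
  moreover have "0 \<le> trace2 ?D"
    using trP c P0 by (smt (verit) mult_pos_pos)
  ultimately show cone: "?D \<in> distortion_cone (\<kappa> (arg R \<tau> a x)) \<epsilon>"
    using row w D34 D(4) unfolding distortion_cone_def t_def[symmetric] by simp
  assume "\<epsilon> \<le> 1"
  from norm_le_trace2[OF cone \<kappa>_ge_1 this]
  have "norm ?D \<le> 6 * (c * (2 * P t - q))"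
    unfolding tr .
  also have "\<dots> \<le> 6 * (c * (2 * P t))"
    using c q0 by simp
  finally show "norm ?D \<le> 12 * c * P (arg R \<tau> a x)"
    by (simp add: t_def)
qed

text \<open>Bounds the values of a stretching independently of the shift, for the uniform
  convergence of the series.\<close>

lemma P_mult_norm_le:
  assumes R: "0 < R" and \<tau>: "0 < \<tau>" "\<tau> \<le> 1"
  shows "P (arg R \<tau> a x) * norm (x - a) \<le> 2 * R + norm (x - a)"
proof -
  let ?t = "arg R \<tau> a x"
  have t: "0 < ?t"
    by (rule arg_pos[OF \<tau>(1)])
  have "norm (x - a) / R \<le> sqrt ?t"
    using \<tau> by (intro real_le_rsqrt) (simp add: arg_def)
  then have "norm (x - a) \<le> R * sqrt ?t"
    using R by (simp add: field_simps)
  then have "P ?t * norm (x - a) \<le> P ?t * (R * sqrt ?t)"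
    using P_pos by (intro mult_left_mono) (auto intro: less_imp_le)
  also have "\<dots> \<le> R * (1 + sqrt ?t)"
    using mult_left_mono[OF sqrt_mult_P_le[OF t], of R] R by (simp add: mult_ac)
  also have "sqrt ?t \<le> norm (x - a) / R + 1"
  proof (rule real_le_lsqrt)
    show "?t \<le> (norm (x - a) / R + 1)\<^sup>2"
      unfolding arg_def power2_sum using divide_nonneg_pos[OF norm_ge_zero[of "x - a"] R] \<tau> by simp
  qed (use t R in auto)
  then have "R * (1 + sqrt ?t) \<le> 2 * R + norm (x - a)"
    using mult_left_mono[of "sqrt ?t" "norm (x - a) / R + 1" R] R by (simp add: algebra_simps)
  finally show ?thesis .
qed

end

section \<open>Superposition over all scales\<close>

lemma ennreal_geometric_less_top:
  assumes "X < (\<infinity> :: ennreal)"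
  shows "(\<Sum>k. ennreal ((1 / 2) ^ k) * X) < \<infinity>"
proof -
  have "(\<Sum>k. ennreal ((1 / 2) ^ k)) = ennreal (1 / (1 - 1 / 2))"
    by (rule suminf_ennreal_eq[OF _ geometric_sums]) simp_all
  then have "(\<Sum>k. ennreal ((1 / 2) ^ k) * X) = ennreal (1 / (1 - 1 / 2)) * X"
    by (subst ennreal_suminf_multc) simp
  then show ?thesis
    using assms by (simp add: ennreal_mult_less_top)
qed

text \<open>The hypothesis is (p k)^2 \<le> 2^(-k) s k with the square root opened by a free weight
  \<delta>. Summing first and then taking \<delta> to be half the sum of \<open>p\<close> gives the
  Cauchy-Schwarz inequality for the series.\<close>

lemma suminf_square_le:
  fixes p s :: "nat \<Rightarrow> real"
  assumes p: "\<And>k. 0 \<le> p k" and s: "summable s" "\<And>k. 0 \<le> s k"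
    and le: "\<And>k \<delta>. 0 < \<delta> \<Longrightarrow> 2 * p k \<le> \<delta> * (1 / 2) ^ k + s k / \<delta>"
  shows "summable p" and "(\<Sum>k. p k)\<^sup>2 \<le> 2 * (\<Sum>k. s k)"
proof -
  have g: "(\<lambda>k. (1 / 2 :: real) ^ k) sums 2"
    using geometric_sums[of "1 / 2 :: real"] by simp
  have sg: "summable (\<lambda>k. \<delta> * (1 / 2) ^ k + s k / \<delta>)" for \<delta> :: real
    using g s(1) by (intro summable_add summable_mult summable_divide) (auto simp: sums_iff)
  have "summable (\<lambda>k. 2 * p k)"
    by (rule summable_comparison_test'[OF sg[of 1], of 0]) (use le[of 1] p in auto)
  then show sp: "summable p"
    by (simp add: summable_cmult_iff)
  have bd: "2 * (\<Sum>k. p k) \<le> 2 * \<delta> + (\<Sum>k. s k) / \<delta>" if "0 < \<delta>" for \<delta>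
  proof -
    have "2 * (\<Sum>k. p k) = (\<Sum>k. 2 * p k)"
      by (rule suminf_mult[OF sp, symmetric])
    also have "\<dots> \<le> (\<Sum>k. \<delta> * (1 / 2) ^ k + s k / \<delta>)"
      by (intro suminf_le le that \<open>summable (\<lambda>k. 2 * p k)\<close> sg)
    also have "\<dots> = \<delta> * 2 + (\<Sum>k. s k) / \<delta>"
      using g s by (subst suminf_add[symmetric])
        (auto simp: sums_iff suminf_mult suminf_divide intro!: summable_mult summable_divide)
    finally show ?thesis by simp
  qed
  show "(\<Sum>k. p k)\<^sup>2 \<le> 2 * (\<Sum>k. s k)"
  proof (cases "(\<Sum>k. p k) = 0")
    case True
    then show ?thesis
      using True suminf_nonneg[OF s] by simp
  next
    case False
    then have W: "0 < (\<Sum>k. p k)"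
      using suminf_nonneg[OF sp p] by simp
    show ?thesis
      using bd[of "(\<Sum>k. p k) / 2"] W by (simp add: field_simps power2_eq_square)
  qed
qed

text \<open>\<open>N\<close> and \<tau> stay free here: \<tau> k has to be chosen after N k, and N
  (Suc k) after \<tau> k, but the Sobolev and distortion estimates hold for every choice.\<close>

locale multiscale = stretching_profile +
  fixes \<epsilon> :: real and N :: "nat \<Rightarrow> nat" and \<tau> :: "nat \<Rightarrow> real"
  assumes \<epsilon>: "0 < \<epsilon>" "\<epsilon> \<le> 1" and N: "0 < N k" and \<tau>: "0 < \<tau> k" "\<tau> k \<le> 1 / 2"
begin

text \<open>Against the grid spacing 1 / N k this keeps the discs of one scale disjoint; their total
  area pi 4^(-k) / 16 is summable.\<close>

definition R :: "nat \<Rightarrow> real" where "R k = (1 / 2) ^ k / (4 * real (N k))"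
text \<open>The amplitudes of scale \<open>k\<close> add up to 2^(-k).\<close>

definition c :: "nat \<Rightarrow> real" where "c k = (1 / 2) ^ k / (real (N k))\<^sup>2"
definition e :: "nat \<Rightarrow> real" where "e k = \<epsilon> * c k * R k / 4"
definition I :: "nat \<Rightarrow> (nat \<times> nat) set" where "I k = {..<N k} \<times> {..<N k}"
definition ctr :: "nat \<Rightarrow> nat \<times> nat \<Rightarrow> real^2" where
  "ctr k i = vector [real (fst i) / real (N k), real (snd i) / real (N k)]"
text \<open>The parity of a grid index is the digit that its bump contributes, at the place value
  2^(-k).\<close>

definition wt :: "nat \<Rightarrow> nat \<Rightarrow> real" where "wt k n = (1 / 2) ^ k * real (n mod 2)"
definition t :: "nat \<Rightarrow> nat \<times> nat \<Rightarrow> real^2 \<Rightarrow> real" where "t k i = arg (R k) (\<tau> k) (ctr k i)"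
definition B :: "nat \<Rightarrow> nat \<times> nat \<Rightarrow> real^2 \<Rightarrow> real^4" where
  "B k i = block (c k) (R k) (\<tau> k) (e k) (wt k (fst i)) (wt k (snd i)) (ctr k i)"
definition DB :: "nat \<Rightarrow> nat \<times> nat \<Rightarrow> real^2 \<Rightarrow> real^2^4" where
  "DB k i = Dblock (c k) (R k) (\<tau> k) (e k) (wt k (fst i)) (wt k (snd i)) (ctr k i)"
definition F :: "nat \<Rightarrow> real^2 \<Rightarrow> real^4" where "F k x = (\<Sum>i\<in>I k. B k i x)"
definition DF :: "nat \<Rightarrow> real^2 \<Rightarrow> real^2^4" where "DF k x = (\<Sum>i\<in>I k. DB k i x)"
definition f :: "real^2 \<Rightarrow> real^4" where "f x = (\<Sum>k. F k x)"
definition D :: "real^2 \<Rightarrow> real^2^4" where "D x = (\<Sum>k. DF k x)"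
text \<open>Energy density of scale \<open>k\<close>: up to constants, 2^(-k) times it bounds the
  squared norm of \<open>DF k\<close>.\<close>

definition W :: "nat \<Rightarrow> real^2 \<Rightarrow> real" where "W k x = (\<Sum>i\<in>I k. c k * (P (t k i x))\<^sup>2)"

lemma R_pos: "0 < R k" and c_pos: "0 < c k"
  using N[of k] by (auto simp: R_def c_def)

lemma R_le: "R k \<le> 1" "R k * (4 * real (N k)) \<le> 1"
proof -
  show *: "R k * (4 * real (N k)) \<le> 1"
    using N[of k] by (simp add: R_def power_le_one)
  have "R k * 1 \<le> R k * (4 * real (N k))"
    using N[of k] R_pos[of k] by (intro mult_left_mono) auto
  then show "R k \<le> 1"
    using * by simp
qed

lemma finite_I[simp]: "finite (I k)" and card_I: "real (card (I k)) = (real (N k))\<^sup>2"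
  by (simp_all add: I_def power2_eq_square)

lemma card_I_c: "real (card (I k)) * c k = (1 / 2) ^ k"
  using N[of k] by (simp add: card_I c_def)

lemma wt_bounds: "0 \<le> wt k n" "wt k n \<le> (1 / 2) ^ k" "\<bar>wt k n\<bar> \<le> 1"
proof -
  have "real (n mod 2) \<le> 1"
    by simp
  then show "wt k n \<le> (1 / 2) ^ k"
    using mult_left_mono[of "real (n mod 2)" 1 "(1 / 2) ^ k"] by (simp add: wt_def)
  moreover have "(1 / 2 :: real) ^ k \<le> 1"
    by (simp add: power_le_one)
  moreover show "0 \<le> wt k n"
    by (simp add: wt_def)
  ultimately show "\<bar>wt k n\<bar> \<le> 1"
    by linarith
qed

lemma t_pos: "0 < t k i x" "\<tau> k \<le> t k i x"
  unfolding t_def using \<tau> arg_pos by (auto simp: arg_def)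

lemma t_ge_1:
  assumes "R k \<le> norm (x - ctr k i)"
  shows "1 \<le> t k i x"
proof -
  have "1 \<le> (norm (x - ctr k i) / R k)\<^sup>2"
    using assms R_pos[of k] by (intro one_le_power) simp
  then show ?thesis
    using \<tau>(1)[of k] by (simp add: t_def arg_def)
qed

lemma DF_derivative: "(F k has_derivative (\<lambda>v. DF k x *v v)) (at x)"
  unfolding F_def[abs_def] DF_def sum_matrix_vector_mult B_def DB_def
  by (intro has_derivative_sum block_derivative \<tau>)

lemma DB_measurable[measurable]: "DB k i \<in> borel_measurable borel"
  unfolding DB_def by (rule Dblock_measurable)

lemma DF_measurable[measurable]: "DF k \<in> borel_measurable borel"
  unfolding DF_def[abs_def] by measurable

lemma t_measurable[measurable]: "t k i \<in> borel_measurable borel"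
  unfolding t_def by measurable

lemma W_measurable[measurable]: "W k \<in> borel_measurable borel"
  unfolding W_def[abs_def] by measurable

lemma W_nonneg: "0 \<le> W k x"
  unfolding W_def using c_pos[of k] by (intro sum_nonneg mult_nonneg_nonneg) auto

section \<open>Energy estimates\<close>

lemma norm_DB_le: "norm (DB k i x) \<le> 12 * c k * P (t k i x)"
  unfolding DB_def t_def
  by (rule norm_Dblock_le[OF c_pos R_pos \<tau>(1) \<epsilon>(1) e_def wt_bounds(3) wt_bounds(3) \<epsilon>(2)])

lemma DB_in_cone: "DB k i x \<in> distortion_cone (\<kappa> (t k i x)) \<epsilon>"
  unfolding DB_def t_def
  by (rule Dblock_in_distortion_cone[OF c_pos R_pos \<tau>(1) \<epsilon>(1) e_def wt_bounds(3) wt_bounds(3)])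

text \<open>Cauchy-Schwarz over the blocks with weights \<open>c k\<close>, whose sum is 2^(-k).
  Optimizing \<delta> would give |DF|^2 \<le> 144 * 2^(-k) W; left free, the weight can be chosen
  after summation over \<open>k\<close>.\<close>

lemma norm_DF_le:
  assumes \<delta>: "0 < \<delta>"
  shows "2 * norm (DF k x) \<le> 12 * (\<delta> * (1 / 2) ^ k + W k x / \<delta>)"
proof -
  have "2 * norm (DF k x) \<le> (\<Sum>i\<in>I k. 2 * norm (DB k i x))"
    unfolding DF_def sum_distrib_left[symmetric] by (simp add: norm_sum)
  also have "\<dots> \<le> (\<Sum>i\<in>I k. 12 * (c k * (\<delta> + (P (t k i x))\<^sup>2 / \<delta>)))"
  proof (rule sum_mono)
    fix i
    let ?p = "P (t k i x)"
    have "0 \<le> (\<delta> - ?p)\<^sup>2"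
      by simp
    then have "2 * ?p \<le> \<delta> + ?p\<^sup>2 / \<delta>"
      using \<delta> by (simp add: power2_eq_square field_simps)
    then have "12 * c k * (2 * ?p) \<le> 12 * c k * (\<delta> + ?p\<^sup>2 / \<delta>)"
      using c_pos[of k] by (intro mult_left_mono) auto
    then show "2 * norm (DB k i x) \<le> 12 * (c k * (\<delta> + ?p\<^sup>2 / \<delta>))"
      using norm_DB_le[of k i x] by simp
  qed
  also have "\<dots> = 12 * (\<delta> * (real (card (I k)) * c k) + W k x / \<delta>)"
    by (simp add: W_def sum_distrib_left sum.distrib sum_divide_distrib distrib_left mult_ac)
  finally show ?thesis
    unfolding card_I_c .
qed

definition P_energy :: ennreal where
  "P_energy = (\<Sum>i. ennreal ((P (1 / 4 ^ Suc i))\<^sup>2 / 4 ^ i))"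

lemma P_energy_finite: "P_energy < \<infinity>"
  unfolding P_energy_def by (subst suminf_ennreal2[OF _ summable_P_dyadic]) auto

text \<open>Outside its disc the profile is 1, inside the radial estimate applies. The bound does
  not depend on the scale or the shift.\<close>

lemma nn_integral_P_square_le:
  "(\<integral>\<^sup>+x\<in>cball 0 r. ennreal ((P (t k i x))\<^sup>2) \<partial>lborel)
    \<le> emeasure lborel (cball (0 :: real^2) r) + ennreal pi * P_energy"
proof -
  have "(\<integral>\<^sup>+x\<in>cball 0 r. ennreal ((P (t k i x))\<^sup>2) \<partial>lborel)
      \<le> (\<integral>\<^sup>+x. indicator (cball 0 r) x + ennreal ((P (t k i x))\<^sup>2) * indicator (ball (ctr k i) (R k)) x \<partial>lborel)"
  proof (rule nn_integral_mono)
    fix x :: "real^2"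
    have "P (t k i x) = 1" if "x \<notin> ball (ctr k i) (R k)"
      using that by (intro P_eq_1 t_ge_1) (simp add: dist_norm norm_minus_commute)
    then show "ennreal ((P (t k i x))\<^sup>2) * indicator (cball 0 r) x
        \<le> indicator (cball 0 r) x + ennreal ((P (t k i x))\<^sup>2) * indicator (ball (ctr k i) (R k)) x"
      by (auto simp: indicator_def simp del: mem_ball)
  qed
  also have "\<dots> = emeasure lborel (cball (0 :: real^2) r)
      + (\<integral>\<^sup>+x\<in>ball (ctr k i) (R k). ennreal ((P (t k i x))\<^sup>2) \<partial>lborel)"
    by (subst nn_integral_add) (auto intro!: borel_measurable_times_ennreal borel_measurable_indicator)
  also have "(\<integral>\<^sup>+x\<in>ball (ctr k i) (R k). ennreal ((P (t k i x))\<^sup>2) \<partial>lborel) \<le> ennreal (pi * (R k)\<^sup>2) * P_energy"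
    unfolding P_energy_def t_def arg_def
    by (rule nn_integral_ball_radial_le[of "\<lambda>t. (P t)\<^sup>2", OF _ R_pos \<tau>(1)])
       (auto intro!: power_mono P_antimono less_imp_le[OF P_pos])
  also have "\<dots> \<le> ennreal pi * P_energy"
    using R_le(1)[of k] R_pos[of k]
    by (intro mult_right_mono ennreal_leI) (auto intro!: mult_left_le power_le_one)
  finally show ?thesis
    by (simp add: add_left_mono)
qed

lemma nn_integral_W_le:
  "(\<integral>\<^sup>+x\<in>cball 0 r. ennreal (W k x) \<partial>lborel)
    \<le> ennreal ((1 / 2) ^ k) * (emeasure lborel (cball (0 :: real^2) r) + ennreal pi * P_energy)"
proof -
  let ?A = "emeasure lborel (cball (0 :: real^2) r) + ennreal pi * P_energy"
  have "(\<integral>\<^sup>+x\<in>cball 0 r. ennreal (W k x) \<partial>lborel)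
      = (\<integral>\<^sup>+x. (\<Sum>i\<in>I k. ennreal (c k) * (ennreal ((P (t k i x))\<^sup>2) * indicator (cball 0 r) x)) \<partial>lborel)"
  proof (rule nn_integral_cong)
    fix x
    have "ennreal (W k x) = (\<Sum>i\<in>I k. ennreal (c k) * ennreal ((P (t k i x))\<^sup>2))"
      unfolding W_def using c_pos[of k] by (subst sum_ennreal[symmetric]) (auto simp: ennreal_mult)
    then show "ennreal (W k x) * indicator (cball 0 r) x
        = (\<Sum>i\<in>I k. ennreal (c k) * (ennreal ((P (t k i x))\<^sup>2) * indicator (cball 0 r) x))"
      by (simp add: sum_distrib_right mult.assoc)
  qed
  also have "\<dots> = (\<Sum>i\<in>I k. \<integral>\<^sup>+x. ennreal (c k) * (ennreal ((P (t k i x))\<^sup>2) * indicator (cball 0 r) x) \<partial>lborel)"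
    by (intro nn_integral_sum borel_measurable_times_ennreal borel_measurable_indicator) auto
  also have "\<dots> = (\<Sum>i\<in>I k. ennreal (c k) * (\<integral>\<^sup>+x\<in>cball 0 r. ennreal ((P (t k i x))\<^sup>2) \<partial>lborel))"
    by (intro sum.cong nn_integral_cmult borel_measurable_times_ennreal borel_measurable_indicator) auto
  also have "\<dots> \<le> (\<Sum>i\<in>I k. ennreal (c k) * ?A)"
    by (intro sum_mono mult_left_mono nn_integral_P_square_le) simp
  also have "\<dots> = ennreal (real (card (I k)) * c k) * ?A"
    using c_pos[of k] by (simp add: ennreal_mult ennreal_of_nat_eq_real_of_nat mult.assoc)
  finally show ?thesis
    unfolding card_I_c .
qed

lemma suminf_nn_integral_W: "(\<Sum>k. \<integral>\<^sup>+x\<in>cball 0 r. ennreal (W k x) \<partial>lborel) < \<infinity>"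
proof -
  let ?A = "emeasure lborel (cball (0 :: real^2) r) + ennreal pi * P_energy"
  have "(\<Sum>k. \<integral>\<^sup>+x\<in>cball 0 r. ennreal (W k x) \<partial>lborel) \<le> (\<Sum>k. ennreal ((1 / 2) ^ k) * ?A)"
    by (intro suminf_le nn_integral_W_le) auto
  also have "\<dots> < \<infinity>"
    using emeasure_lborel_cball_finite[of "0 :: real^2" r] P_energy_finite
    by (intro ennreal_geometric_less_top) (simp add: ennreal_mult_less_top)
  finally show ?thesis .
qed

lemma nn_integral_suminf_W: "(\<integral>\<^sup>+x\<in>cball 0 r. (\<Sum>k. ennreal (W k x)) \<partial>lborel) < \<infinity>"
proof -
  have "(\<integral>\<^sup>+x\<in>cball 0 r. (\<Sum>k. ennreal (W k x)) \<partial>lborel) = (\<integral>\<^sup>+x. (\<Sum>k. ennreal (W k x) * indicator (cball 0 r) x) \<partial>lborel)"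
    by (intro nn_integral_cong) (rule ennreal_suminf_multc[symmetric])
  also have "\<dots> = (\<Sum>k. \<integral>\<^sup>+x\<in>cball 0 r. ennreal (W k x) \<partial>lborel)"
    by (intro nn_integral_suminf borel_measurable_times_ennreal borel_measurable_indicator) auto
  finally show ?thesis
    using suminf_nn_integral_W by simp
qed

lemma suminf_nn_integral_DF: "(\<Sum>k. \<integral>\<^sup>+x\<in>cball 0 r. ennreal (norm (DF k x)) \<partial>lborel) < \<infinity>"
proof -
  let ?V = "emeasure lborel (cball (0 :: real^2) r)"
  have "(\<integral>\<^sup>+x\<in>cball 0 r. ennreal (norm (DF k x)) \<partial>lborel)
      \<le> 6 * (ennreal ((1 / 2) ^ k) * ?V + (\<integral>\<^sup>+x\<in>cball 0 r. ennreal (W k x) \<partial>lborel))" for k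
  proof -
    have "(\<integral>\<^sup>+x\<in>cball 0 r. ennreal (norm (DF k x)) \<partial>lborel)
        \<le> (\<integral>\<^sup>+x. 6 * (ennreal ((1 / 2) ^ k) * indicator (cball 0 r) x + ennreal (W k x) * indicator (cball 0 r) x) \<partial>lborel)"
    proof (rule nn_integral_mono)
      fix x
      have "norm (DF k x) \<le> 6 * ((1 / 2) ^ k + W k x)"
        using norm_DF_le[of 1 k x] by simp
      then have "ennreal (norm (DF k x)) \<le> ennreal (6 * ((1 / 2) ^ k + W k x))"
        by (rule ennreal_leI)
      also have "\<dots> = 6 * (ennreal ((1 / 2) ^ k) + ennreal (W k x))"
        using W_nonneg[of k x] by (simp add: ennreal_mult ennreal_plus del: distrib_left_numeral)
      finally show "ennreal (norm (DF k x)) * indicator (cball 0 r) x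
          \<le> 6 * (ennreal ((1 / 2) ^ k) * indicator (cball 0 r) x + ennreal (W k x) * indicator (cball 0 r) x)"
        by (auto simp: indicator_def)
    qed
    also have "\<dots> = 6 * (\<integral>\<^sup>+x. ennreal ((1 / 2) ^ k) * indicator (cball 0 r) x + ennreal (W k x) * indicator (cball 0 r) x \<partial>lborel)"
      by (intro nn_integral_cmult borel_measurable_add borel_measurable_times_ennreal borel_measurable_indicator) auto
    also have "(\<integral>\<^sup>+x. ennreal ((1 / 2) ^ k) * indicator (cball 0 r) x + ennreal (W k x) * indicator (cball 0 r) x \<partial>lborel)
        = (\<integral>\<^sup>+x. ennreal ((1 / 2) ^ k) * indicator (cball (0 :: real^2) r) x \<partial>lborel) + (\<integral>\<^sup>+x\<in>cball 0 r. ennreal (W k x) \<partial>lborel)"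
      by (intro nn_integral_add borel_measurable_times_ennreal borel_measurable_indicator) auto
    also have "(\<integral>\<^sup>+x. ennreal ((1 / 2) ^ k) * indicator (cball (0 :: real^2) r) x \<partial>lborel) = ennreal ((1 / 2) ^ k) * ?V"
      by (rule nn_integral_cmult_indicator) simp
    finally show ?thesis .
  qed
  then have "(\<Sum>k. \<integral>\<^sup>+x\<in>cball 0 r. ennreal (norm (DF k x)) \<partial>lborel)
      \<le> (\<Sum>k. 6 * (ennreal ((1 / 2) ^ k) * ?V + (\<integral>\<^sup>+x\<in>cball 0 r. ennreal (W k x) \<partial>lborel)))"
    by (intro suminf_le) auto
  also have "\<dots> = 6 * ((\<Sum>k. ennreal ((1 / 2) ^ k) * ?V) + (\<Sum>k. \<integral>\<^sup>+x\<in>cball 0 r. ennreal (W k x) \<partial>lborel))"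
    unfolding ennreal_suminf_cmult suminf_add[OF summableI summableI] ..
  also have "\<dots> < \<infinity>"
  proof -
    have "6 * (x + y) < \<infinity>" if "x < \<infinity>" "y < \<infinity>" for x y :: ennreal
      using that by (simp add: ennreal_mult_less_top)
    from this[OF ennreal_geometric_less_top[OF emeasure_lborel_cball_finite] suminf_nn_integral_W]
    show ?thesis .
  qed
  finally show ?thesis .
qed

text \<open>P is decreasing and its argument is at least \<tau> k. This serves only the integration
  by parts of a single summand.\<close>

lemma DF_locally_bounded: "norm (DF k x) \<le> real (card (I k)) * (12 * c k * P (\<tau> k))"
  unfolding DF_def
proof (rule order_trans[OF norm_sum], rule sum_bounded_above)
  fix i
  have "12 * c k * P (t k i x) \<le> 12 * c k * P (\<tau> k)"
    using c_pos[of k] t_pos(2) P_antimono[OF \<tau>(1)] by (intro mult_left_mono) auto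
  then show "norm (DB k i x) \<le> 12 * c k * P (\<tau> k)"
    using norm_DB_le[of k i x] by linarith
qed

section \<open>Disjoint bumps and bounds for the summands\<close>

lemma ctr_separated:
  assumes "i \<in> I k" "j \<in> I k" "norm (x - ctr k i) \<le> R k" "norm (x - ctr k j) \<le> R k"
  shows "i = j"
proof (rule ccontr)
  assume "i \<noteq> j"
  then have d: "fst i \<noteq> fst j \<or> snd i \<noteq> snd j"
    by (auto simp: prod_eq_iff)
  have *: "1 / real (N k) \<le> \<bar>real m / real (N k) - real n / real (N k)\<bar>" if "m \<noteq> n" for m n :: nat
  proof -
    have "1 \<le> \<bar>real m - real n\<bar>"
      using that by linarith
    then have "1 / real (N k) \<le> \<bar>real m - real n\<bar> / real (N k)"
      by (rule divide_right_mono) simp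
    then show ?thesis
      by (simp add: diff_divide_distrib[symmetric] abs_divide)
  qed
  have "1 / real (N k) \<le> norm (ctr k i - ctr k j)"
    using d
  proof
    assume "fst i \<noteq> fst j"
    from *[OF this] show ?thesis
      using component_le_norm_cart[of "ctr k i - ctr k j" 1] by (simp add: ctr_def)
  next
    assume "snd i \<noteq> snd j"
    from *[OF this] show ?thesis
      using component_le_norm_cart[of "ctr k i - ctr k j" 2] by (simp add: ctr_def)
  qed
  also have "norm (ctr k i - ctr k j) \<le> norm (x - ctr k j) + norm (x - ctr k i)"
    using norm_triangle_ineq4[of "x - ctr k j" "x - ctr k i"] by simp
  also have "\<dots> \<le> 2 * R k"
    using assms by simp
  finally have "1 \<le> 2 * R k * real (N k)"
    using N[of k] by (simp add: field_simps)
  moreover have "0 < R k * real (N k)"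
    using R_pos[of k] N[of k] by simp
  ultimately show False
    using R_le(2)[of k] by simp
qed

lemma \<eta>_outside: "R k < norm (x - ctr k i) \<Longrightarrow> \<eta> (e k) (t k i x) = 0"
  by (intro \<eta>_eq_0 t_ge_1) simp

text \<open>By disjointness at most one bump of each scale is nonzero at a point, so the last two
  coordinates see a single digit per scale.\<close>

lemma F_34:
  assumes "i \<in> I k" "norm (x - ctr k i) \<le> R k"
  shows "F k x $ 3 = wt k (fst i) * \<eta> (e k) (t k i x)" and "F k x $ 4 = wt k (snd i) * \<eta> (e k) (t k i x)"
proof -
  have *: "(\<Sum>j\<in>I k. g j * \<eta> (e k) (t k j x)) = g i * \<eta> (e k) (t k i x)" for g :: "nat \<times> nat \<Rightarrow> real"
  proof -
    have "(\<Sum>j\<in>I k. g j * \<eta> (e k) (t k j x)) = (\<Sum>j\<in>{i}. g j * \<eta> (e k) (t k j x))"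
    proof (intro sum.mono_neutral_right ballI)
      fix j assume j: "j \<in> I k - {i}"
      then have "R k < norm (x - ctr k j)"
        using ctr_separated[of j k i x] assms by force
      then show "g j * \<eta> (e k) (t k j x) = 0"
        by (simp add: \<eta>_outside)
    qed (use assms in auto)
    then show ?thesis by simp
  qed
  show "F k x $ 3 = wt k (fst i) * \<eta> (e k) (t k i x)" "F k x $ 4 = wt k (snd i) * \<eta> (e k) (t k i x)"
    using *[of "\<lambda>j. wt k (fst j)"] *[of "\<lambda>j. wt k (snd j)"]
    by (simp_all add: F_def B_def block_def vector_4 t_def[symmetric])
qed

lemma F_34_bound: "\<bar>F k x $ 3\<bar> \<le> (1 / 2) ^ k" "\<bar>F k x $ 4\<bar> \<le> (1 / 2) ^ k"
proof -
  have "\<bar>F k x $ 3\<bar> \<le> (1 / 2) ^ k \<and> \<bar>F k x $ 4\<bar> \<le> (1 / 2) ^ k"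
  proof (cases "\<exists>i\<in>I k. norm (x - ctr k i) \<le> R k")
    case True
    then obtain i where i: "i \<in> I k" "norm (x - ctr k i) \<le> R k"
      by blast
    have "\<bar>wt k n * \<eta> (e k) (t k i x)\<bar> \<le> (1 / 2) ^ k * 1" for n
      unfolding abs_mult using wt_bounds[of k n] \<eta>_bounds[of "e k" "t k i x"] by (intro mult_mono) auto
    then show ?thesis
      unfolding F_34[OF i] by simp
  next
    case False
    then have "\<eta> (e k) (t k i x) = 0" if "i \<in> I k" for i
      using that by (intro \<eta>_outside) (auto simp: not_le)
    then show ?thesis
      by (simp add: F_def B_def block_def vector_4 t_def[symmetric])
  qed
  then show "\<bar>F k x $ 3\<bar> \<le> (1 / 2) ^ k" "\<bar>F k x $ 4\<bar> \<le> (1 / 2) ^ k"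
    by auto
qed

lemma norm_ctr_le: "i \<in> I k \<Longrightarrow> norm (ctr k i) \<le> 2"
  using norm_le_l1_cart[of "ctr k i"] add_mono[of "real (fst i) / real (N k)" 1 "real (snd i) / real (N k)" 1] N[of k]
  by (auto simp: I_def ctr_def sum_2)

lemma F_12_bound: "\<bar>F k x $ 1\<bar> \<le> (1 / 2) ^ k * (norm x + 4)" "\<bar>F k x $ 2\<bar> \<le> (1 / 2) ^ k * (norm x + 4)"
proof -
  have *: "\<bar>\<Sum>i\<in>I k. c k * P (t k i x) * (x - ctr k i) $ l\<bar> \<le> (1 / 2) ^ k * (norm x + 4)" for l
  proof -
    have "\<bar>\<Sum>i\<in>I k. c k * P (t k i x) * (x - ctr k i) $ l\<bar> \<le> (\<Sum>i\<in>I k. \<bar>c k * P (t k i x) * (x - ctr k i) $ l\<bar>)"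
      by (rule sum_abs)
    also have "\<dots> \<le> (\<Sum>i\<in>I k. c k * (norm x + 4))"
    proof (rule sum_mono)
      fix i assume i: "i \<in> I k"
      have "\<bar>c k * P (t k i x) * (x - ctr k i) $ l\<bar> \<le> c k * (P (t k i x) * norm (x - ctr k i))"
        using c_pos[of k] P_pos[of "t k i x"] component_le_norm_cart[of "x - ctr k i" l]
        by (simp add: abs_mult mult.assoc mult_left_mono del: vector_minus_component)
      also have "P (t k i x) * norm (x - ctr k i) \<le> 2 * R k + norm (x - ctr k i)"
        unfolding t_def using \<tau>[of k] by (intro P_mult_norm_le R_pos) auto
      also have "\<dots> \<le> norm x + 4"
        using R_le(1)[of k] norm_ctr_le[OF i] norm_triangle_ineq4[of x "ctr k i"] by linarith
      finally show "\<bar>c k * P (t k i x) * (x - ctr k i) $ l\<bar> \<le> c k * (norm x + 4)"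
        using c_pos[of k] by simp
    qed
    also have "\<dots> = real (card (I k)) * c k * (norm x + 4)"
      by simp
    finally show ?thesis
      unfolding card_I_c .
  qed
  show "\<bar>F k x $ 1\<bar> \<le> (1 / 2) ^ k * (norm x + 4)" "\<bar>F k x $ 2\<bar> \<le> (1 / 2) ^ k * (norm x + 4)"
    using *[of 1] *[of 2] by (simp_all add: F_def B_def block_def vector_4 t_def[symmetric])
qed

lemma norm_F_le: "norm (F k x) \<le> (1 / 2) ^ k * (2 * norm x + 10)"
  using norm_le_l1_cart[of "F k x"] F_12_bound[of k x] F_34_bound[of k x]
  by (simp add: sum_4 distrib_left)

section \<open>Sobolev regularity of the limit map\<close>

lemma f_weak_derivative:
  "continuous_on UNIV f" "AE x in lborel. summable (\<lambda>k. norm (DF k x))" "weak_derivative UNIV f D"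
proof -
  have unif: "\<exists>M. summable M \<and> (\<forall>k x. norm x \<le> r \<longrightarrow> norm (F k x) \<le> M k)" for r
  proof (intro exI conjI allI impI)
    show "summable (\<lambda>k. (1 / 2 :: real) ^ k * (2 * r + 10))"
      by (intro summable_mult2 summable_geometric) simp
    fix k and x :: "real^2" assume "norm x \<le> r"
    then show "norm (F k x) \<le> (1 / 2) ^ k * (2 * r + 10)"
      by (intro order_trans[OF norm_F_le] mult_left_mono) auto
  qed
  have bnd: "\<exists>B. \<forall>x. norm x \<le> r \<longrightarrow> norm (DF k x) \<le> B" for k r
    using DF_locally_bounded by blast
  note * = weak_derivative_suminf[OF DF_derivative DF_measurable bnd unif suminf_nn_integral_DF]
  show "continuous_on UNIV f" "AE x in lborel. summable (\<lambda>k. norm (DF k x))" "weak_derivative UNIV f D"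
    unfolding f_def[abs_def] D_def[abs_def] by (rule *)+
qed

lemma AE_summable_W: "AE x in lborel. summable (\<lambda>k. W k x)"
proof -
  have "AE x in lborel. (\<Sum>k. ennreal (W k x)) \<noteq> \<infinity>"
    by (rule AE_finite_if_locally_integrable[OF _ nn_integral_suminf_W])
       (intro borel_measurable_suminf_order, measurable)
  then show ?thesis
    by eventually_elim (intro summable_suminf_not_top, auto simp: W_nonneg)
qed

text \<open>The series form of Cauchy-Schwarz with p k = |DF k| / 12, whence 288 = 2 * 12^2.\<close>

lemma norm_D_square_le:
  assumes DF: "summable (\<lambda>k. norm (DF k x))" and W: "summable (\<lambda>k. W k x)"
  shows "(norm (D x))\<^sup>2 \<le> 288 * (\<Sum>k. W k x)"
proof -
  have "(\<Sum>k. norm (DF k x) / 12)\<^sup>2 \<le> 2 * (\<Sum>k. W k x)"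
  proof (rule suminf_square_le(2)[OF _ W W_nonneg])
    fix k and \<delta> :: real assume "0 < \<delta>"
    have "2 * (n / 12) \<le> z" if "2 * n \<le> 12 * z" for n z :: real
      using that by simp
    then show "2 * (norm (DF k x) / 12) \<le> \<delta> * (1 / 2) ^ k + W k x / \<delta>"
      using norm_DF_le[OF \<open>0 < \<delta>\<close>] .
  qed simp
  moreover have "(\<Sum>k. norm (DF k x) / 12) = (\<Sum>k. norm (DF k x)) / 12"
    by (rule suminf_divide[OF DF])
  moreover have "norm (D x) \<le> (\<Sum>k. norm (DF k x))"
    unfolding D_def by (rule summable_norm[OF DF])
  then have "(norm (D x))\<^sup>2 \<le> (\<Sum>k. norm (DF k x))\<^sup>2"
    by (rule power_mono) simp
  ultimately show ?thesis
    by (simp add: power_divide)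
qed

lemma D_measurable[measurable]: "D \<in> borel_measurable borel"
  unfolding D_def[abs_def] by measurable

lemma nn_integral_D_square: "(\<integral>\<^sup>+x\<in>cball 0 r. ennreal ((norm (D x))\<^sup>2) \<partial>lborel) < \<infinity>"
proof -
  have "AE x in lborel. ennreal ((norm (D x))\<^sup>2) * indicator (cball 0 r) x
      \<le> 288 * ((\<Sum>k. ennreal (W k x)) * indicator (cball 0 r) x)"
    using f_weak_derivative(2) AE_summable_W
  proof eventually_elim
    case (elim x)
    have "ennreal ((norm (D x))\<^sup>2) \<le> ennreal (288 * (\<Sum>k. W k x))"
      by (rule ennreal_leI[OF norm_D_square_le[OF elim]])
    also have "\<dots> = 288 * (\<Sum>k. ennreal (W k x))"
      using elim(2) by (subst suminf_ennreal2[OF W_nonneg]) (auto simp: ennreal_mult suminf_nonneg W_nonneg)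
    finally show ?case
      by (auto simp: indicator_def)
  qed
  then have "(\<integral>\<^sup>+x\<in>cball 0 r. ennreal ((norm (D x))\<^sup>2) \<partial>lborel)
      \<le> (\<integral>\<^sup>+x. 288 * ((\<Sum>k. ennreal (W k x)) * indicator (cball 0 r) x) \<partial>lborel)"
    by (rule nn_integral_mono_AE)
  also have "\<dots> = 288 * (\<integral>\<^sup>+x\<in>cball 0 r. (\<Sum>k. ennreal (W k x)) \<partial>lborel)"
    by (intro nn_integral_cmult borel_measurable_times_ennreal borel_measurable_indicator borel_measurable_suminf_order) auto
  also have "\<dots> < \<infinity>"
    using nn_integral_suminf_W[of r] by (simp add: ennreal_mult_less_top)
  finally show ?thesis .
qed

lemma W1p_loc_f: "W1p_loc 2 UNIV f" "W1p_loc 1 UNIV f"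
proof -
  have "Lp_loc 2 UNIV D"
  proof (rule Lp_locI)
    fix r
    show "(\<integral>\<^sup>+x\<in>cball 0 r. ennreal (norm (D x) powr 2) \<partial>lborel) < \<infinity>"
      using nn_integral_D_square[of r] by simp
  qed measurable
  then show "W1p_loc 2 UNIV f"
    unfolding W1p_loc_def using f_weak_derivative Lp_loc_continuous[of f 2] by auto
  show "W1p_loc 1 UNIV f"
    unfolding W1p_loc_def using f_weak_derivative(3) by (auto simp: weak_derivative_def)
qed

lemma Lp_loc_jacobian: "Lp_loc 1 UNIV (star_pullback dy1_dy2 f D)"
proof (rule Lp_locI)
  have eq: "star_pullback dy1_dy2 f D = (\<lambda>x. D x $ 1 $ 1 * D x $ 2 $ 2 - D x $ 2 $ 1 * D x $ 1 $ 2)"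
    by (rule ext) (rule star_pullback_dy1_dy2)
  show "star_pullback dy1_dy2 f D \<in> borel_measurable borel"
    unfolding eq
    by (rule borel_measurable_continuous_on[OF _ D_measurable, where f = "\<lambda>D. D $ 1 $ 1 * D $ 2 $ 2 - D $ 2 $ 1 * D $ 1 $ 2"])
       (intro continuous_intros)
  fix r
  have "(\<integral>\<^sup>+x\<in>cball 0 r. ennreal (norm (star_pullback dy1_dy2 f D x) powr 1) \<partial>lborel)
      \<le> (\<integral>\<^sup>+x. 2 * (ennreal ((norm (D x))\<^sup>2) * indicator (cball 0 r) x) \<partial>lborel)"
  proof (rule nn_integral_mono)
    fix x
    have comp: "\<bar>D x $ i $ j\<bar> \<le> norm (D x)" for i j
      using Finite_Cartesian_Product.norm_nth_le[of "D x" i] component_le_norm_cart[of "D x $ i" j] by linarith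
    have "\<bar>D x $ i $ j * D x $ k $ l\<bar> \<le> (norm (D x))\<^sup>2" for i j k l
      unfolding abs_mult power2_eq_square by (intro mult_mono comp) auto
    from this[of 1 1 2 2] this[of 2 1 1 2]
    have "\<bar>star_pullback dy1_dy2 f D x\<bar> \<le> 2 * (norm (D x))\<^sup>2"
      unfolding star_pullback_dy1_dy2 by linarith
    then have "ennreal \<bar>star_pullback dy1_dy2 f D x\<bar> \<le> ennreal (2 * (norm (D x))\<^sup>2)"
      by (rule ennreal_leI)
    then show "ennreal (norm (star_pullback dy1_dy2 f D x) powr 1) * indicator (cball 0 r) x
        \<le> 2 * (ennreal ((norm (D x))\<^sup>2) * indicator (cball 0 r) x)"
      by (auto simp: indicator_def ennreal_mult)
  qed
  also have "\<dots> = 2 * (\<integral>\<^sup>+x\<in>cball 0 r. ennreal ((norm (D x))\<^sup>2) \<partial>lborel)"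
    by (intro nn_integral_cmult borel_measurable_times_ennreal borel_measurable_indicator) auto
  also have "\<dots> < \<infinity>"
    using nn_integral_D_square[of r] by (simp add: ennreal_mult_less_top)
  finally show "(\<integral>\<^sup>+x\<in>cball 0 r. ennreal (norm (star_pullback dy1_dy2 f D x) powr 1) \<partial>lborel) < \<infinity>" .
qed

section \<open>The distortion function and its exponential integrability\<close>

definition \<Phi> :: "real \<Rightarrow> real^2 \<Rightarrow> ennreal" where
  "\<Phi> \<mu> x = (\<Sum>k. \<Sum>i\<in>I k. ennreal (exp (\<mu> * \<kappa> (t k i x))) * indicator (ball (ctr k i) (R k)) x)"

text \<open>A measurable majorant of the supremum of all \<kappa> (t k i x). Where \<Phi> is
  infinite, a null set, \<open>enn2real\<close> returns 0 and the value carries no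
  information.\<close>

definition K :: "real \<Rightarrow> real^2 \<Rightarrow> real" where
  "K \<mu> x = max 1 (ln (enn2real (\<Phi> \<mu> x)) / \<mu>)"

lemma \<Phi>_measurable[measurable]: "\<Phi> \<mu> \<in> borel_measurable borel"
  unfolding \<Phi>_def[abs_def]
  by (intro borel_measurable_suminf_order borel_measurable_sum borel_measurable_times_ennreal borel_measurable_indicator) auto

lemma K_measurable[measurable]: "K \<mu> \<in> borel_measurable borel"
  unfolding K_def[abs_def] by measurable

lemma K_ge_1: "1 \<le> K \<mu> x"
  by (simp add: K_def)

text \<open>Each disc contributes at most a constant times (R k)^2, and the (N k)^2 discs of scale
  \<open>k\<close> together at most a constant times 2^(-k).\<close>

lemma nn_integral_\<Phi>:
  assumes \<mu>: "0 < \<mu>" "\<mu> * b < 1"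
  shows "(\<integral>\<^sup>+x. \<Phi> \<mu> x \<partial>lborel) < \<infinity>"
proof -
  define E where "E = (\<Sum>i. ennreal (exp (\<mu> * \<kappa> (1 / 4 ^ Suc i)) / 4 ^ i))"
  have E: "E < \<infinity>"
    unfolding E_def by (subst suminf_ennreal2[OF _ summable_exp_\<kappa>_dyadic[OF \<mu>(2)]]) auto
  have 1: "(\<integral>\<^sup>+x\<in>ball (ctr k i) (R k). ennreal (exp (\<mu> * \<kappa> (t k i x))) \<partial>lborel) \<le> ennreal (pi * (R k)\<^sup>2) * E" for k i
    unfolding E_def t_def arg_def
    by (rule nn_integral_ball_radial_le[of "\<lambda>t. exp (\<mu> * \<kappa> t)", OF _ R_pos \<tau>(1)])
       (use \<mu> in \<open>auto intro!: \<kappa>_antimono\<close>)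
  have m: "(\<lambda>x. ennreal (exp (\<mu> * \<kappa> (t k i x))) * indicator (ball (ctr k i) (R k)) x) \<in> borel_measurable lborel" for k i
    by (intro borel_measurable_times_ennreal borel_measurable_indicator) auto
  have "(\<integral>\<^sup>+x. \<Phi> \<mu> x \<partial>lborel)
      = (\<Sum>k. \<Sum>i\<in>I k. \<integral>\<^sup>+x\<in>ball (ctr k i) (R k). ennreal (exp (\<mu> * \<kappa> (t k i x))) \<partial>lborel)"
    unfolding \<Phi>_def nn_integral_suminf[OF borel_measurable_sum[OF m]] nn_integral_sum[OF m] ..
  also have "\<dots> \<le> (\<Sum>k. \<Sum>i\<in>I k. ennreal (pi * (R k)\<^sup>2) * E)"
    by (intro suminf_le sum_mono 1) auto
  also have "\<dots> \<le> (\<Sum>k. ennreal ((1 / 2) ^ k) * (ennreal pi * E))"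
  proof (intro suminf_le)
    fix k
    have "(real (N k) * R k)\<^sup>2 \<le> (1 / 2) ^ k"
    proof -
      have "real (N k) * R k = (1 / 2) ^ k / 4"
        using N[of k] by (simp add: R_def)
      moreover have "((1 / 2 :: real) ^ k / 4)\<^sup>2 \<le> (1 / 2) ^ k * 1"
        unfolding power2_eq_square using power_le_one[of "1 / 2 :: real" k] by (intro mult_mono) auto
      ultimately show ?thesis by (metis mult.right_neutral)
    qed
    then have "real (card (I k)) * (pi * (R k)\<^sup>2) \<le> (1 / 2) ^ k * pi"
      by (simp add: card_I power_mult_distrib mult_ac)
    then have "ennreal (real (card (I k)) * (pi * (R k)\<^sup>2)) * E \<le> ennreal ((1 / 2) ^ k * pi) * E"
      by (intro mult_right_mono ennreal_leI) auto
    then show "(\<Sum>i\<in>I k. ennreal (pi * (R k)\<^sup>2) * E) \<le> ennreal ((1 / 2) ^ k) * (ennreal pi * E)"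
      by (simp add: ennreal_mult ennreal_of_nat_eq_real_of_nat mult.assoc)
  qed auto
  also have "\<dots> < \<infinity>"
    using E by (intro ennreal_geometric_less_top) (simp add: ennreal_mult_less_top)
  finally show ?thesis .
qed

lemma AE_\<Phi>_finite:
  assumes "0 < \<mu>" "\<mu> * b < 1"
  shows "AE x in lborel. \<Phi> \<mu> x \<noteq> \<infinity>"
  by (rule nn_integral_noteq_infinite) (use nn_integral_\<Phi>[OF assms] in auto)

text \<open>Inside the disc the exponential is one summand of \<Phi>; outside, \<kappa> is
  1.\<close>

lemma \<kappa>_le_K:
  assumes \<mu>: "0 < \<mu>" and fin: "\<Phi> \<mu> x \<noteq> \<infinity>" and i: "i \<in> I k"
  shows "\<kappa> (t k i x) \<le> K \<mu> x"
proof (cases "x \<in> ball (ctr k i) (R k)")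
  case True
  define g where "g k = (\<Sum>i\<in>I k. ennreal (exp (\<mu> * \<kappa> (t k i x))) * indicator (ball (ctr k i) (R k)) x)" for k
  have "ennreal (exp (\<mu> * \<kappa> (t k i x))) = ennreal (exp (\<mu> * \<kappa> (t k i x))) * indicator (ball (ctr k i) (R k)) x"
    using True by simp
  also have "\<dots> \<le> g k"
    unfolding g_def by (rule member_le_sum[OF i]) auto
  also have "\<dots> \<le> (\<Sum>k. g k)"
    using sum_le_suminf[OF summableI, of "{k}" g] by simp
  also have "\<dots> = \<Phi> \<mu> x"
    by (simp add: \<Phi>_def g_def)
  also have "\<dots> = ennreal (enn2real (\<Phi> \<mu> x))"
    using fin by (simp add: less_top)
  finally have "exp (\<mu> * \<kappa> (t k i x)) \<le> enn2real (\<Phi> \<mu> x)"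
    by (simp add: ennreal_le_iff)
  then have "\<mu> * \<kappa> (t k i x) \<le> ln (enn2real (\<Phi> \<mu> x))"
    by (subst ln_ge_iff) (auto intro: less_le_trans[OF exp_gt_zero])
  then show ?thesis
    using \<mu> by (simp add: K_def field_simps le_max_iff_disj)
next
  case False
  then have "1 \<le> t k i x"
    by (intro t_ge_1) (simp add: dist_norm norm_minus_commute)
  then show ?thesis
    using K_ge_1 by (simp add: \<kappa>_eq_1)
qed

lemma D_in_cone:
  assumes "0 < \<mu>" "\<Phi> \<mu> x \<noteq> \<infinity>" "summable (\<lambda>k. norm (DF k x))"
  shows "D x \<in> distortion_cone (K \<mu> x) \<epsilon>"
proof -
  have "DF k x \<in> distortion_cone (K \<mu> x) \<epsilon>" for k
    unfolding DF_def using \<kappa>_le_K[OF assms(1,2)]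
    by (intro sum_in_distortion_cone[OF _ K_ge_1] distortion_cone_mono[OF DB_in_cone \<kappa>_ge_1])
  then show ?thesis
    unfolding D_def by (rule suminf_in_distortion_cone[OF _ K_ge_1 summable_norm_cancel[OF assms(3)]])
qed

lemma finite_distortion_f:
  assumes \<mu>: "0 < \<mu>" "\<mu> * b < 1"
  shows "finite_distortion_curve UNIV dy1_dy2 f (\<lambda>x. ereal ((1 + 8 * \<epsilon>\<^sup>2) * K \<mu> x))"
proof -
  have "(\<lambda>x. ereal ((1 + 8 * \<epsilon>\<^sup>2) * K \<mu> x)) \<in> borel_measurable (lebesgue_on UNIV)"
    by (simp add: lebesgue_on_UNIV_eq measurable_completion)
  moreover have "1 \<le> ereal ((1 + 8 * \<epsilon>\<^sup>2) * K \<mu> x)" for x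
  proof -
    have "1 * 1 \<le> (1 + 8 * \<epsilon>\<^sup>2) * K \<mu> x"
      using K_ge_1 by (intro mult_mono) auto
    then show ?thesis
      by (simp add: one_ereal_def)
  qed
  moreover have "AE x in lebesgue_on UNIV. ereal (comass dy1_dy2 (f x) * onorm ((*v) (D x)) ^ CARD(2))
      \<le> ereal ((1 + 8 * \<epsilon>\<^sup>2) * K \<mu> x) * ereal (star_pullback dy1_dy2 f D x)"
  proof -
    have "AE x in lborel. ereal (comass dy1_dy2 (f x) * onorm ((*v) (D x)) ^ CARD(2))
      \<le> ereal ((1 + 8 * \<epsilon>\<^sup>2) * K \<mu> x) * ereal (star_pullback dy1_dy2 f D x)"
      using AE_\<Phi>_finite[OF \<mu>] f_weak_derivative(2)
    proof eventually_elim
      case (elim x)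
      have "comass dy1_dy2 (f x) * (onorm ((*v) (D x)))\<^sup>2 \<le> 1 * (onorm ((*v) (D x)))\<^sup>2"
        by (intro mult_right_mono comass_dy1_dy2_le) simp
      also have "\<dots> \<le> (1 + 8 * \<epsilon>\<^sup>2) * K \<mu> x * star_pullback dy1_dy2 f D x"
        using onorm_le_distortion[OF D_in_cone[OF \<mu>(1) elim] K_ge_1] by (simp add: star_pullback_dy1_dy2)
      finally show ?case
        by simp
    qed
    then show ?thesis
      unfolding lebesgue_on_UNIV_eq by (rule AE_completion)
  qed
  moreover have "domain (UNIV :: (real^2) set)"
    by (simp add: domain_def connected_UNIV)
  ultimately show ?thesis
    unfolding finite_distortion_curve_def
    using volume_form_dy1_dy2 W1p_loc_f(2) f_weak_derivative(3) Lp_loc_jacobian by auto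
qed

lemma exp_distortion_integrable:
  assumes \<mu>: "0 < \<mu>" "\<mu> * b < 1" and lam: "lam * (1 + 8 * \<epsilon>\<^sup>2) \<le> \<mu>"
  shows "Lp_loc 1 UNIV (\<lambda>x. exp (lam * real_of_ereal (ereal ((1 + 8 * \<epsilon>\<^sup>2) * K \<mu> x))))"
proof (rule Lp_locI)
  fix r
  let ?V = "emeasure lborel (cball (0 :: real^2) r)"
  have "AE x in lborel. ennreal (norm (exp (lam * real_of_ereal (ereal ((1 + 8 * \<epsilon>\<^sup>2) * K \<mu> x)))) powr 1) * indicator (cball 0 r) x
      \<le> ennreal (exp \<mu>) * indicator (cball 0 r) x + \<Phi> \<mu> x"
    using AE_\<Phi>_finite[OF \<mu>]
  proof eventually_elim
    case (elim x)
    have "lam * ((1 + 8 * \<epsilon>\<^sup>2) * K \<mu> x) \<le> \<mu> * K \<mu> x"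
      using mult_right_mono[OF lam, of "K \<mu> x"] K_ge_1[of \<mu> x] by (simp add: mult.assoc)
    then have "exp (lam * ((1 + 8 * \<epsilon>\<^sup>2) * K \<mu> x)) \<le> exp (\<mu> * K \<mu> x)"
      by simp
    \<comment> \<open>Either \<open>K\<close> is 1, which gives the first term, or exp (\<mu> K) is
      \<Phi> itself.\<close>
    also have "\<dots> \<le> exp \<mu> + enn2real (\<Phi> \<mu> x)"
    proof (cases "ln (enn2real (\<Phi> \<mu> x)) / \<mu> \<le> 1")
      case True
      then show ?thesis
        by (simp add: K_def max_absorb1)
    next
      case False
      then have "ln (enn2real (\<Phi> \<mu> x)) > 0"
        using \<mu> by (simp add: field_simps)
      then have "enn2real (\<Phi> \<mu> x) > 0"
        using enn2real_nonneg[of "\<Phi> \<mu> x"] by (cases "enn2real (\<Phi> \<mu> x) = 0") auto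
      then show ?thesis
        using False \<mu> by (simp add: K_def max_absorb2)
    qed
    finally have "ennreal (exp (lam * ((1 + 8 * \<epsilon>\<^sup>2) * K \<mu> x))) \<le> ennreal (exp \<mu> + enn2real (\<Phi> \<mu> x))"
      by (rule ennreal_leI)
    also have "\<dots> = ennreal (exp \<mu>) + \<Phi> \<mu> x"
      using elim by (simp add: less_top)
    finally show ?case
      by (auto simp: indicator_def)
  qed
  then have "(\<integral>\<^sup>+x\<in>cball 0 r. ennreal (norm (exp (lam * real_of_ereal (ereal ((1 + 8 * \<epsilon>\<^sup>2) * K \<mu> x)))) powr 1) \<partial>lborel)
      \<le> (\<integral>\<^sup>+x. ennreal (exp \<mu>) * indicator (cball 0 r) x + \<Phi> \<mu> x \<partial>lborel)"
    by (rule nn_integral_mono_AE)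
  also have "\<dots> = (\<integral>\<^sup>+x. ennreal (exp \<mu>) * indicator (cball (0 :: real^2) r) x \<partial>lborel) + (\<integral>\<^sup>+x. \<Phi> \<mu> x \<partial>lborel)"
    by (intro nn_integral_add borel_measurable_times_ennreal borel_measurable_indicator) auto
  also have "(\<integral>\<^sup>+x. ennreal (exp \<mu>) * indicator (cball (0 :: real^2) r) x \<partial>lborel) = ennreal (exp \<mu>) * ?V"
    by (rule nn_integral_cmult_indicator) simp
  also have "ennreal (exp \<mu>) * ?V + (\<integral>\<^sup>+x. \<Phi> \<mu> x \<partial>lborel) < \<infinity>"
    using nn_integral_\<Phi>[OF \<mu>] emeasure_lborel_cball_finite[of "0 :: real^2" r] by (simp add: ennreal_mult_less_top)
  finally show "(\<integral>\<^sup>+x\<in>cball 0 r. ennreal (norm (exp (lam * real_of_ereal (ereal ((1 + 8 * \<epsilon>\<^sup>2) * K \<mu> x)))) powr 1) \<partial>lborel) < \<infinity>" .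
qed measurable

end

section \<open>The image of a Cantor set\<close>

text \<open>The factor 2 in \<open>N_Suc\<close> makes each centre an even-indexed point of the next
  grid, so the parity of the next index can be prescribed. By \<open>gap\<close>, all points within
  4 / N (Suc k) of a centre lie on the plateau of its bump.\<close>

locale multiscale_cantor = multiscale +
  fixes q :: "nat \<Rightarrow> nat"
  assumes \<eta>_inside: "0 < s \<Longrightarrow> s \<le> 2 * \<tau> k \<Longrightarrow> \<eta> (e k) s = 1"
    and N_Suc: "N (Suc k) = 2 * q k * N k" and q: "0 < q k"
    and gap: "4 \<le> real (N (Suc k)) * (R k * sqrt (\<tau> k))"
begin

section \<open>Binary digits and grid addresses\<close>

definition bit :: "real \<Rightarrow> nat \<Rightarrow> nat" where
  "bit y k = nat (\<lfloor>2 ^ k * y\<rfloor> mod 2)"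

text \<open>Multiplication by \<open>2 * q k\<close> re-reads the old centre on the finer grid;
  adding the digit moves it by at most one cell and sets the parity read by
  \<open>wt\<close>.\<close>

primrec address :: "real \<Rightarrow> nat \<Rightarrow> nat" where
  "address y 0 = 0"
| "address y (Suc k) = 2 * q k * address y k + bit y (Suc k)"

definition coord :: "real \<Rightarrow> nat \<Rightarrow> real" where
  "coord y k = real (address y k) / real (N k)"

lemma bit_le_1: "bit y k \<le> 1"
  by (simp add: bit_def)

lemma address_less: "address y k < N k"
proof (induction k)
  case (Suc k)
  have "2 * q k * (address y k + 1) \<le> 2 * q k * N k"
    using Suc.IH by (intro mult_left_mono) auto
  then have "2 * q k * address y k + 2 * q k \<le> N (Suc k)"
    by (simp add: N_Suc)
  then show ?case
    using bit_le_1[of y "Suc k"] q[of k] by simp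
qed (use N in simp)

lemma address_mod_2: "0 \<le> y \<Longrightarrow> y < 1 \<Longrightarrow> address y k mod 2 = bit y k"
proof (cases k)
  case 0
  assume "0 \<le> y" "y < 1"
  then have "\<lfloor>y\<rfloor> = 0"
    by linarith
  then show ?thesis
    using 0 by (simp add: bit_def)
next
  case (Suc j)
  have "bit y (Suc j) mod 2 = bit y (Suc j)"
    using bit_le_1[of y "Suc j"] by simp
  moreover have "(2 * q j * address y j + bit y (Suc j)) mod 2 = bit y (Suc j) mod 2"
    by (simp add: mult.assoc)
  ultimately show ?thesis
    using Suc by simp
qed

text \<open>The partial sums telescope to floor (2^n y) / 2^n. Digit 0 vanishes because y <
  1.\<close>

lemma sums_bits:
  assumes y: "0 \<le> y" "y < 1"
  shows "(\<lambda>k. (1 / 2) ^ k * real (bit y k)) sums y"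
proof -
  have part: "(\<Sum>k<Suc n. (1 / 2) ^ k * real (bit y k)) = of_int \<lfloor>2 ^ n * y\<rfloor> / 2 ^ n" for n
  proof (induction n)
    case 0
    have "\<lfloor>y\<rfloor> = 0"
      using y by linarith
    then show ?case
      by (simp add: bit_def)
  next
    case (Suc n)
    have *: "\<lfloor>2 ^ Suc n * y\<rfloor> div 2 = \<lfloor>2 ^ n * y\<rfloor>"
      using floor_divide_real_eq_div[of 2 "2 ^ Suc n * y"] by simp
    have "real (bit y (Suc n)) = of_int (\<lfloor>2 ^ Suc n * y\<rfloor> mod 2)"
      by (simp add: bit_def)
    also have "\<dots> = of_int \<lfloor>2 ^ Suc n * y\<rfloor> - 2 * of_int \<lfloor>2 ^ n * y\<rfloor>"
      using arg_cong[OF minus_div_mult_eq_mod[of "\<lfloor>2 ^ Suc n * y\<rfloor>" 2], of real_of_int] unfolding * by simp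
    finally show ?case
      using Suc.IH by (simp add: power_one_over field_simps)
  qed
  have "(\<lambda>n. of_int \<lfloor>2 ^ n * y\<rfloor> / 2 ^ n) \<longlonglongrightarrow> y"
  proof (rule real_tendsto_sandwich)
    show "\<forall>\<^sub>F n in sequentially. y - (1 / 2) ^ n \<le> of_int \<lfloor>2 ^ n * y\<rfloor> / 2 ^ n"
    proof (intro always_eventually allI)
      fix n
      have "2 ^ n * y - 1 \<le> of_int \<lfloor>2 ^ n * y\<rfloor>"
        by linarith
      then have "(2 ^ n * y - 1) / 2 ^ n \<le> of_int \<lfloor>2 ^ n * y\<rfloor> / 2 ^ n"
        by (rule divide_right_mono) simp
      then show "y - (1 / 2) ^ n \<le> of_int \<lfloor>2 ^ n * y\<rfloor> / 2 ^ n"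
        by (simp add: diff_divide_distrib power_one_over)
    qed
    show "\<forall>\<^sub>F n in sequentially. of_int \<lfloor>2 ^ n * y\<rfloor> / 2 ^ n \<le> y"
      by (intro always_eventually allI) (simp add: field_simps)
    show "(\<lambda>n. y - (1 / 2) ^ n) \<longlonglongrightarrow> y"
      using tendsto_diff[OF tendsto_const LIMSEQ_power_zero[of "1 / 2 :: real"], of y] by simp
  qed simp
  then have "(\<lambda>n. \<Sum>k<Suc n. (1 / 2) ^ k * real (bit y k)) \<longlonglongrightarrow> y"
    unfolding part .
  then show ?thesis
    unfolding sums_def by (rule LIMSEQ_imp_Suc)
qed

text \<open>Nested intervals. The 2 leaves room for one digit, at most 1 / N (Suc k), and for the
  next interval, whose length 2 / N (Suc (Suc k)) is at most 1 / N (Suc k).\<close>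

lemma coord_limit: "\<exists>x. \<forall>k. coord y k \<le> x \<and> x \<le> coord y k + 2 / real (N (Suc k))"
proof -
  have step: "coord y (Suc k) = coord y k + real (bit y (Suc k)) / real (N (Suc k))" for k
    using N[of k] q[of k] by (simp add: coord_def N_Suc field_simps)
  have inc: "incseq (coord y)"
    by (rule incseq_SucI) (simp add: step)
  define u where "u k = coord y k + 2 / real (N (Suc k))" for k
  have "decseq u"
  proof (rule decseq_SucI)
    fix k
    have "real (bit y (Suc k)) / real (N (Suc k)) \<le> 1 / real (N (Suc k))"
      using bit_le_1[of y "Suc k"] by (intro divide_right_mono) auto
    moreover have "2 / real (N (Suc (Suc k))) \<le> 1 / real (N (Suc k))"
    proof -
      have "2 * 1 * N (Suc k) \<le> 2 * q (Suc k) * N (Suc k)"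
        using q[of "Suc k"] by (intro mult_right_mono mult_left_mono) auto
      then have "real (2 * N (Suc k)) \<le> real (N (Suc (Suc k)))"
        unfolding N_Suc[of "Suc k"] by (intro of_nat_mono) simp
      then have "2 * real (N (Suc k)) \<le> real (N (Suc (Suc k)))"
        by simp
      then show ?thesis
        using N[of "Suc k"] N[of "Suc (Suc k)"] by (simp add: field_simps)
    qed
    ultimately show "u (Suc k) \<le> u k"
      by (simp add: u_def step)
  qed
  have le: "coord y n \<le> u k" for n k
  proof -
    have "coord y n \<le> coord y (max n k)"
      using inc by (simp add: incseq_def)
    also have "\<dots> \<le> u (max n k)"
      by (simp add: u_def)
    also have "\<dots> \<le> u k"
      using \<open>decseq u\<close> by (simp add: decseq_def)
    finally show ?thesis .
  qed
  obtain x where x: "coord y \<longlonglongrightarrow> x" "\<And>n. coord y n \<le> x"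
    using incseq_convergent[OF inc, of "u 0"] le by blast
  have "x \<le> u k" for k
    by (rule LIMSEQ_le_const2[OF x(1)]) (use le in blast)
  then show ?thesis
    using x(2) by (auto simp: u_def)
qed

text \<open>All discs of each scale are taken, not only those reached by addresses; their total area
  already tends to 0.\<close>

definition cantor_set :: "(real^2) set" where
  "cantor_set = (\<Inter>k. \<Union>i\<in>I k. cball (ctr k i) (R k))"

lemma cantor_set_null: "cantor_set \<in> null_sets lebesgue"
proof -
  have bor: "cantor_set \<in> sets lborel"
    unfolding cantor_set_def by (intro sets.countable_INT' sets.finite_UN) auto
  have le: "emeasure lborel cantor_set \<le> ennreal (pi * (1 / 4) ^ k)" for k
  proof -
    have "emeasure lborel cantor_set \<le> emeasure lborel (\<Union>i\<in>I k. cball (ctr k i) (R k))"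
      unfolding cantor_set_def by (intro emeasure_mono) (auto intro!: sets.finite_UN)
    also have "\<dots> \<le> (\<Sum>i\<in>I k. emeasure lborel (cball (ctr k i) (R k)))"
      by (rule emeasure_subadditive_finite) auto
    also have "\<dots> = (\<Sum>i\<in>I k. ennreal (pi * (R k)\<^sup>2))"
      by (simp add: emeasure_cball less_imp_le[OF R_pos] unit_ball_vol_2)
    also have "\<dots> = ennreal (real (card (I k)) * (pi * (R k)\<^sup>2))"
      by (simp add: ennreal_mult ennreal_of_nat_eq_real_of_nat)
    also have "real (card (I k)) * (pi * (R k)\<^sup>2) = pi * (real (N k) * R k)\<^sup>2"
      by (simp add: card_I power_mult_distrib)
    also have "real (N k) * R k = (1 / 2) ^ k / 4"
      using N[of k] by (simp add: R_def)
    also have "ennreal (pi * ((1 / 2) ^ k / 4)\<^sup>2) \<le> ennreal (pi * (1 / 4) ^ k)"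
      by (intro ennreal_leI mult_left_mono)
        (simp_all add: power_divide power_mult[symmetric] mult.commute[of k 2] power_mult divide_simps)
    finally show ?thesis .
  qed
  have "(\<lambda>k. ennreal (pi * (1 / 4) ^ k)) \<longlonglongrightarrow> ennreal (pi * 0)"
    by (intro tendsto_ennrealI tendsto_intros LIMSEQ_power_zero) simp
  then have "emeasure lborel cantor_set \<le> ennreal (pi * 0)"
    by (rule LIMSEQ_le_const) (use le in blast)
  then have "cantor_set \<in> null_sets lborel"
    using bor by (simp add: null_sets_def)
  then show ?thesis
    by (rule null_sets_completionI)
qed

text \<open>The limit of the two address sequences lies at every scale on the plateau of the
  addressed bump, and the other bumps of that scale vanish there. The last two coordinates therefore
  sum exactly the prescribed digits.\<close>

lemma exists_preimage:
  assumes y: "0 \<le> y1" "y1 < 1" "0 \<le> y2" "y2 < 1"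
  shows "\<exists>x\<in>cantor_set. f x $ 3 = y1 \<and> f x $ 4 = y2"
proof -
  obtain x1 x2 where x1: "\<And>k. coord y1 k \<le> x1 \<and> x1 \<le> coord y1 k + 2 / real (N (Suc k))"
    and x2: "\<And>k. coord y2 k \<le> x2 \<and> x2 \<le> coord y2 k + 2 / real (N (Suc k))"
    using coord_limit by metis
  define x :: "real^2" where "x = vector [x1, x2]"
  define i where "i k = (address y1 k, address y2 k)" for k
  have iI: "i k \<in> I k" for k
    by (simp add: i_def I_def address_less)
  have near: "norm (x - ctr k (i k)) \<le> R k * sqrt (\<tau> k)" for k
  proof -
    have "norm (x - ctr k (i k)) \<le> \<bar>x1 - coord y1 k\<bar> + \<bar>x2 - coord y2 k\<bar>"
      using norm_le_l1_cart[of "x - ctr k (i k)"] by (simp add: sum_2 x_def ctr_def i_def coord_def)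
    also have "\<dots> \<le> 4 / real (N (Suc k))"
      using x1[of k] x2[of k] by simp
    also have "\<dots> \<le> R k * sqrt (\<tau> k)"
      using gap[of k] N[of "Suc k"] by (simp add: field_simps)
    finally show ?thesis .
  qed
  have nearR: "norm (x - ctr k (i k)) \<le> R k" for k
  proof -
    have "R k * sqrt (\<tau> k) \<le> R k * 1"
      using \<tau>[of k] R_pos[of k] by (intro mult_left_mono) auto
    then show ?thesis
      using near[of k] by simp
  qed
  have "\<eta> (e k) (t k (i k) x) = 1" for k
  proof (rule \<eta>_inside[OF t_pos(1)])
    have "norm (x - ctr k (i k)) / R k \<le> sqrt (\<tau> k)"
      using near[of k] R_pos[of k] by (simp add: field_simps)
    then have "(norm (x - ctr k (i k)) / R k)\<^sup>2 \<le> (sqrt (\<tau> k))\<^sup>2"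
      using R_pos[of k] by (intro power_mono) auto
    then show "t k (i k) x \<le> 2 * \<tau> k"
      using \<tau>[of k] by (simp add: t_def arg_def)
  qed
  then have F: "F k x $ 3 = (1 / 2) ^ k * real (bit y1 k)" "F k x $ 4 = (1 / 2) ^ k * real (bit y2 k)" for k
    using F_34[OF iI nearR, of k] y by (simp_all add: wt_def i_def address_mod_2)
  have "summable (\<lambda>k. F k x)"
  proof (rule summable_comparison_test'[of _ 0])
    show "summable (\<lambda>k. (1 / 2 :: real) ^ k * (2 * norm x + 10))"
      by (intro summable_mult2 summable_geometric) simp
  qed (rule norm_F_le)
  then have "f x $ 3 = y1" "f x $ 4 = y2"
    unfolding f_def using sums_bits[OF y(1,2)] sums_bits[OF y(3,4)]
    by (simp_all add: bounded_linear.suminf[OF bounded_linear_vec_nth] F sums_iff)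
  moreover have "x \<in> cantor_set"
    using iI nearR by (force simp: cantor_set_def dist_norm norm_minus_commute)
  ultimately show ?thesis
    by blast
qed

text \<open>Projection to the last two coordinates is a contraction, and the image of the null
  Cantor set projects onto a set containing a disc.\<close>

lemma not_lusin_N_f: "\<not> lusin_N UNIV f"
proof
  assume "lusin_N UNIV f"
  then have "hausdorff_measure CARD(2) (f ` cantor_set) = 0"
    unfolding lusin_N_def using cantor_set_null by blast
  moreover define Q :: "real^4 \<Rightarrow> real^2" where "Q z = vector [z $ 3, z $ 4]" for z
  have "hausdorff_measure DIM(real^2) (f ` cantor_set) \<noteq> 0"
  proof (rule hausdorff_measure_contraction_nonzero)
    show "dist (Q v) (Q w) \<le> dist v w" for v w
    proof -
      have "(norm (Q v - Q w))\<^sup>2 \<le> (norm (v - w))\<^sup>2"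
        unfolding norm_real2_square
        by (simp add: Q_def norm_vec_def[of "v - w"] L2_set_def sum_4)
      then show ?thesis
        unfolding dist_norm by (rule power2_le_imp_le) simp
    qed
    show "ball (vector [1 / 2, 1 / 2]) (1 / 4) \<subseteq> Q ` f ` cantor_set"
    proof
      fix y :: "real^2"
      assume "y \<in> ball (vector [1 / 2, 1 / 2]) (1 / 4)"
      then have n: "norm (y - vector [1 / 2, 1 / 2]) < 1 / 4"
        by (simp add: dist_norm norm_minus_commute)
      have "\<bar>y $ 1 - 1 / 2\<bar> < 1 / 4" "\<bar>y $ 2 - 1 / 2\<bar> < 1 / 4"
        using le_less_trans[OF component_le_norm_cart n, of 1] le_less_trans[OF component_le_norm_cart n, of 2]
        by simp_all
      then have "0 \<le> y $ 1" "y $ 1 < 1" "0 \<le> y $ 2" "y $ 2 < 1"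
        by linarith+
      from exists_preimage[OF this] obtain x where x: "x \<in> cantor_set" "f x $ 3 = y $ 1" "f x $ 4 = y $ 2"
        by blast
      have "Q (f x) = y"
        using x exhaust_2 by (simp add: Q_def vec_eq_iff forall_2)
      then show "y \<in> Q ` f ` cantor_set"
        using x(1) by blast
    qed
  qed simp
  ultimately show False
    by simp
qed

end

section \<open>Choice of the parameters\<close>

theorem theorem1p2:
  fixes lam :: real
  assumes "lam < 2"
  shows "\<exists>(f :: real^2 \<Rightarrow> real^4) (K :: real^2 \<Rightarrow> ereal).
           continuous_on UNIV f \<and>
           finite_distortion_curve UNIV dy1_dy2 f K \<and>
           W1p_loc 2 UNIV f \<and>
           Lp_loc 1 UNIV (\<lambda>x. exp (lam * real_of_ereal (K x))) \<and>
           \<not> lusin_N UNIV f"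
proof -
  \<comment> \<open>\<open>lam\<close> may be small or negative. Raising it to at least 1 gives
    \<mu> > 1, so that 1 / \<mu> is a valid upper bound for \<open>b\<close>.\<close>
  define L \<mu> where "L = max lam 1" and "\<mu> = (L + 2) / 2"
  have L: "1 \<le> L" "L < 2" "lam \<le> L"
    using assms by (auto simp: L_def)
  then have \<mu>: "L < \<mu>" "\<mu> < 2" "1 < \<mu>"
    by (auto simp: \<mu>_def)
  \<comment> \<open>\<mu> < 2 leaves room between 1/2, which the bumps require, and 1 / \<mu>, which
    exponential integrability requires.\<close>
  define b where "b = (1 / 2 + 1 / \<mu>) / 2"
  have "1 / 2 < 1 / \<mu>" "1 / \<mu> < 1"
    using \<mu> by (auto simp: field_simps)
  then have b: "1 / 2 < b" "b < 1" "b < 1 / \<mu>"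
    by (auto simp: b_def)
  then have \<mu>b: "\<mu> * b < 1"
    using \<mu> by (simp add: field_simps)
  \<comment> \<open>The root solves L (1 + 8 \<epsilon>^2) = \<mu>, so the gap between
    \<open>L\<close> and \<mu> pays for the rows of the bumps.\<close>
  define \<epsilon> where "\<epsilon> = min 1 (sqrt ((\<mu> / L - 1) / 8))"
  have "1 < \<mu> / L"
    using L \<mu> by simp
  then have \<epsilon>: "0 < \<epsilon>" "\<epsilon> \<le> 1"
    by (auto simp: \<epsilon>_def)
  have "\<epsilon>\<^sup>2 \<le> (sqrt ((\<mu> / L - 1) / 8))\<^sup>2"
    using \<epsilon> by (intro power_mono) (auto simp: \<epsilon>_def)
  then have "1 + 8 * \<epsilon>\<^sup>2 \<le> \<mu> / L"
    using \<open>1 < \<mu> / L\<close> by simp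
  then have "L * (1 + 8 * \<epsilon>\<^sup>2) \<le> \<mu>"
    using L by (simp add: field_simps)
  moreover have "lam * (1 + 8 * \<epsilon>\<^sup>2) \<le> L * (1 + 8 * \<epsilon>\<^sup>2)"
    using L by (intro mult_right_mono) auto
  ultimately have lam: "lam * (1 + 8 * \<epsilon>\<^sup>2) \<le> \<mu>"
    by linarith
  interpret P: stretching_profile b
    using b by unfold_locales
  define Rf where "Rf k n = (1 / 2 :: real) ^ k / (4 * real n)" for k n
  define ef where "ef k n = \<epsilon> * ((1 / 2) ^ k / (real n)\<^sup>2) * Rf k n / 4" for k n
  define good where "good k n \<tau> \<longleftrightarrow> 0 < \<tau> \<and> \<tau> \<le> 1 / 2 \<and> (\<forall>s. 0 < s \<and> s \<le> 2 * \<tau> \<longrightarrow> P.\<eta> (ef k n) s = 1)"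
    for k n \<tau>
  \<comment> \<open>Chosen for all pairs of a scale and a grid size at once, because the recursion
    for \<open>N\<close> uses it.\<close>
  define \<tau>f where "\<tau>f k n = (SOME \<tau>. good k n \<tau>)" for k n
  have "good k n (\<tau>f k n)" if "0 < n" for k n
    unfolding \<tau>f_def
  proof (rule someI_ex)
    have "0 < ef k n"
      using that \<epsilon> by (simp add: ef_def Rf_def)
    then show "\<exists>\<tau>. good k n \<tau>"
      unfolding good_def by (rule P.\<eta>_eq_1_near_0)
  qed
  then have \<tau>f: "0 < \<tau>f k n" "\<tau>f k n \<le> 1 / 2" "\<And>s. 0 < s \<Longrightarrow> s \<le> 2 * \<tau>f k n \<Longrightarrow> P.\<eta> (ef k n) s = 1"
    if "0 < n" for k n
    using that unfolding good_def by blast+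
  define qf where "qf k n = nat \<lceil>4 / (Rf k n * sqrt (\<tau>f k n))\<rceil>" for k n
  define N where "N = rec_nat 1 (\<lambda>k n. 2 * qf k n * n)"
  have N_Suc: "N (Suc k) = 2 * qf k (N k) * N k" for k
    by (simp add: N_def)
  have pos: "0 < Rf k n * sqrt (\<tau>f k n)" if "0 < n" for k n
    using that \<tau>f(1)[OF that] by (simp add: Rf_def)
  have qf_pos: "0 < qf k n" if "0 < n" for k n
    using pos[OF that, of k] by (simp add: qf_def)
  have N_pos: "0 < N k" for k
    by (induction k) (auto simp: N_Suc qf_pos, simp add: N_def)
  define \<tau> where "\<tau> k = \<tau>f k (N k)" for k
  interpret M: multiscale b \<epsilon> N \<tau>
    using \<epsilon> N_pos \<tau>f(1,2)[OF N_pos] by unfold_locales (auto simp: \<tau>_def)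
  have R_eq: "M.R k = Rf k (N k)" and e_eq: "M.e k = ef k (N k)" for k
    by (simp_all add: M.R_def M.e_def M.c_def Rf_def ef_def)
  interpret C: multiscale_cantor b \<epsilon> N \<tau> "\<lambda>k. qf k (N k)"
  proof unfold_locales
    show "P.\<eta> (M.e k) s = 1" if "0 < s" "s \<le> 2 * \<tau> k" for k s
      using that \<tau>f(3)[OF N_pos] by (simp add: e_eq \<tau>_def)
    show "N (Suc k) = 2 * qf k (N k) * N k" "0 < qf k (N k)" for k
      using N_Suc qf_pos[OF N_pos] by auto
    show "4 \<le> real (N (Suc k)) * (M.R k * sqrt (\<tau> k))" for k
    proof -
      let ?r = "Rf k (N k) * sqrt (\<tau>f k (N k))"
      have "4 / ?r \<le> real (qf k (N k))"
        unfolding qf_def by (rule real_nat_ceiling_ge)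
      also have "\<dots> \<le> real (N (Suc k))"
      proof -
        have "qf k (N k) * 1 \<le> qf k (N k) * (2 * N k)"
          using N_pos[of k] by (intro mult_left_mono) auto
        then have "qf k (N k) \<le> N (Suc k)"
          by (simp add: N_Suc mult_ac)
        then show ?thesis
          by simp
      qed
      finally show ?thesis
        using pos[OF N_pos, of k] by (simp add: R_eq \<tau>_def field_simps)
    qed
  qed
  have "0 < \<mu>"
    using \<mu> by simp
  then show ?thesis
    using M.f_weak_derivative(1) M.finite_distortion_f[OF _ \<mu>b] M.W1p_loc_f(1)
      M.exp_distortion_integrable[OF _ \<mu>b lam] C.not_lusin_N_f by blast
qed

end
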